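(* Let $J,M,d\geq1$ and $N>M$ be standard natural numbers. For each $m=1,\dots,M$ let $F_1^{(m)},\dots,F_J^{(m)}$ be finite non-empty subsets of $\mathbb{Z}^d$ and $E^{(m)}$ a periodic subset of $\mathbb{Z}^d$. Define $\tilde F_j\coloneqq\biguplus_{m=1}^M F_j^{(m)}\times\{m\}\subset\mathbb{Z}^d\times\mathbb{Z}$ for $j=1,\dots,J$ and the periodic set $\tilde E\coloneqq\biguplus_{m=1}^M E^{(m)}\times(N\mathbb{Z}+m)\subset\mathbb{Z}^d\times\mathbb{Z}$. Then: (i) the system of tiling equations $\operatorname{Tile}(F_1^{(m)},\dots,F_J^{(m)};E^{(m)})$, $m=1,\dots,M$, is aperiodic if and only if the tiling equation $\operatorname{Tile}(\tilde F_1,\dots,\tilde F_J;\tilde E)$ is aperiodic; (ii) that system is undecidable if and only if $\operatorname{Tile}(\tilde F_1,\dots,\tilde F_J;\tilde E)$ is undecidable.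
   Context: A subset of $\mathbb{Z}^k$ is periodic if it is a finite union of cosets of a finite-index subgroup. For subsets $A,F$, $A\oplus F$ is $\{a+f\}$ if all sums are distinct and undefined otherwise; $A\uplus B$ is $A\cup B$ if disjoint and undefined otherwise; equations with undefined terms are false. $\operatorname{Tile}(F_1,\dots,F_J;E)$ is the equation $\biguplus_{j=1}^J X_j\oplus F_j=E$ in unknown sets $X_1,\dots,X_J$. A system of such equations with common unknowns is undecidable if the sentence asserting a common solution exists is not provable in ZFC (equivalently, as the paper puts it, a common solution exists in some universes of ZFC and not in others); it is aperiodic if, in the standard universe, a common solution exists but none with all $X_j$ periodic. *)

theory Defs
  imports "HOL-Algebra.Product_Groups" "HOL-Algebra.Coset" "HOL-Library.List_Lexorder"
    "HOL-Library.Disjoint_Sets"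
begin

section \<open>Tilings of the lattices $\mathbb{Z}^k$\<close>

text \<open>
  The lattice is the library's product of k copies of the integers; its elements are the
  functions in the extensional product over the indices below k. A pair (v, n) of
  a vector of dimension d and an integer is the vector v(d := n) of dimension d + 1.
\<close>

definition lattice_group :: "nat \<Rightarrow> (nat \<Rightarrow> int) monoid"
  where "lattice_group k = product_group {..<k} (\<lambda>_. integer_group)"

definition times_lattice :: "nat \<Rightarrow> (nat \<Rightarrow> int) set \<Rightarrow> int set \<Rightarrow> (nat \<Rightarrow> int) set"
  where "times_lattice d A B = {v(d := n) | v n. v \<in> A \<and> n \<in> B}"

text \<open>Finite unions of cosets of a subgroup of finite index (the union is automatically finite).\<close>

definition periodic_set :: "('a, 'b) monoid_scheme \<Rightarrow> 'a set \<Rightarrow> bool"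
  where "periodic_set G A \<longleftrightarrow>
    (\<exists>H. subgroup H G \<and> finite (rcosets\<^bsub>G\<^esub> H) \<and> (\<exists>C. C \<subseteq> rcosets\<^bsub>G\<^esub> H \<and> A = \<Union>C))"

text \<open>
  An equation between partially defined expressions is false if a term is undefined. So the
  equation demands that every direct sum is defined (all sums are distinct), that the union
  of these sums is defined (they are pairwise disjoint), and that it equals E.
\<close>

definition direct_sum_defined :: "('a, 'b) monoid_scheme \<Rightarrow> 'a set \<Rightarrow> 'a set \<Rightarrow> bool"
  where "direct_sum_defined G A F \<longleftrightarrow> inj_on (\<lambda>(a, f). a \<otimes>\<^bsub>G\<^esub> f) (A \<times> F)"

definition solves_tile ::
    "('a, 'b) monoid_scheme \<Rightarrow> nat \<Rightarrow> (nat \<Rightarrow> 'a set) \<Rightarrow> 'a set \<Rightarrow> (nat \<Rightarrow> 'a set) \<Rightarrow> bool"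
  where "solves_tile G J F E X \<longleftrightarrow>
    (\<forall>j\<in>{1..J}. X j \<subseteq> carrier G) \<and>
    (\<forall>j\<in>{1..J}. direct_sum_defined G (X j) (F j)) \<and>
    disjoint_family_on (\<lambda>j. X j <#>\<^bsub>G\<^esub> F j) {1..J} \<and>
    (\<Union>j\<in>{1..J}. X j <#>\<^bsub>G\<^esub> F j) = E"

text \<open>A system has equations m = 1, ..., M, with tiles F m 1, ..., F m J and right-hand side E m.\<close>

definition solves_system ::
    "nat \<Rightarrow> nat \<Rightarrow> nat \<Rightarrow> (nat \<Rightarrow> nat \<Rightarrow> (nat \<Rightarrow> int) set) \<Rightarrow> (nat \<Rightarrow> (nat \<Rightarrow> int) set) \<Rightarrow>
     (nat \<Rightarrow> (nat \<Rightarrow> int) set) \<Rightarrow> bool"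
  where "solves_system k J M F E X \<longleftrightarrow>
    (\<forall>m\<in>{1..M}. solves_tile (lattice_group k) J (F m) (E m) X)"

definition aperiodic_system ::
    "nat \<Rightarrow> nat \<Rightarrow> nat \<Rightarrow> (nat \<Rightarrow> nat \<Rightarrow> (nat \<Rightarrow> int) set) \<Rightarrow> (nat \<Rightarrow> (nat \<Rightarrow> int) set) \<Rightarrow> bool"
  where "aperiodic_system k J M F E \<longleftrightarrow>
    (\<exists>X. solves_system k J M F E X) \<and>
    \<not> (\<exists>X. solves_system k J M F E X \<and> (\<forall>j\<in>{1..J}. periodic_set (lattice_group k) (X j)))"


section \<open>Provability in ZFC\<close>

text \<open>First-order formulas over membership and equality, with de Bruijn indices.\<close>

datatype fm =
    Mem nat nat  (infix "\<^bold>\<in>" 50)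
  | Eq nat nat   (infix "\<^bold>=" 50)
  | Bot          ("\<^bold>\<bottom>")
  | Imp fm fm    (infixr "\<^bold>\<longrightarrow>" 25)
  | All fm       ("\<^bold>\<forall> _" [40] 40)

abbreviation Neg ("\<^bold>\<not> _" [40] 40) where "\<^bold>\<not> p \<equiv> p \<^bold>\<longrightarrow> \<^bold>\<bottom>"
abbreviation Dis (infixr "\<^bold>\<or>" 30) where "p \<^bold>\<or> q \<equiv> \<^bold>\<not> p \<^bold>\<longrightarrow> q"
abbreviation Con (infixr "\<^bold>\<and>" 35) where "p \<^bold>\<and> q \<equiv> \<^bold>\<not> (p \<^bold>\<longrightarrow> \<^bold>\<not> q)"
abbreviation Iff (infixr "\<^bold>\<longleftrightarrow>" 25) where "p \<^bold>\<longleftrightarrow> q \<equiv> (p \<^bold>\<longrightarrow> q) \<^bold>\<and> (q \<^bold>\<longrightarrow> p)"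
abbreviation Exi ("\<^bold>\<exists> _" [40] 40) where "\<^bold>\<exists> p \<equiv> \<^bold>\<not> (\<^bold>\<forall> (\<^bold>\<not> p))"

definition conjs :: "fm list \<Rightarrow> fm" where "conjs ps = foldr Con ps (\<^bold>\<not> \<^bold>\<bottom>)"
definition disjs :: "fm list \<Rightarrow> fm" where "disjs ps = foldr Dis ps \<^bold>\<bottom>"

fun lift_ren :: "(nat \<Rightarrow> nat) \<Rightarrow> nat \<Rightarrow> nat"
  where "lift_ren r 0 = 0"
  | "lift_ren r (Suc i) = Suc (r i)"

primrec ren :: "(nat \<Rightarrow> nat) \<Rightarrow> fm \<Rightarrow> fm"
  where "ren r (i \<^bold>\<in> j) = (r i \<^bold>\<in> r j)"
  | "ren r (i \<^bold>= j) = (r i \<^bold>= r j)"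
  | "ren r \<^bold>\<bottom> = \<^bold>\<bottom>"
  | "ren r (p \<^bold>\<longrightarrow> q) = (ren r p \<^bold>\<longrightarrow> ren r q)"
  | "ren r (\<^bold>\<forall> p) = (\<^bold>\<forall> (ren (lift_ren r) p))"

abbreviation shift :: "fm \<Rightarrow> fm" where "shift \<equiv> ren Suc"

text \<open>Instantiation of the outermost variable by the variable i; the other indices drop by one.\<close>

definition inst :: "nat \<Rightarrow> fm \<Rightarrow> fm" where "inst i = ren (case_nat i (\<lambda>j. j))"

text \<open>
  A Hilbert calculus for classical first-order logic with equality. Because of the rule Gen, an
  axiom with free variables has the force of its universal closure.
\<close>

inductive proves :: "fm set \<Rightarrow> fm \<Rightarrow> bool" (infix "\<^bold>\<turnstile>" 20) for T :: "fm set"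
  where
    Ax:   "p \<in> T \<Longrightarrow> T \<^bold>\<turnstile> p"
  | MP:   "T \<^bold>\<turnstile> (p \<^bold>\<longrightarrow> q) \<Longrightarrow> T \<^bold>\<turnstile> p \<Longrightarrow> T \<^bold>\<turnstile> q"
  | Gen:  "T \<^bold>\<turnstile> p \<Longrightarrow> T \<^bold>\<turnstile> (\<^bold>\<forall> p)"
  | K:    "T \<^bold>\<turnstile> (p \<^bold>\<longrightarrow> q \<^bold>\<longrightarrow> p)"
  | S:    "T \<^bold>\<turnstile> ((p \<^bold>\<longrightarrow> q \<^bold>\<longrightarrow> r) \<^bold>\<longrightarrow> (p \<^bold>\<longrightarrow> q) \<^bold>\<longrightarrow> p \<^bold>\<longrightarrow> r)"
  | DN:   "T \<^bold>\<turnstile> (\<^bold>\<not> (\<^bold>\<not> p) \<^bold>\<longrightarrow> p)"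
  | Spec: "T \<^bold>\<turnstile> ((\<^bold>\<forall> p) \<^bold>\<longrightarrow> inst i p)"
  | Dist: "T \<^bold>\<turnstile> ((\<^bold>\<forall> (p \<^bold>\<longrightarrow> q)) \<^bold>\<longrightarrow> (\<^bold>\<forall> p) \<^bold>\<longrightarrow> (\<^bold>\<forall> q))"
  | Vac:  "T \<^bold>\<turnstile> (p \<^bold>\<longrightarrow> (\<^bold>\<forall> (shift p)))"
  | Refl: "T \<^bold>\<turnstile> (i \<^bold>= i)"
  | Leib: "T \<^bold>\<turnstile> ((i \<^bold>= j) \<^bold>\<longrightarrow> inst i p \<^bold>\<longrightarrow> inst j p)"

text \<open>
  In the formula builders below the arguments are indices of variables in the current context,
  so they grow by one under each quantifier.
\<close>

definition is_empty :: "nat \<Rightarrow> fm"    \<comment> \<open>$i = \emptyset$\<close>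
  where "is_empty i = (\<^bold>\<forall> (\<^bold>\<not> (0 \<^bold>\<in> Suc i)))"

definition is_succ :: "nat \<Rightarrow> nat \<Rightarrow> fm"    \<comment> \<open>$s = i \cup \{i\}$\<close>
  where "is_succ i s = (\<^bold>\<forall> ((0 \<^bold>\<in> Suc s) \<^bold>\<longleftrightarrow> ((0 \<^bold>\<in> Suc i) \<^bold>\<or> (0 \<^bold>= Suc i))))"

definition is_inductive :: "nat \<Rightarrow> fm"
  where "is_inductive i =
    ((\<^bold>\<exists> (is_empty 0 \<^bold>\<and> (0 \<^bold>\<in> Suc i))) \<^bold>\<and>
     (\<^bold>\<forall> ((0 \<^bold>\<in> Suc i) \<^bold>\<longrightarrow> (\<^bold>\<exists> (is_succ 1 0 \<^bold>\<and> (0 \<^bold>\<in> i + 2))))))"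

definition extensionality :: fm
  where "extensionality = (\<^bold>\<forall> (\<^bold>\<forall> ((\<^bold>\<forall> ((0 \<^bold>\<in> 2) \<^bold>\<longleftrightarrow> (0 \<^bold>\<in> 1))) \<^bold>\<longrightarrow> (1 \<^bold>= 0))))"

definition foundation :: fm
  where "foundation =
    (\<^bold>\<forall> ((\<^bold>\<exists> (0 \<^bold>\<in> 1)) \<^bold>\<longrightarrow> (\<^bold>\<exists> ((0 \<^bold>\<in> 1) \<^bold>\<and> \<^bold>\<not> (\<^bold>\<exists> ((0 \<^bold>\<in> 2) \<^bold>\<and> (0 \<^bold>\<in> 1)))))))"

definition pairing :: fm
  where "pairing = (\<^bold>\<forall> (\<^bold>\<forall> (\<^bold>\<exists> ((2 \<^bold>\<in> 0) \<^bold>\<and> (1 \<^bold>\<in> 0)))))"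

definition union_axiom :: fm
  where "union_axiom = (\<^bold>\<forall> (\<^bold>\<exists> (\<^bold>\<forall> (\<^bold>\<forall> (((0 \<^bold>\<in> 1) \<^bold>\<and> (1 \<^bold>\<in> 3)) \<^bold>\<longrightarrow> (0 \<^bold>\<in> 2))))))"

definition powerset :: fm
  where "powerset = (\<^bold>\<forall> (\<^bold>\<exists> (\<^bold>\<forall> ((\<^bold>\<forall> ((0 \<^bold>\<in> 1) \<^bold>\<longrightarrow> (0 \<^bold>\<in> 3))) \<^bold>\<longrightarrow> (0 \<^bold>\<in> 1)))))"

definition infinity :: fm
  where "infinity = (\<^bold>\<exists> (is_inductive 0))"

text \<open>In p, index 0 is the element, 1 is the set being separated, and the rest are parameters.\<close>

definition separation :: "fm \<Rightarrow> fm"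
  where "separation p =
    (\<^bold>\<forall> (\<^bold>\<exists> (\<^bold>\<forall> ((0 \<^bold>\<in> 1) \<^bold>\<longleftrightarrow> ((0 \<^bold>\<in> 2) \<^bold>\<and> ren (lift_ren Suc) p)))))"

text \<open>
  In p, index 0 is the value, 1 is the argument, 2 is the domain, and the rest are parameters:
  if every x in A has exactly one y with p, then some B contains a suitable y for every x in A.
\<close>

definition replacement :: "fm \<Rightarrow> fm"
  where "replacement p =
    (\<^bold>\<forall> ((\<^bold>\<forall> ((0 \<^bold>\<in> 1) \<^bold>\<longrightarrow> (\<^bold>\<exists> (\<^bold>\<forall> (ren (lift_ren Suc) p \<^bold>\<longleftrightarrow> (0 \<^bold>= 1)))))) \<^bold>\<longrightarrow>
        (\<^bold>\<exists> (\<^bold>\<forall> ((0 \<^bold>\<in> 2) \<^bold>\<longrightarrow> (\<^bold>\<exists> ((0 \<^bold>\<in> 2) \<^bold>\<and> ren (lift_ren (lift_ren Suc)) p)))))))"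

text \<open>A set of pairwise disjoint non-empty sets has a transversal.\<close>

definition choice :: fm
  where "choice =
    (\<^bold>\<forall> (((\<^bold>\<forall> ((0 \<^bold>\<in> 1) \<^bold>\<longrightarrow> (\<^bold>\<exists> (0 \<^bold>\<in> 1)))) \<^bold>\<and>
         (\<^bold>\<forall> (\<^bold>\<forall> (((1 \<^bold>\<in> 2) \<^bold>\<and> (0 \<^bold>\<in> 2) \<^bold>\<and> (\<^bold>\<exists> ((0 \<^bold>\<in> 2) \<^bold>\<and> (0 \<^bold>\<in> 1)))) \<^bold>\<longrightarrow> (1 \<^bold>= 0))))) \<^bold>\<longrightarrow>
        (\<^bold>\<exists> (\<^bold>\<forall> ((0 \<^bold>\<in> 2) \<^bold>\<longrightarrow>
           (\<^bold>\<exists> (\<^bold>\<forall> (((0 \<^bold>\<in> 3) \<^bold>\<and> (0 \<^bold>\<in> 2)) \<^bold>\<longleftrightarrow> (0 \<^bold>= 1)))))))))"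

definition ZFC :: "fm set"
  where "ZFC = {extensionality, foundation, pairing, union_axiom, powerset, infinity, choice} \<union>
    range separation \<union> range replacement"


section \<open>The existence of a solution as a sentence of set theory\<close>

definition is_upair :: "nat \<Rightarrow> nat \<Rightarrow> nat \<Rightarrow> fm"    \<comment> \<open>$p = \{i, j\}$\<close>
  where "is_upair i j p = (\<^bold>\<forall> ((0 \<^bold>\<in> Suc p) \<^bold>\<longleftrightarrow> ((0 \<^bold>= Suc i) \<^bold>\<or> (0 \<^bold>= Suc j))))"

definition is_pair :: "nat \<Rightarrow> nat \<Rightarrow> nat \<Rightarrow> fm"    \<comment> \<open>$p = \{\{i\}, \{i, j\}\}$\<close>
  where "is_pair i j p =
    (\<^bold>\<exists> (\<^bold>\<exists> (is_upair (i + 2) (i + 2) 1 \<^bold>\<and> is_upair (i + 2) (j + 2) 0 \<^bold>\<and> is_upair 1 0 (p + 2))))"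

definition is_natural :: "nat \<Rightarrow> fm"    \<comment> \<open>$i \in \omega$\<close>
  where "is_natural i = (\<^bold>\<forall> (is_inductive 0 \<^bold>\<longrightarrow> (Suc i \<^bold>\<in> 0)))"

text \<open>
  Inside set theory the integers are the set $\{0, 1\} \times \omega$: the pair (0, n) stands for
  the integer n, and the pair (1, n) for the integer - n - 1.
\<close>

definition is_nonneg :: "nat \<Rightarrow> nat \<Rightarrow> fm"    \<comment> \<open>$a = (0, n)$\<close>
  where "is_nonneg n a = (\<^bold>\<exists> (is_empty 0 \<^bold>\<and> is_pair 0 (Suc n) (Suc a)))"

definition is_negative :: "nat \<Rightarrow> nat \<Rightarrow> fm"    \<comment> \<open>$a = (1, n)$\<close>
  where "is_negative n a =
    (\<^bold>\<exists> (\<^bold>\<exists> (is_empty 1 \<^bold>\<and> is_succ 1 0 \<^bold>\<and> is_pair 0 (n + 2) (a + 2))))"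

definition is_integer :: "nat \<Rightarrow> fm"
  where "is_integer a =
    (\<^bold>\<exists> (is_natural 0 \<^bold>\<and> (is_nonneg 0 (Suc a) \<^bold>\<or> is_negative 0 (Suc a))))"

definition is_int_succ :: "nat \<Rightarrow> nat \<Rightarrow> fm"    \<comment> \<open>$b = a + 1$\<close>
  where "is_int_succ a b =
    ((\<^bold>\<exists> (\<^bold>\<exists> (is_succ 1 0 \<^bold>\<and> is_nonneg 1 (a + 2) \<^bold>\<and> is_nonneg 0 (b + 2)))) \<^bold>\<or>
     (\<^bold>\<exists> (is_empty 0 \<^bold>\<and> is_negative 0 (Suc a) \<^bold>\<and> is_nonneg 0 (Suc b))) \<^bold>\<or>
     (\<^bold>\<exists> (\<^bold>\<exists> (is_succ 1 0 \<^bold>\<and> is_negative 0 (a + 2) \<^bold>\<and> is_negative 1 (b + 2)))))"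

primrec is_int_add_nat :: "nat \<Rightarrow> nat \<Rightarrow> nat \<Rightarrow> fm"
  where "is_int_add_nat 0 a b = (a \<^bold>= b)"
  | "is_int_add_nat (Suc n) a b = (\<^bold>\<exists> (is_int_succ (Suc a) 0 \<^bold>\<and> is_int_add_nat n 0 (Suc b)))"

text \<open>
  Only standard integers c are ever added, so b = a + c is expressed by iterating the successor.
\<close>

definition is_int_add :: "int \<Rightarrow> nat \<Rightarrow> nat \<Rightarrow> fm"    \<comment> \<open>$b = a + c$\<close>
  where "is_int_add c a b =
    (if 0 \<le> c then is_int_add_nat (nat c) a b else is_int_add_nat (nat (- c)) b a)"

definition is_int_const :: "int \<Rightarrow> nat \<Rightarrow> fm"    \<comment> \<open>$a = c$\<close>
  where "is_int_const c a =
    (\<^bold>\<exists> (\<^bold>\<exists> (is_empty 1 \<^bold>\<and> is_nonneg 1 0 \<^bold>\<and> is_int_add c 0 (a + 2))))"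

text \<open>
  The coset $n \mathbb{Z} + c$ is the least set that contains c and is closed under adding and
  subtracting n.
\<close>

definition is_int_cong :: "nat \<Rightarrow> int \<Rightarrow> nat \<Rightarrow> fm"    \<comment> \<open>$a \in n \mathbb{Z} + c$\<close>
  where "is_int_cong n c a =
    (\<^bold>\<forall> (((\<^bold>\<exists> (is_int_const c 0 \<^bold>\<and> (0 \<^bold>\<in> 1))) \<^bold>\<and>
         (\<^bold>\<forall> (\<^bold>\<forall> (((1 \<^bold>\<in> 2) \<^bold>\<and> (is_int_add (int n) 1 0 \<^bold>\<or> is_int_add (int n) 0 1)) \<^bold>\<longrightarrow> (0 \<^bold>\<in> 2)))))
        \<^bold>\<longrightarrow> (Suc a \<^bold>\<in> 0)))"

text \<open>
  Inside set theory a vector is a nested pair $(a_1, (a_2, \ldots (a_k, \emptyset)))$.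
  Standard vectors are given as lists of their coordinates.
\<close>

primrec is_vector :: "nat \<Rightarrow> nat \<Rightarrow> fm"    \<comment> \<open>$x \in \mathbb{Z}^k$\<close>
  where "is_vector 0 x = is_empty x"
  | "is_vector (Suc k) x =
      (\<^bold>\<exists> (\<^bold>\<exists> (is_integer 1 \<^bold>\<and> is_vector k 0 \<^bold>\<and> is_pair 1 0 (x + 2))))"

primrec is_vec_add :: "int list \<Rightarrow> nat \<Rightarrow> nat \<Rightarrow> fm"    \<comment> \<open>$y = x + cs$\<close>
  where "is_vec_add [] x y = (x \<^bold>= y)"
  | "is_vec_add (c # cs) x y =
      (\<^bold>\<exists> (\<^bold>\<exists> (\<^bold>\<exists> (\<^bold>\<exists> (is_pair 3 2 (x + 4) \<^bold>\<and> is_pair 1 0 (y + 4) \<^bold>\<and>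
        is_int_add c 3 1 \<^bold>\<and> is_vec_add cs 2 0)))))"

primrec is_vec_cong :: "nat \<Rightarrow> int list \<Rightarrow> nat \<Rightarrow> fm"    \<comment> \<open>$x \in n \mathbb{Z}^k + cs$\<close>
  where "is_vec_cong n [] x = is_empty x"
  | "is_vec_cong n (c # cs) x =
      (\<^bold>\<exists> (\<^bold>\<exists> (is_pair 1 0 (x + 2) \<^bold>\<and> is_int_cong n c 1 \<^bold>\<and> is_vec_cong n cs 0)))"

definition vec_list :: "nat \<Rightarrow> (nat \<Rightarrow> int) set \<Rightarrow> int list list"
  where "vec_list k A = sorted_list_of_set ((\<lambda>v. map v [0..<k]) ` A)"

text \<open>
  Every subgroup of finite index of $\mathbb{Z}^k$ contains $n \mathbb{Z}^k$ for some $n > 0$.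
  Hence a periodic set E is a finite union of cosets of $n \mathbb{Z}^k$, and this is how E is
  described in set theory: n is the least possible, and the cosets are given by their
  representatives in $\{0, \ldots, n-1\}^k$.
\<close>

definition least_period :: "nat \<Rightarrow> (nat \<Rightarrow> int) set \<Rightarrow> nat"
  where "least_period k E = (LEAST n. n > 0 \<and>
    (\<forall>v\<in>carrier (lattice_group k). \<forall>w\<in>carrier (lattice_group k).
       (\<forall>i<k. v i mod int n = w i mod int n) \<longrightarrow> v \<in> E \<longrightarrow> w \<in> E))"

definition coset_representatives :: "nat \<Rightarrow> (nat \<Rightarrow> int) set \<Rightarrow> (nat \<Rightarrow> int) set"
  where "coset_representatives k E = {v \<in> E. \<forall>i<k. 0 \<le> v i \<and> v i < int (least_period k E)}"

definition in_periodic :: "nat \<Rightarrow> (nat \<Rightarrow> int) set \<Rightarrow> nat \<Rightarrow> fm"    \<comment> \<open>$x \in E$\<close>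
  where "in_periodic k E x =
    disjs [is_vec_cong (least_period k E) r x. r \<leftarrow> vec_list k (coset_representatives k E)]"

text \<open>
  In the following formulas the unknowns $X_1, \ldots, X_J$ are the variables
  0, ..., J - 1 of the context. The first one says that
  $x + f = y + g$ with $x \in X_i$ and $y \in X_j$ implies p, where p may
  use the indices 2, 1, 0 for x, y and the common value.
\<close>

definition sums_coincide_only_if ::
    "fm \<Rightarrow> nat \<Rightarrow> int list \<Rightarrow> nat \<Rightarrow> int list \<Rightarrow> fm"
  where "sums_coincide_only_if p i f j g =
    (\<^bold>\<forall> (\<^bold>\<forall> (\<^bold>\<forall> (((2 \<^bold>\<in> (i - 1) + 3) \<^bold>\<and> (1 \<^bold>\<in> (j - 1) + 3) \<^bold>\<and> is_vec_add f 2 0 \<^bold>\<and> is_vec_add g 1 0)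
        \<^bold>\<longrightarrow> p))))"

definition tile_fm ::
    "nat \<Rightarrow> nat \<Rightarrow> (nat \<Rightarrow> (nat \<Rightarrow> int) set) \<Rightarrow> (nat \<Rightarrow> int) set \<Rightarrow> fm"
  where "tile_fm k J F E =
    (conjs [sums_coincide_only_if (if f = g then 2 \<^bold>= 1 else \<^bold>\<bottom>) j f j g.
       j \<leftarrow> [1..<Suc J], f \<leftarrow> vec_list k (F j), g \<leftarrow> vec_list k (F j)] \<^bold>\<and>
     conjs [sums_coincide_only_if \<^bold>\<bottom> i f j g.
       i \<leftarrow> [1..<Suc J], j \<leftarrow> [1..<Suc J], i \<noteq> j, f \<leftarrow> vec_list k (F i), g \<leftarrow> vec_list k (F j)] \<^bold>\<and>
     (\<^bold>\<forall> (is_vector k 0 \<^bold>\<longrightarrow>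
        (disjs [\<^bold>\<exists> ((0 \<^bold>\<in> (j - 1) + 2) \<^bold>\<and> is_vec_add f 0 1).
           j \<leftarrow> [1..<Suc J], f \<leftarrow> vec_list k (F j)]
         \<^bold>\<longleftrightarrow> in_periodic k E 0))))"

definition solvable_sentence ::
    "nat \<Rightarrow> nat \<Rightarrow> nat \<Rightarrow> (nat \<Rightarrow> nat \<Rightarrow> (nat \<Rightarrow> int) set) \<Rightarrow> (nat \<Rightarrow> (nat \<Rightarrow> int) set) \<Rightarrow> fm"
  where "solvable_sentence k J M F E =
    (Exi ^^ J)
      (conjs [\<^bold>\<forall> ((0 \<^bold>\<in> (j - 1) + 1) \<^bold>\<longrightarrow> is_vector k 0). j \<leftarrow> [1..<Suc J]] \<^bold>\<and>
       conjs [tile_fm k J (F m) (E m). m \<leftarrow> [1..<Suc M]])"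

text \<open>
  Undecidable: the sentence is not provable in ZFC. Independent: it is neither provable nor
  refutable, so that by the completeness theorem it holds in some universes of ZFC and fails in
  others. The two differ only for systems whose solvability ZFC refutes.
\<close>

definition undecidable_system ::
    "nat \<Rightarrow> nat \<Rightarrow> nat \<Rightarrow> (nat \<Rightarrow> nat \<Rightarrow> (nat \<Rightarrow> int) set) \<Rightarrow> (nat \<Rightarrow> (nat \<Rightarrow> int) set) \<Rightarrow> bool"
  where "undecidable_system k J M F E \<longleftrightarrow> \<not> (ZFC \<^bold>\<turnstile> solvable_sentence k J M F E)"

definition independent_system ::
    "nat \<Rightarrow> nat \<Rightarrow> nat \<Rightarrow> (nat \<Rightarrow> nat \<Rightarrow> (nat \<Rightarrow> int) set) \<Rightarrow> (nat \<Rightarrow> (nat \<Rightarrow> int) set) \<Rightarrow> bool"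
  where "independent_system k J M F E \<longleftrightarrow>
    \<not> (ZFC \<^bold>\<turnstile> solvable_sentence k J M F E) \<and> \<not> (ZFC \<^bold>\<turnstile> (\<^bold>\<not> solvable_sentence k J M F E))"


section \<open>Stacking a system into a single equation\<close>

definition stacked_tile ::
    "nat \<Rightarrow> nat \<Rightarrow> (nat \<Rightarrow> nat \<Rightarrow> (nat \<Rightarrow> int) set) \<Rightarrow> nat \<Rightarrow> (nat \<Rightarrow> int) set"
  where "stacked_tile d M F j = (\<Union>m\<in>{1..M}. times_lattice d (F m j) {int m})"

definition stacked_set ::
    "nat \<Rightarrow> nat \<Rightarrow> nat \<Rightarrow> (nat \<Rightarrow> (nat \<Rightarrow> int) set) \<Rightarrow> (nat \<Rightarrow> int) set"
  where "stacked_set d M N E =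
    (\<Union>m\<in>{1..M}. times_lattice d (E m) {int N * q + int m | q. True})"

text \<open>The unions are disjoint, as required.\<close>

lemma disjoint_stacked_tile:
  "disjoint_family_on (\<lambda>m. times_lattice d (F m j) {int m}) {1..M}"
  unfolding disjoint_family_on_def times_lattice_def by (auto dest: fun_cong[where x = d])

lemma disjoint_stacked_set:
  assumes "N > M"
  shows "disjoint_family_on (\<lambda>m. times_lattice d (E m) {int N * q + int m | q. True}) {1..M}"
proof -
  have "m = m'" if "m \<in> {1..M}" "m' \<in> {1..M}" "int N * q + int m = int N * q' + int m'"
    for m m' q q'
  proof -
    have "int m mod int N = int m' mod int N"
      using that(3) by (metis mod_mult_self4)
    then show ?thesis using that assms by simp
  qed
  moreover have "n = n'" if "v(d := n) = w(d := n')" for v w :: "nat \<Rightarrow> int" and n n'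
    using fun_cong[OF that, of d] by simp
  ultimately show ?thesis
    unfolding disjoint_family_on_def times_lattice_def by blast
qed

end

theory Submission
  imports Defs "HOL-Library.Countable_Set" "HOL-Algebra.FiniteProduct"
begin

text \<open>
  Provability is replaced by truth in all models of ZFC by means of the completeness theorem, so
  all three equivalences become statements about solutions. A solution of the system is lifted by
  $X_j \mapsto X_j \times N\mathbb{Z}$, and a solution of the stacked equation is restricted
  to the slice of height 0. The restriction works because every $\tilde X_j$ lives in heights
  divisible by N: if it meets height a, then $a + 1, \ldots, a + M$ all have residues in
  $\{1, \ldots, M\}$ modulo $N > M$. The argument only needs the action of the standard integers
  and the residues modulo standard moduli, so it also applies to the possibly nonstandard integers
  of a model of ZFC, provided that lifting and slicing preserve internal sets, just as they preserve
  periodic sets.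
\<close>

section \<open>Soundness and completeness\<close>

text \<open>The obstacle is nonstandard models. In them induction holds only for predicates given by
  sets of the model, so every induction on \<open>omega\<close> or on \<open>integers\<close> is
  accompanied by a formula defining its predicate, and even the uniqueness of residues has to be
  derived from the definition of a congruence class as a least closed set. Periodic right-hand sides
  stay manageable because membership is a condition on residues modulo a standard number. The two
  sentences use unrelated least periods; \<open>ext\<close> evaluates a periodic set through any of
  its periods and so removes this mismatch.

  The bound N > M leaves the residue 0 modulo N outside 1, ..., M, so the right-hand side of the
  stacked equation has empty layers at all heights divisible by N. These gaps are what pins every
  unknown to a single residue class of heights.

  Aperiodicity needs the transfer twice, for the existence of solutions and for the existence of
  periodic ones. Independence needs it for the sentence and for its negation; both follow from equal
  truth values in every model.\<close>

instance fm :: countable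
  by countable_datatype

section \<open>Satisfaction, renaming of variables and soundness\<close>

text \<open>Equality is interpreted by an arbitrary relation because in the Henkin model, whose
  elements are the variables, it is at first only a congruence.\<close>

primrec sat_eq :: "('a \<Rightarrow> 'a \<Rightarrow> bool) \<Rightarrow> ('a \<Rightarrow> 'a \<Rightarrow> bool) \<Rightarrow> (nat \<Rightarrow> 'a) \<Rightarrow> fm \<Rightarrow> bool"
  where "sat_eq eqv mem e (i \<^bold>\<in> j) \<longleftrightarrow> mem (e i) (e j)"
  | "sat_eq eqv mem e (i \<^bold>= j) \<longleftrightarrow> eqv (e i) (e j)"
  | "sat_eq eqv mem e \<^bold>\<bottom> \<longleftrightarrow> False"
  | "sat_eq eqv mem e (p \<^bold>\<longrightarrow> q) \<longleftrightarrow> (sat_eq eqv mem e p \<longrightarrow> sat_eq eqv mem e q)"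
  | "sat_eq eqv mem e (\<^bold>\<forall> p) \<longleftrightarrow> (\<forall>x. sat_eq eqv mem (case_nat x e) p)"

abbreviation sat :: "('a \<Rightarrow> 'a \<Rightarrow> bool) \<Rightarrow> (nat \<Rightarrow> 'a) \<Rightarrow> fm \<Rightarrow> bool"
  where "sat \<equiv> sat_eq (=)"

lemma lift_ren_eq: "lift_ren r = case_nat 0 (\<lambda>i. Suc (r i))"
  by (rule ext) (simp split: nat.split)

lemma comp_lift_ren: "lift_ren r \<circ> lift_ren s = lift_ren (r \<circ> s)"
  by (rule ext) (simp add: lift_ren_eq split: nat.split)

lemma ren_ren: "ren r (ren s p) = ren (r \<circ> s) p"
  by (induction p arbitrary: r s) (simp_all add: comp_lift_ren)

lemma lift_ren_id: "lift_ren (\<lambda>i. i) = (\<lambda>i. i)"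
  by (rule ext) (simp add: lift_ren_eq split: nat.split)

lemma ren_id: "ren (\<lambda>i. i) p = p"
  by (induction p) (simp_all add: lift_ren_id)

lemma size_ren [simp]: "size (ren r p) = size p"
  by (induction p arbitrary: r) simp_all

lemma ren_inst: "ren r (inst i p) = inst (r i) (ren (lift_ren r) p)"
  unfolding inst_def ren_ren
  by (rule arg_cong[where f = "\<lambda>r. ren r p"]) (auto simp: lift_ren_eq split: nat.split)

lemma ren_shift: "ren (lift_ren r) (shift p) = shift (ren r p)"
  unfolding ren_ren
  by (rule arg_cong[where f = "\<lambda>r. ren r p"]) (auto simp: lift_ren_eq split: nat.split)

lemma sat_eq_ren: "sat_eq eqv mem e (ren r p) = sat_eq eqv mem (e \<circ> r) p"
proof (induction p arbitrary: e r)
  case (All p)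
  have "case_nat x e \<circ> lift_ren r = case_nat x (e \<circ> r)" for x
    by (rule ext) (simp add: lift_ren_eq split: nat.split)
  then show ?case by (simp only: ren.simps sat_eq.simps All)
qed simp_all

lemma sat_eq_inst: "sat_eq eqv mem e (inst i p) = sat_eq eqv mem (case_nat (e i) e) p"
proof -
  have "e \<circ> case_nat i (\<lambda>j. j) = case_nat (e i) e"
    by (rule ext) (simp split: nat.split)
  then show ?thesis by (simp add: inst_def sat_eq_ren)
qed

lemma sat_eq_shift: "sat_eq eqv mem (case_nat x e) (shift p) = sat_eq eqv mem e p"
proof -
  have "case_nat x e \<circ> Suc = e" by (rule ext) simp
  then show ?thesis by (simp add: sat_eq_ren)
qed

text \<open>The axioms must hold in all environments: \<open>Gen\<close> closes them universally, so
  truth in a single environment would not survive that rule.\<close>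

theorem soundness:
  assumes "T \<^bold>\<turnstile> p" and "\<And>p e. p \<in> T \<Longrightarrow> sat mem e p"
  shows "sat mem e p"
  using assms(1)
proof (induction arbitrary: e)
  case (Ax p)
  then show ?case by (rule assms(2))
qed (auto simp: sat_eq_inst sat_eq_shift)

text \<open>The renaming need not be injective, since \<open>inst\<close> and \<open>shift\<close>
  commute with it. This is how a fresh variable is later turned into the index that
  \<open>Gen\<close> binds.\<close>

lemma proves_ren:
  assumes "T \<^bold>\<turnstile> p" and closed: "\<And>r p. p \<in> T \<Longrightarrow> ren r p \<in> T"
  shows "T \<^bold>\<turnstile> ren r p"
  using assms(1)
proof (induction arbitrary: r)
  case (Ax p)
  then show ?case by (intro proves.Ax closed)
next
  case (MP p q)
  then show ?case by (metis proves.MP ren.simps(4))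
next
  case (Spec p i)
  then show ?case by (simp add: ren_inst proves.Spec)
next
  case (Vac p)
  then show ?case by (simp add: ren_shift proves.Vac)
next
  case (Leib i j p)
  then show ?case by (simp add: ren_inst proves.Leib)
qed (auto intro: proves.Gen proves.K proves.S proves.DN proves.Dist proves.Refl)

primrec fv :: "fm \<Rightarrow> nat set"
  where "fv (i \<^bold>\<in> j) = {i, j}"
  | "fv (i \<^bold>= j) = {i, j}"
  | "fv \<^bold>\<bottom> = {}"
  | "fv (p \<^bold>\<longrightarrow> q) = fv p \<union> fv q"
  | "fv (\<^bold>\<forall> p) = Suc -` fv p"

lemma finite_fv: "finite (fv p)"
  by (induction p) (auto intro: finite_vimageI)

lemma ren_cong: "(\<And>i. i \<in> fv p \<Longrightarrow> r i = s i) \<Longrightarrow> ren r p = ren s p"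
proof (induction p arbitrary: r s)
  case (Imp p q)
  have "ren r p = ren s p" by (rule Imp.IH) (simp add: Imp.prems)
  moreover have "ren r q = ren s q" by (rule Imp.IH) (simp add: Imp.prems)
  ultimately show ?case by simp
next
  case (All p)
  have "ren (lift_ren r) p = ren (lift_ren s) p"
    by (rule All.IH) (auto simp: lift_ren_eq All.prems split: nat.split)
  then show ?case by simp
qed auto

subsection \<open>Derivations from finitely many hypotheses\<close>

text \<open>Hypotheses are added at the right end, so the deduction theorem holds by definition.\<close>

definition derives :: "fm set \<Rightarrow> fm list \<Rightarrow> fm \<Rightarrow> bool"
  where "derives T ps p \<longleftrightarrow> (T \<^bold>\<turnstile> foldr Imp ps p)"

lemma derives_snoc: "derives T (ps @ [q]) p \<longleftrightarrow> derives T ps (q \<^bold>\<longrightarrow> p)"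
  by (simp add: derives_def)

lemma derives_theorem: "T \<^bold>\<turnstile> p \<Longrightarrow> derives T ps p"
  unfolding derives_def by (induction ps) (simp_all add: proves.MP[OF proves.K])

lemma proves_id: "T \<^bold>\<turnstile> (p \<^bold>\<longrightarrow> p)"
  by (rule proves.MP[OF proves.MP[OF proves.S proves.K[of T p "p \<^bold>\<longrightarrow> p"]] proves.K])

lemma derives_MP:
  assumes "derives T ps (p \<^bold>\<longrightarrow> q)" "derives T ps p"
  shows "derives T ps q"
proof -
  have mono: "T \<^bold>\<turnstile> ((r \<^bold>\<longrightarrow> p) \<^bold>\<longrightarrow> (r \<^bold>\<longrightarrow> q))" if "T \<^bold>\<turnstile> (p \<^bold>\<longrightarrow> q)" for p q r
    by (rule proves.MP[OF proves.S proves.MP[OF proves.K that]])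
  have trans: "T \<^bold>\<turnstile> (p \<^bold>\<longrightarrow> r)" if "T \<^bold>\<turnstile> (p \<^bold>\<longrightarrow> q)" "T \<^bold>\<turnstile> (q \<^bold>\<longrightarrow> r)" for p q r
    by (rule proves.MP[OF mono[OF that(2)] that(1)])
  have "T \<^bold>\<turnstile> (foldr Imp ps (p \<^bold>\<longrightarrow> q) \<^bold>\<longrightarrow> (foldr Imp ps p \<^bold>\<longrightarrow> foldr Imp ps q))"
  proof (induction ps)
    case Nil
    show ?case by (simp add: proves_id)
  next
    case (Cons a ps)
    show ?case using trans[OF mono[OF Cons.IH, of a] proves.S] by simp
  qed
  with assms show ?thesis unfolding derives_def by (blast intro: proves.MP)
qed

lemma derives_weaken: "derives T ps p \<Longrightarrow> derives T (ps @ [q]) p"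
  unfolding derives_snoc by (rule derives_MP[OF derives_theorem[OF proves.K]])

lemma derives_weaken_append: "derives T ps p \<Longrightarrow> derives T (ps @ qs) p"
proof (induction qs rule: rev_induct)
  case (snoc q qs)
  then show ?case using derives_weaken[of T "ps @ qs" p q] by simp
qed simp

lemma derives_hyp: "derives T (ps @ [p]) p"
  unfolding derives_snoc by (intro derives_theorem proves_id)

text \<open>Generalization over an eigenvariable x. As \<open>Gen\<close> binds only the index 0,
  the whole derivation is renamed first, and then the quantifier is pushed past the
  hypotheses.\<close>

lemma derives_Gen:
  assumes closed: "\<And>r p. p \<in> T \<Longrightarrow> ren r p \<in> T"
    and der: "derives T ps (inst x p)"
    and fresh: "\<And>q. q \<in> set ps \<Longrightarrow> x \<notin> fv q" "x \<notin> fv (\<^bold>\<forall> p)"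
  shows "derives T ps (\<^bold>\<forall> p)"
proof -
  \<comment> \<open>On formulas without x this acts as \<open>shift\<close>, and it undoes the
    instantiation by x because it sends x to 0.\<close>
  define r where "r y = (if y = x then 0 else Suc y)" for y
  have ren_ps: "map (ren r) ps = map shift ps"
    using fresh(1) by (auto intro!: ren_cong simp: r_def)
  have "ren r (inst x p) = ren (\<lambda>i. i) p"
    unfolding inst_def ren_ren using fresh(2)
    by (intro ren_cong) (auto simp: r_def split: nat.split)
  then have ren_p: "ren r (inst x p) = p" by (simp add: ren_id)
  have "ren r (foldr Imp qs q) = foldr Imp (map (ren r) qs) (ren r q)" for qs q
    by (induction qs) simp_all
  then have "T \<^bold>\<turnstile> foldr Imp (map shift ps) p"
    using proves_ren[OF der[unfolded derives_def] closed, of r] ren_ps ren_p by simp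
  then have "T \<^bold>\<turnstile> (\<^bold>\<forall> foldr Imp (map shift ps) p)" by (rule proves.Gen)
  \<comment> \<open>\<open>Dist\<close> and \<open>Vac\<close> move the quantifier past one
    hypothesis at a time; hypotheses already passed are collected in \<open>rs\<close>.\<close>
  moreover have "T \<^bold>\<turnstile> foldr Imp qs (\<^bold>\<forall> p)" if "T \<^bold>\<turnstile> (\<^bold>\<forall> foldr Imp (map shift qs) p)" for qs
  proof -
    have "derives T rs (foldr Imp qs (\<^bold>\<forall> p))" if "derives T rs (\<^bold>\<forall> foldr Imp (map shift qs) p)" for rs
      using that
    proof (induction qs arbitrary: rs)
      case (Cons q qs)
      have "derives T rs ((\<^bold>\<forall> shift q) \<^bold>\<longrightarrow> (\<^bold>\<forall> foldr Imp (map shift qs) p))"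
        using derives_MP[OF derives_theorem[OF proves.Dist] Cons.prems[simplified]] by simp
      then have "derives T (rs @ [q]) ((\<^bold>\<forall> shift q) \<^bold>\<longrightarrow> (\<^bold>\<forall> foldr Imp (map shift qs) p))"
        by (rule derives_weaken)
      moreover have "derives T (rs @ [q]) (\<^bold>\<forall> shift q)"
        by (rule derives_MP[OF derives_theorem[OF proves.Vac] derives_hyp])
      ultimately have "derives T (rs @ [q]) (foldr Imp qs (\<^bold>\<forall> p))"
        by (intro Cons.IH) (rule derives_MP)
      then show ?case by (simp add: derives_snoc)
    qed simp
    from this[of "[]"] that show ?thesis by (simp add: derives_def)
  qed
  ultimately show ?thesis by (simp add: derives_def)
qed

subsection \<open>The Henkin construction\<close>

text \<open>The variables themselves serve as Henkin constants.\<close>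

definition fresh :: "fm list \<Rightarrow> nat"
  where "fresh ps = (SOME x. \<forall>p\<in>set ps. x \<notin> fv p)"

lemma fresh: "p \<in> set ps \<Longrightarrow> fresh ps \<notin> fv p"
proof -
  have "finite (\<Union>p\<in>set ps. fv p)" by (simp add: finite_fv)
  then obtain x where "x \<notin> (\<Union>p\<in>set ps. fv p)" using ex_new_if_finite infinite_UNIV_nat by blast
  then have "\<forall>p\<in>set ps. x \<notin> fv p" by blast
  then have "\<forall>p\<in>set ps. fresh ps \<notin> fv p" unfolding fresh_def by (rule someI)
  then show "p \<in> set ps \<Longrightarrow> fresh ps \<notin> fv p" by blast
qed

text \<open>Only negated universal formulas need a counterexample. Its variable avoids q as well as
  the earlier formulas, which is the side condition of \<open>derives_Gen\<close>; it exists because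
  each stage is a finite list.\<close>

definition witness :: "fm list \<Rightarrow> fm \<Rightarrow> fm list"
  where "witness ps q = (case q of (\<^bold>\<forall> p) \<^bold>\<longrightarrow> \<^bold>\<bottom> \<Rightarrow> [\<^bold>\<not> inst (fresh (q # ps)) p] | _ \<Rightarrow> [])"

primrec henkin :: "fm set \<Rightarrow> fm \<Rightarrow> nat \<Rightarrow> fm list"
  where "henkin T p 0 = [p]"
  | "henkin T p (Suc n) =
      (let ps = henkin T p n; q = from_nat n in
       if derives T ps (\<^bold>\<not> q) then ps else ps @ q # witness ps q)"

definition henkin_theory :: "fm set \<Rightarrow> fm \<Rightarrow> fm set"
  where "henkin_theory T p = {q. \<exists>n. derives T (henkin T p n) q}"

context
  fixes T :: "fm set" and h :: fm
  assumes closed: "\<And>r p. p \<in> T \<Longrightarrow> ren r p \<in> T"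
    and consistent: "\<not> (T \<^bold>\<turnstile> (\<^bold>\<not> h))"
begin

text \<open>A witness cannot introduce an inconsistency: it would make the instance at a fresh
  variable derivable, hence the universal formula whose negation has just been added.\<close>

lemma henkin_consistent: "\<not> derives T (henkin T h n) \<^bold>\<bottom>"
proof (induction n)
  case 0
  then show ?case using consistent by (simp add: derives_def)
next
  case (Suc n)
  define ps where "ps = henkin T h n"
  define q :: fm where "q = from_nat n"
  show ?case
  proof (cases "derives T ps (\<^bold>\<not> q)")
    case True
    then show ?thesis using Suc by (simp add: ps_def q_def Let_def)
  next
    case False
    then have *: "\<not> derives T (ps @ [q]) \<^bold>\<bottom>" by (simp add: derives_snoc)
    have "\<not> derives T (ps @ q # witness ps q) \<^bold>\<bottom>"
    proof (cases "\<exists>p. q = (\<^bold>\<not> (\<^bold>\<forall> p))")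
      case True
      then obtain p where q: "q = (\<^bold>\<not> (\<^bold>\<forall> p))" by blast
      define x where "x = fresh (q # ps)"
      have x: "x \<notin> fv r" if "r \<in> set (ps @ [q])" for r
        using fresh[of r "q # ps"] that by (auto simp: x_def)
      have False if "derives T ((ps @ [q]) @ [\<^bold>\<not> inst x p]) \<^bold>\<bottom>"
      proof -
        have "derives T (ps @ [q]) (inst x p)"
          using that unfolding derives_snoc[of T "ps @ [q]"]
          by (rule derives_MP[OF derives_theorem[OF proves.DN]])
        moreover have "x \<notin> fv (\<^bold>\<forall> p)" using x[of q] by (simp add: q)
        ultimately have "derives T (ps @ [q]) (\<^bold>\<forall> p)"
          using derives_Gen[of T "ps @ [q]" x p] closed x by blast
        moreover have "derives T (ps @ [q]) (\<^bold>\<not> (\<^bold>\<forall> p))" unfolding q by (rule derives_hyp)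
        ultimately show False using * derives_MP by blast
      qed
      then show ?thesis by (auto simp: witness_def q x_def)
    next
      case False
      then have "witness ps q = []" by (auto simp: witness_def split: fm.split)
      with * show ?thesis by simp
    qed
    with False show ?thesis by (simp add: ps_def q_def Let_def)
  qed
qed

lemma henkin_mono:
  assumes "derives T (henkin T h n) p" "n \<le> m"
  shows "derives T (henkin T h m) p"
  using assms(2,1)
proof (induction m rule: dec_induct)
  case (step m)
  then show ?case by (simp add: Let_def derives_weaken_append)
qed

lemma henkin_theory_theorem: "T \<^bold>\<turnstile> p \<Longrightarrow> p \<in> henkin_theory T h"
  by (auto simp: henkin_theory_def intro: derives_theorem)

lemma henkin_theory_MP:
  assumes "(p \<^bold>\<longrightarrow> q) \<in> henkin_theory T h" "p \<in> henkin_theory T h"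
  shows "q \<in> henkin_theory T h"
proof -
  obtain n m where "derives T (henkin T h n) (p \<^bold>\<longrightarrow> q)" "derives T (henkin T h m) p"
    using assms by (auto simp: henkin_theory_def)
  then have "derives T (henkin T h (max n m)) (p \<^bold>\<longrightarrow> q)" "derives T (henkin T h (max n m)) p"
    using henkin_mono by (meson max.cobounded1 max.cobounded2)+
  then show ?thesis unfolding henkin_theory_def using derives_MP by blast
qed

lemma henkin_theory_consistent: "\<^bold>\<bottom> \<notin> henkin_theory T h"
  using henkin_consistent by (auto simp: henkin_theory_def)

lemma henkin_theory_start: "h \<in> henkin_theory T h"
  using derives_hyp[of T "[]" h] by (auto simp: henkin_theory_def intro: exI[of _ 0])

text \<open>By consistency a member of the theory is never rejected at its own stage, so each
  negated universal member really received its witness there.\<close>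

lemma henkin_theory_stage:
  assumes "q \<in> henkin_theory T h"
  shows "derives T (henkin T h (Suc (to_nat q))) q \<and>
    (\<forall>p. q = (\<^bold>\<not> (\<^bold>\<forall> p)) \<longrightarrow> (\<exists>x. (\<^bold>\<not> inst x p) \<in> henkin_theory T h))"
proof -
  define ps where "ps = henkin T h (to_nat q)"
  have "\<not> derives T ps (\<^bold>\<not> q)"
    using assms henkin_theory_MP henkin_theory_consistent
    unfolding ps_def henkin_theory_def by blast
  then have step: "henkin T h (Suc (to_nat q)) = ps @ q # witness ps q"
    by (simp add: ps_def Let_def)
  have "derives T (ps @ q # witness ps q) q"
    using derives_weaken_append[OF derives_hyp[of T ps q], of "witness ps q"] by simp
  moreover have "\<exists>x. (\<^bold>\<not> inst x p) \<in> henkin_theory T h" if "q = (\<^bold>\<not> (\<^bold>\<forall> p))" for p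
  proof -
    have "derives T ((ps @ [q]) @ [\<^bold>\<not> inst (fresh (q # ps)) p]) (\<^bold>\<not> inst (fresh (q # ps)) p)"
      by (rule derives_hyp)
    then have "derives T (henkin T h (Suc (to_nat q))) (\<^bold>\<not> inst (fresh (q # ps)) p)"
      unfolding step by (simp add: witness_def that)
    then show ?thesis unfolding henkin_theory_def by blast
  qed
  ultimately show ?thesis unfolding step by blast
qed

lemma henkin_theory_complete: "p \<in> henkin_theory T h \<or> (\<^bold>\<not> p) \<in> henkin_theory T h"
proof (cases "derives T (henkin T h (to_nat p)) (\<^bold>\<not> p)")
  case True
  then show ?thesis by (auto simp: henkin_theory_def)
next
  case False
  then have "henkin T h (Suc (to_nat p)) =
    (henkin T h (to_nat p) @ [p]) @ witness (henkin T h (to_nat p)) p" by (simp add: Let_def)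
  then have "derives T (henkin T h (Suc (to_nat p))) p"
    by (simp only: derives_weaken_append derives_hyp)
  then show ?thesis unfolding henkin_theory_def by blast
qed

lemma henkin_theory_Imp:
  "(p \<^bold>\<longrightarrow> q) \<in> henkin_theory T h \<longleftrightarrow> (p \<in> henkin_theory T h \<longrightarrow> q \<in> henkin_theory T h)"
proof
  assume imp: "p \<in> henkin_theory T h \<longrightarrow> q \<in> henkin_theory T h"
  show "(p \<^bold>\<longrightarrow> q) \<in> henkin_theory T h"
  proof (cases "q \<in> henkin_theory T h")
    case True
    then show ?thesis using henkin_theory_MP[OF henkin_theory_theorem[OF proves.K]] by blast
  next
    case False
    with imp have "(\<^bold>\<not> p) \<in> henkin_theory T h" using henkin_theory_complete by blast
    moreover have "T \<^bold>\<turnstile> (\<^bold>\<not> p \<^bold>\<longrightarrow> p \<^bold>\<longrightarrow> q)"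
    proof -
      \<comment> \<open>An instance of \<open>K\<close> turns falsity into a double negation, which
        \<open>DN\<close> removes.\<close>
      have "T \<^bold>\<turnstile> (\<^bold>\<bottom> \<^bold>\<longrightarrow> q)" 
        by (rule proves.MP[OF proves.MP[OF proves.S proves.MP[OF proves.K proves.DN]] proves.K])
      then have "T \<^bold>\<turnstile> (p \<^bold>\<longrightarrow> \<^bold>\<bottom> \<^bold>\<longrightarrow> q)"
        by (rule proves.MP[OF proves.K])
      then show ?thesis by (rule proves.MP[OF proves.S])
    qed
    ultimately show ?thesis using henkin_theory_MP henkin_theory_theorem by blast
  qed
qed (use henkin_theory_MP in blast)

lemma henkin_theory_All: "(\<^bold>\<forall> p) \<in> henkin_theory T h \<longleftrightarrow> (\<forall>x. inst x p \<in> henkin_theory T h)"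
proof
  assume "(\<^bold>\<forall> p) \<in> henkin_theory T h"
  then show "\<forall>x. inst x p \<in> henkin_theory T h"
    using henkin_theory_MP[OF henkin_theory_theorem[OF proves.Spec]] by blast
next
  assume "\<forall>x. inst x p \<in> henkin_theory T h"
  then have "(\<^bold>\<not> (\<^bold>\<forall> p)) \<notin> henkin_theory T h"
    using henkin_theory_stage henkin_theory_Imp henkin_theory_consistent by blast
  then show "(\<^bold>\<forall> p) \<in> henkin_theory T h" using henkin_theory_complete by blast
qed

abbreviation (input) "henkin_eq \<equiv> \<lambda>i j. (i \<^bold>= j) \<in> henkin_theory T h"
abbreviation (input) "henkin_mem \<equiv> \<lambda>i j. (i \<^bold>\<in> j) \<in> henkin_theory T h"

text \<open>The induction is on the size of formulas, because the quantifier case needs the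
  hypothesis for the instances of q, and these have the size of q without being subformulas.\<close>

lemma henkin_truth: "sat_eq henkin_eq henkin_mem (\<lambda>i. i) p \<longleftrightarrow> p \<in> henkin_theory T h"
proof (induction p rule: measure_induct_rule[where f = size])
  case (less p)
  show ?case
  proof (cases p)
    case (All q)
    have "sat_eq henkin_eq henkin_mem (case_nat x (\<lambda>i. i)) q \<longleftrightarrow> inst x q \<in> henkin_theory T h" for x
      using less[of "inst x q"] sat_eq_inst[of henkin_eq henkin_mem "\<lambda>i. i" x q]
      by (simp add: All inst_def)
    then show ?thesis by (simp add: All henkin_theory_All)
  qed (simp_all add: less henkin_theory_Imp henkin_theory_consistent)
qed

lemma henkin_eq_refl: "henkin_eq i i"
  by (intro henkin_theory_theorem proves.Refl)

lemma henkin_eq_subst: "henkin_eq i j \<Longrightarrow> inst i p \<in> henkin_theory T h \<Longrightarrow> inst j p \<in> henkin_theory T h"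
  using henkin_theory_MP[OF henkin_theory_MP[OF henkin_theory_theorem[OF proves.Leib]]] by blast

text \<open>Leibniz' rule is applied to a formula whose index 0 marks the place of substitution. The
  index to be kept is written with \<open>Suc\<close>, since \<open>inst\<close> lowers it by
  one.\<close>

lemma henkin_eq_sym: "henkin_eq i j \<Longrightarrow> henkin_eq j i"
  using henkin_eq_subst[of i j "0 \<^bold>= Suc i"] henkin_eq_refl by (simp add: inst_def)

lemma henkin_eq_trans: "henkin_eq i j \<Longrightarrow> henkin_eq j k \<Longrightarrow> henkin_eq i k"
  using henkin_eq_subst[of j k "Suc i \<^bold>= 0"] by (simp add: inst_def)

lemma henkin_mem_cong:
  assumes "henkin_eq i i'" "henkin_eq j j'"
  shows "henkin_mem i j \<longleftrightarrow> henkin_mem i' j'"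
proof -
  have "henkin_mem i' j'" if "henkin_eq i i'" "henkin_eq j j'" "henkin_mem i j" for i i' j j'
    using henkin_eq_subst[OF that(1), of "0 \<^bold>\<in> Suc j"] henkin_eq_subst[OF that(2), of "Suc i' \<^bold>\<in> 0"]
      that(3) by (simp add: inst_def)
  with assms henkin_eq_sym show ?thesis by blast
qed

end

section \<open>From the Henkin theory to a model on the natural numbers\<close>

text \<open>The map f presents the quotient by \<open>eqv\<close>, which carries true equality; its
  surjectivity is what the quantifier case needs.\<close>

lemma sat_eq_surj:
  assumes "surj f" "\<And>i j. eqv i j \<longleftrightarrow> f i = f j" "\<And>i j. mem i j \<longleftrightarrow> mem' (f i) (f j)"
  shows "sat_eq eqv mem e p \<longleftrightarrow> sat mem' (f \<circ> e) p"
proof (induction p arbitrary: e)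
  case (All p)
  have "f \<circ> case_nat x e = case_nat (f x) (f \<circ> e)" for x
    by (rule ext) (simp split: nat.split)
  then have "sat_eq eqv mem (case_nat x e) p \<longleftrightarrow> sat mem' (case_nat (f x) (f \<circ> e)) p" for x
    by (simp only: All)
  then show ?case using \<open>surj f\<close> unfolding sat_eq.simps by (metis surjD)
qed (simp_all add: assms)

text \<open>Separation and replacement have free parameters, so a renaming maps an instance to
  another instance, whose formula is renamed behind its two or three distinguished indices. The
  other axioms are closed.\<close>

lemma ZFC_ren: "p \<in> ZFC \<Longrightarrow> ren r p \<in> ZFC"
proof -
  have *: "lift_ren (lift_ren (lift_ren r)) \<circ> lift_ren Suc = lift_ren Suc \<circ> lift_ren (lift_ren r)"
    "lift_ren (lift_ren (lift_ren (lift_ren r))) \<circ> lift_ren (lift_ren Suc) =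
      lift_ren (lift_ren Suc) \<circ> lift_ren (lift_ren (lift_ren r))" for r
    by (simp_all add: comp_lift_ren) (simp_all add: o_def)
  have "ren r (separation p) = separation (ren (lift_ren (lift_ren r)) p)" for p
    by (simp add: separation_def ren_ren * numeral_2_eq_2)
  moreover have "ren r (replacement p) = replacement (ren (lift_ren (lift_ren (lift_ren r))) p)" for p
    by (simp add: replacement_def ren_ren * numeral_2_eq_2)
  moreover have "ren r p = p" if "p \<in> {extensionality, foundation, pairing, union_axiom, powerset,
      infinity, choice}"
    using that by (auto simp: extensionality_def foundation_def pairing_def union_axiom_def
      powerset_def infinity_def choice_def is_inductive_def is_empty_def is_succ_def
      numeral_2_eq_2 numeral_3_eq_3)
  ultimately show "p \<in> ZFC \<Longrightarrow> ren r p \<in> ZFC" unfolding ZFC_def by fastforce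
qed

text \<open>
  Quotienting the Henkin model by its equality gives a model on nat, because a model
  of ZFC has infinitely many elements: each finite set of elements is contained in a member of the
  universe, and no member contains everything by Russell's paradox.
\<close>

theorem completeness:
  assumes models: "\<And>mem :: nat \<Rightarrow> nat \<Rightarrow> bool. \<And>e. (\<And>p e. p \<in> ZFC \<Longrightarrow> sat mem e p) \<Longrightarrow> sat mem e p"
  shows "ZFC \<^bold>\<turnstile> p"
proof (rule ccontr)
  assume "\<not> (ZFC \<^bold>\<turnstile> p)"
  then have con: "\<not> (ZFC \<^bold>\<turnstile> (\<^bold>\<not> (\<^bold>\<not> p)))" using proves.MP[OF proves.DN] by blast
  note henkin = ZFC_ren con
  define H where "H = henkin_theory ZFC (\<^bold>\<not> p)"
  define eqv where "eqv = (\<lambda>i j. (i \<^bold>= j) \<in> H)"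
  define mem where "mem = (\<lambda>i j. (i \<^bold>\<in> j) \<in> H)"
  have truth: "sat_eq eqv mem (\<lambda>i. i) q \<longleftrightarrow> q \<in> H" for q
    unfolding H_def eqv_def mem_def by (rule henkin_truth[OF henkin])
  have refl: "eqv i i" and sym: "eqv i j \<Longrightarrow> eqv j i" and trans: "eqv i j \<Longrightarrow> eqv j k \<Longrightarrow> eqv i k"
    and mem_cong: "eqv i i' \<Longrightarrow> eqv j j' \<Longrightarrow> mem i j \<longleftrightarrow> mem i' j'" for i j k i' j'
    using henkin_eq_refl[OF henkin] henkin_eq_sym[OF henkin] henkin_eq_trans[OF henkin]
      henkin_mem_cong[OF henkin] unfolding eqv_def mem_def H_def by blast+
  \<comment> \<open>The truth lemma concerns the identity environment only. An environment e of
    variables is itself a renaming, and renamed axioms are axioms.\<close>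
  have sat_ZFC: "sat_eq eqv mem e q" if "q \<in> ZFC" for q e
    using truth[of "ren e q"] henkin_theory_theorem[OF henkin proves.Ax[OF ZFC_ren[OF that]]]
    by (simp add: H_def sat_eq_ren o_def)
  have pair: "\<exists>c. mem a c \<and> mem b c" for a b
    using sat_ZFC[of pairing undefined] by (simp add: ZFC_def pairing_def numeral_2_eq_2)
  have union: "\<exists>u. \<forall>b c. mem c b \<and> mem b a \<longrightarrow> mem c u" for a
    using sat_ZFC[of union_axiom undefined] by (simp add: ZFC_def union_axiom_def eval_nat_numeral) blast
  have russell: "\<exists>b. \<not> mem b a" for a
  proof -
    have "separation (\<^bold>\<not> (0 \<^bold>\<in> 0)) \<in> ZFC" by (simp add: ZFC_def)
    from sat_ZFC[OF this, of undefined]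
    have "\<exists>b. \<forall>x. mem x b \<longleftrightarrow> mem x a \<and> \<not> mem x x"
      by (simp add: separation_def numeral_2_eq_2) blast
    then show ?thesis by blast
  qed
  \<comment> \<open>Least representatives realise the quotient as a subset of \<open>nat\<close>;
    once it is infinite, enumerating it makes all of \<open>nat\<close> the universe.\<close>
  define rep where "rep i = (LEAST j. eqv i j)" for i
  have eq_rep: "eqv i (rep i)" for i unfolding rep_def by (rule LeastI) (rule refl)
  have rep_eq: "eqv i j \<longleftrightarrow> rep i = rep j" for i j
  proof
    assume "eqv i j"
    then have "eqv i k \<longleftrightarrow> eqv j k" for k using sym trans by blast
    then show "rep i = rep j" by (simp add: rep_def)
  next
    assume "rep i = rep j"
    then show "eqv i j" using eq_rep[of i] eq_rep[of j] sym trans by metis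
  qed
  have cover: "\<exists>u. \<forall>a\<in>A. mem a u" if "finite A" for A
    using that
  proof induction
    case (insert a A)
    then obtain u where u: "\<forall>b\<in>A. mem b u" by blast
    obtain s c where "mem a s" "mem u c" "mem s c" using pair by meson
    moreover obtain v where "\<forall>b x. mem x b \<and> mem b c \<longrightarrow> mem x v" using union by blast
    ultimately show ?case using u by blast
  qed simp
  have "infinite (range rep)"
  proof
    assume "finite (range rep)"
    then obtain u where "\<forall>a\<in>range rep. mem a u" using cover by blast
    then have "mem b u" for b using mem_cong[OF eq_rep[of b] refl, of u] by blast
    with russell show False by blast
  qed
  then have bij: "bij_betw (to_nat_on (range rep)) (range rep) UNIV"
    by (intro to_nat_on_infinite) simp_all
  define f where "f i = to_nat_on (range rep) (rep i)" for i
  have "surj f" using bij by (auto simp: bij_betw_def f_def image_image)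
  have f_eq: "eqv i j \<longleftrightarrow> f i = f j" for i j
    unfolding rep_eq f_def using inj_on_eq_iff[OF bij_betw_imp_inj_on[OF bij]] by blast
  define mem' where "mem' a b \<longleftrightarrow> mem (inv_into UNIV f a) (inv_into UNIV f b)" for a b
  have mem': "mem i j \<longleftrightarrow> mem' (f i) (f j)" for i j
  proof -
    have "f (inv_into UNIV f (f k)) = f k" for k by (simp add: f_inv_into_f)
    then show ?thesis unfolding mem'_def by (intro mem_cong) (simp_all add: f_eq)
  qed
  have transfer: "sat_eq eqv mem e q \<longleftrightarrow> sat mem' (f \<circ> e) q" for e q
    by (intro sat_eq_surj \<open>surj f\<close> f_eq mem')
  have "sat mem' e q" if "q \<in> ZFC" for q e
  proof -
    have "f \<circ> (inv_into UNIV f \<circ> e) = e" using \<open>surj f\<close> by (auto simp: surj_f_inv_f)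
    then show ?thesis using sat_ZFC[OF that, of "inv_into UNIV f \<circ> e"] transfer by metis
  qed
  then have "sat mem' (f \<circ> (\<lambda>i. i)) p" by (rule models)
  then have "p \<in> H" using truth transfer by blast
  moreover have "(\<^bold>\<not> p) \<in> H" unfolding H_def by (rule henkin_theory_start[OF henkin])
  ultimately show False
    using henkin_theory_MP[OF henkin] henkin_theory_consistent[OF henkin] unfolding H_def by blast
qed

section \<open>Tilings over an abstract copy of the integers\<close>

text \<open>Lists are used because the residues of a vector from any model form a list of standard
  integers, which can then be tested for membership in a standard set.\<close>

definition periodic_list :: "nat \<Rightarrow> nat \<Rightarrow> int list set \<Rightarrow> bool"
  where "periodic_list k n E \<longleftrightarrow> E \<subseteq> {v. length v = k} \<and>
    (\<forall>v w. map (\<lambda>a. a mod int n) v = map (\<lambda>a. a mod int n) w \<longrightarrow> v \<in> E \<longrightarrow> w \<in> E)"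

lemma periodic_list_iff:
  "periodic_list k n E \<Longrightarrow> map (\<lambda>a. a mod int n) v = map (\<lambda>a. a mod int n) w \<Longrightarrow> v \<in> E \<longleftrightarrow> w \<in> E"
  unfolding periodic_list_def by metis

lemma periodic_list_dvd:
  assumes "periodic_list k n E" "n dvd m"
  shows "periodic_list k m E"
proof -
  have "map (\<lambda>a. a mod int n) (map (\<lambda>a. a mod int m) v) = map (\<lambda>a. a mod int n) v" for v
    using assms(2) by (auto simp: mod_mod_cancel)
  then show ?thesis using assms(1) unfolding periodic_list_def by metis
qed

text \<open>The product of all periods and N works. The factor N makes the same modulus decide the
  residue of the height.\<close>

lemma common_period:
  fixes M :: nat and n :: "nat \<Rightarrow> nat"
  assumes "N > 0" "\<And>m. m \<in> {1..M} \<Longrightarrow> n m > 0 \<and> periodic_list k (n m) (E m)"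
  shows "\<exists>l>0. N dvd l \<and> (\<forall>m\<in>{1..M}. periodic_list k l (E m))"
proof (intro exI conjI ballI)
  let ?l = "N * (\<Prod>m\<in>{1..M}. n m)"
  show "?l > 0" using assms by (auto intro!: prod_pos)
  show "N dvd ?l" by simp
  fix m assume m: "m \<in> {1..M}"
  have "n m dvd (\<Prod>m\<in>{1..M}. n m)" using m by (intro dvd_prodI) auto
  then show "periodic_list k ?l (E m)"
    using periodic_list_dvd[of k "n m" "E m" ?l] assms(2)[OF m] by simp
qed

definition stacked_lists :: "nat \<Rightarrow> nat \<Rightarrow> (nat \<Rightarrow> int list set) \<Rightarrow> int list set"
  where "stacked_lists M N E = {v @ [c] | v c. \<exists>m\<in>{1..M}. v \<in> E m \<and> c mod int N = int m}"

lemma periodic_stacked_lists: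
  assumes "\<And>m. m \<in> {1..M} \<Longrightarrow> periodic_list k n (E m)" "N dvd n"
  shows "periodic_list (Suc k) n (stacked_lists M N E)"
  unfolding periodic_list_def
proof (intro conjI allI impI)
  show "stacked_lists M N E \<subseteq> {v. length v = Suc k}"
    using assms(1) unfolding stacked_lists_def periodic_list_def by fastforce
next
  fix v w assume eq: "map (\<lambda>a. a mod int n) v = map (\<lambda>a. a mod int n) w" and "v \<in> stacked_lists M N E"
  then obtain x a m where v: "v = x @ [a]" "m \<in> {1..M}" "x \<in> E m" "a mod int N = int m"
    by (auto simp: stacked_lists_def)
  obtain y b where w: "w = y @ [b]" using map_eq_imp_length_eq[OF eq] v(1)
    by (cases w rule: rev_cases) auto
  with eq v(1) have "map (\<lambda>a. a mod int n) x = map (\<lambda>a. a mod int n) y" "a mod int n = b mod int n"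
    by auto
  moreover from this(2) have "b mod int N = int m"
    using v(4) assms(2) mod_mod_cancel[of "int N" "int n" a] mod_mod_cancel[of "int N" "int n" b] by simp
  ultimately show "w \<in> stacked_lists M N E"
    using v w periodic_list_iff[OF assms(1)[OF v(2)], of x y] unfolding stacked_lists_def by blast
qed

definition stacked_tiles :: "nat \<Rightarrow> (nat \<Rightarrow> nat \<Rightarrow> int list set) \<Rightarrow> nat \<Rightarrow> int list set"
  where "stacked_tiles M F j = {f @ [int m] | f m. m \<in> {1..M} \<and> f \<in> F m j}"

text \<open>
  The carrier \<open>Z\<close> is meant to be the integers, possibly of a nonstandard model of set
  theory: only standard integers can be added, and only residues modulo standard moduli are used.
\<close>

locale integer_model =
  fixes Z :: "'i set" and add :: "int \<Rightarrow> 'i \<Rightarrow> 'i" and zero :: 'i and res :: "nat \<Rightarrow> 'i \<Rightarrow> int"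
  assumes add_closed: "a \<in> Z \<Longrightarrow> add c a \<in> Z"
    and add_0: "a \<in> Z \<Longrightarrow> add 0 a = a"
    and add_add: "a \<in> Z \<Longrightarrow> add b (add c a) = add (b + c) a"
    and zero_closed: "zero \<in> Z"
    and res_range: "n > 0 \<Longrightarrow> a \<in> Z \<Longrightarrow> 0 \<le> res n a \<and> res n a < int n"
    and res_zero: "n > 0 \<Longrightarrow> res n zero = 0"
    and res_add: "n > 0 \<Longrightarrow> a \<in> Z \<Longrightarrow> res n (add c a) = (res n a + c) mod int n"
    and res_dvd: "n > 0 \<Longrightarrow> n dvd l \<Longrightarrow> l > 0 \<Longrightarrow> a \<in> Z \<Longrightarrow> res n a = res l a mod int n"
begin

definition vec :: "nat \<Rightarrow> 'i list \<Rightarrow> bool"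
  where "vec k x \<longleftrightarrow> length x = k \<and> set x \<subseteq> Z"

definition vec_add :: "int list \<Rightarrow> 'i list \<Rightarrow> 'i list"
  where "vec_add f x = map2 add f x"

text \<open>Directness of each sum and disjointness of different sums are merged into the middle
  clause. Equality of x and y follows from it, since translation by f is injective.\<close>

definition tiling ::
    "nat \<Rightarrow> nat \<Rightarrow> (nat \<Rightarrow> int list set) \<Rightarrow> ('i list \<Rightarrow> bool) \<Rightarrow> (nat \<Rightarrow> 'i list set) \<Rightarrow> bool"
  where "tiling k J F P X \<longleftrightarrow>
    (\<forall>j\<in>{1..J}. \<forall>x\<in>X j. vec k x) \<and>
    (\<forall>i\<in>{1..J}. \<forall>j\<in>{1..J}. \<forall>f\<in>F i. \<forall>g\<in>F j. \<forall>x\<in>X i. \<forall>y\<in>X j.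
      vec_add f x = vec_add g y \<longrightarrow> i = j \<and> f = g) \<and>
    (\<forall>y. vec k y \<longrightarrow> ((\<exists>j\<in>{1..J}. \<exists>f\<in>F j. \<exists>x\<in>X j. y = vec_add f x) \<longleftrightarrow> P y))"

text \<open>The set that the description of a standard periodic set E defines in the model: residues
  modulo a period are looked up in E.\<close>

definition ext :: "nat \<Rightarrow> int list set \<Rightarrow> 'i list \<Rightarrow> bool"
  where "ext k E y \<longleftrightarrow> (\<exists>n>0. periodic_list k n E \<and> map (res n) y \<in> E)"

text \<open>Two periods m and n are compared through their product, since the residues modulo m n
  determine those modulo m and modulo n.\<close>

lemma ext_iff:
  assumes "n > 0" "periodic_list k n E" "set y \<subseteq> Z"
  shows "ext k E y \<longleftrightarrow> map (res n) y \<in> E"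
proof -
  have "map (res m) y \<in> E \<longleftrightarrow> map (res n) y \<in> E" if "m > 0" "periodic_list k m E" for m
  proof -
    have "map (res l) y \<in> E \<longleftrightarrow> map (res (m * n)) y \<in> E"
      if l: "l > 0" "periodic_list k l E" "l dvd m * n" for l
    proof (rule periodic_list_iff[OF l(2)])
      have "res l a mod int l = res (m * n) a mod int l" if "a \<in> Z" for a
        using res_dvd[of l "m * n" a] that l \<open>m > 0\<close> assms(1) by simp
      then show "map (\<lambda>a. a mod int l) (map (res l) y) = map (\<lambda>a. a mod int l) (map (res (m * n)) y)"
        using assms(3) by auto
    qed
    from this[of m] this[of n] show ?thesis using that assms by simp
  qed
  then show ?thesis unfolding ext_def using assms by blast
qed

lemma vec_snoc: "vec (Suc k) y \<longleftrightarrow> (\<exists>x a. y = x @ [a] \<and> vec k x \<and> a \<in> Z)"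
  unfolding vec_def by (cases y rule: rev_cases) auto

lemma vec_add_snoc: "length f = length x \<Longrightarrow> vec_add (f @ [c]) (x @ [a]) = vec_add f x @ [add c a]"
  by (simp add: vec_add_def)

lemma vec_vec_add: "length f = k \<Longrightarrow> vec k x \<Longrightarrow> vec k (vec_add f x)"
  unfolding vec_def vec_add_def by (auto dest: set_zip_leftD set_zip_rightD intro!: add_closed)

lemma add_inj: "a \<in> Z \<Longrightarrow> b \<in> Z \<Longrightarrow> add c a = add c b \<Longrightarrow> a = b"
  using add_add[of _ "- c" c] add_0 by (metis add.left_inverse)

lemma ext_stacked_lists:
  assumes "N > 0" "\<And>m. m \<in> {1..M} \<Longrightarrow> n m > 0 \<and> periodic_list k (n m) (E m)"
    and "set x \<subseteq> Z" "a \<in> Z"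
  shows "ext (Suc k) (stacked_lists M N E) (x @ [a]) \<longleftrightarrow>
    (\<exists>m\<in>{1..M}. ext k (E m) x \<and> res N a = int m)"
proof -
  obtain l where pos: "l > 0" and "N dvd l" and per: "\<And>m. m \<in> {1..M} \<Longrightarrow> periodic_list k l (E m)"
    using common_period[of N M n k E, OF assms(1,2)] by auto
  have "periodic_list (Suc k) l (stacked_lists M N E)"
    by (rule periodic_stacked_lists[OF per \<open>N dvd l\<close>])
  moreover have "set (x @ [a]) \<subseteq> Z" using assms by simp
  moreover have "res N a = res l a mod int N"
    using assms pos \<open>N dvd l\<close> by (intro res_dvd)
  ultimately show ?thesis
    using ext_iff[OF pos per assms(3)] ext_iff[OF pos, of "Suc k" "stacked_lists M N E" "x @ [a]"]
    by (auto simp: stacked_lists_def)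
qed

section \<open>Lifting and slicing of solutions\<close>

definition lift_set :: "nat \<Rightarrow> 'i list set \<Rightarrow> 'i list set"
  where "lift_set N A = {x @ [a] | x a. x \<in> A \<and> a \<in> Z \<and> res N a = 0}"

definition slice_set :: "'i list set \<Rightarrow> 'i list set"
  where "slice_set A = {x. x @ [zero] \<in> A}"

context
  fixes d J M N :: nat and F :: "nat \<Rightarrow> nat \<Rightarrow> int list set" and E :: "nat \<Rightarrow> int list set"
    and n :: "nat \<Rightarrow> nat"
  assumes "M \<ge> 1" and "N > M"
    and tiles: "\<And>m j. m \<in> {1..M} \<Longrightarrow> j \<in> {1..J} \<Longrightarrow> F m j \<noteq> {} \<and> F m j \<subseteq> {f. length f = d}"
    and periodic: "\<And>m. m \<in> {1..M} \<Longrightarrow> n m > 0 \<and> periodic_list d (n m) (E m)"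
begin

lemma ext_stacked:
  assumes "vec d x" "a \<in> Z"
  shows "ext (Suc d) (stacked_lists M N E) (x @ [a]) \<longleftrightarrow>
    (\<exists>m\<in>{1..M}. ext d (E m) x \<and> res N a = int m)"
  using \<open>N > M\<close> assms periodic by (intro ext_stacked_lists[of N M n]) (auto simp: vec_def)

text \<open>Adding m to a height divisible by N gives the residue m, because m is at most M and M <
  N. The height of a sum thus reveals the equation it belongs to, and the layers can be treated
  separately.\<close>

lemma tiling_lift:
  assumes "\<And>m. m \<in> {1..M} \<Longrightarrow> tiling d J (F m) (ext d (E m)) X"
  shows "tiling (Suc d) J (stacked_tiles M F) (ext (Suc d) (stacked_lists M N E))
    (\<lambda>j. lift_set N (X j))"
proof -
  have vec: "vec d x" if "x \<in> X j" "j \<in> {1..J}" for x j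
  proof -
    have "tiling d J (F 1) (ext d (E 1)) X" using assms \<open>M \<ge> 1\<close> by simp
    with that show ?thesis unfolding tiling_def by blast
  qed
  have len: "length f = d" if "f \<in> F m j" "m \<in> {1..M}" "j \<in> {1..J}" for f m j
    using tiles that by blast
  have res_m: "res N (add (int m) a) = int m" if "a \<in> Z" "res N a = 0" "m \<in> {1..M}" for a m
    using that \<open>N > M\<close> by (simp add: res_add)
  show ?thesis unfolding tiling_def
  proof (intro conjI ballI allI impI)
    fix j x assume "j \<in> {1..J}" "x \<in> lift_set N (X j)"
    then show "vec (Suc d) x" using vec unfolding lift_set_def vec_snoc by blast
  next
    fix i j f' g' x' y'
    assume ij: "i \<in> {1..J}" "j \<in> {1..J}" and "f' \<in> stacked_tiles M F i" "g' \<in> stacked_tiles M F j"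
      "x' \<in> lift_set N (X i)" "y' \<in> lift_set N (X j)" and eq: "vec_add f' x' = vec_add g' y'"
    then obtain f g l m x y a b where
      *: "f' = f @ [int l]" "l \<in> {1..M}" "f \<in> F l i" "g' = g @ [int m]" "m \<in> {1..M}" "g \<in> F m j"
        "x' = x @ [a]" "x \<in> X i" "a \<in> Z" "res N a = 0" "y' = y @ [b]" "y \<in> X j" "b \<in> Z" "res N b = 0"
      unfolding stacked_tiles_def lift_set_def by blast
    have "length f = length x" "length g = length y"
      using * ij len vec by (metis vec_def)+
    with eq * have eq': "vec_add f x = vec_add g y" "add (int l) a = add (int m) b"
      by (simp_all add: vec_add_snoc)
    with * res_m have "l = m" by (metis of_nat_eq_iff)
    with * eq'(1) ij assms[of m] have "i = j \<and> f = g" unfolding tiling_def by blast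
    then show "i = j" "f' = g'" using * \<open>l = m\<close> by simp_all
  next
    fix y' assume "vec (Suc d) y'"
    then obtain y b where y: "y' = y @ [b]" "vec d y" "b \<in> Z" by (auto simp: vec_snoc)
    have "(\<exists>j\<in>{1..J}. \<exists>f\<in>stacked_tiles M F j. \<exists>x\<in>lift_set N (X j). y' = vec_add f x) \<longleftrightarrow>
      (\<exists>m\<in>{1..M}. ext d (E m) y \<and> res N b = int m)" (is "?l = ?r")
    proof
      assume ?l
      then obtain j f m x a where
        *: "j \<in> {1..J}" "m \<in> {1..M}" "f \<in> F m j" "x \<in> X j" "a \<in> Z" "res N a = 0"
          "y' = vec_add (f @ [int m]) (x @ [a])"
        unfolding stacked_tiles_def lift_set_def by blast
      have "length f = length x" using * len vec by (metis vec_def)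
      with * y have "y = vec_add f x" "b = add (int m) a" by (simp_all add: vec_add_snoc)
      then show ?r using * y(2) assms[of m] res_m unfolding tiling_def by blast
    next
      assume ?r
      then obtain m where m: "m \<in> {1..M}" "ext d (E m) y" "res N b = int m" by blast
      with assms[of m] y(2) obtain j f x where
        *: "j \<in> {1..J}" "f \<in> F m j" "x \<in> X j" "y = vec_add f x"
        unfolding tiling_def by blast
      \<comment> \<open>Descending by m from a height of residue m leads to a multiple of N, as
        membership in the lift requires.\<close>
      define a where "a = add (- int m) b"
      have "a \<in> Z" "res N a = 0" "b = add (int m) a"
        using y(3) m \<open>N > M\<close> by (simp_all add: a_def add_closed res_add add_add add_0)
      moreover have "length f = length x" using * m len vec by (metis vec_def)
      ultimately have "y' = vec_add (f @ [int m]) (x @ [a])" "x @ [a] \<in> lift_set N (X j)"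
        "f @ [int m] \<in> stacked_tiles M F j"
        using * y m by (auto simp: vec_add_snoc lift_set_def stacked_tiles_def)
      with * show ?l by blast
    qed
    then show "(\<exists>j\<in>{1..J}. \<exists>f\<in>stacked_tiles M F j. \<exists>x\<in>lift_set N (X j). y' = vec_add f x) \<longleftrightarrow>
      ext (Suc d) (stacked_lists M N E) y'"
      using ext_stacked[OF y(2,3)] y(1) by simp
  qed
qed

text \<open>Equation m is read off at height exactly m. A tile covering a point there could come
  from another layer l and another height a; the residues modulo N give l = m, and then a is zero by
  cancellation.\<close>

lemma tiling_slice:
  assumes til: "tiling (Suc d) J (stacked_tiles M F) (ext (Suc d) (stacked_lists M N E)) X"
    and m: "m \<in> {1..M}"
  shows "tiling d J (F m) (ext d (E m)) (\<lambda>j. slice_set (X j))"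
proof -
  have vec: "vec (Suc d) x" if "x \<in> X j" "j \<in> {1..J}" for x j
    using til that unfolding tiling_def by blast
  have vec': "vec d x" "a \<in> Z" if "x @ [a] \<in> X j" "j \<in> {1..J}" for x a j
    using vec[OF that] by (auto simp: vec_def)
  have len: "length f = d" if "f \<in> F m j" "m \<in> {1..M}" "j \<in> {1..J}" for f m j
    using tiles that by blast
  have stacked: "f @ [int m] \<in> stacked_tiles M F j" if "f \<in> F m j" "m \<in> {1..M}" for f m j
    using that by (auto simp: stacked_tiles_def)
  have covered: "\<exists>l\<in>{1..M}. ext d (E l) (vec_add f x) \<and> res N (add (int m) a) = int l"
    if *: "x @ [a] \<in> X j" "j \<in> {1..J}" "f \<in> F m j" "m \<in> {1..M}" for x a j f m
  proof -
    have "vec (Suc d) (vec_add (f @ [int m]) (x @ [a]))"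
      using * vec len by (intro vec_vec_add) auto
    then have "ext (Suc d) (stacked_lists M N E) (vec_add (f @ [int m]) (x @ [a]))"
      using til stacked[OF *(3,4)] * unfolding tiling_def by blast
    moreover have "vec d x" "a \<in> Z" "length f = d"
      using vec'[OF *(1,2)] len[OF *(3,4,2)] by simp_all
    moreover from this have "length f = length x" "vec d (vec_add f x)" "add (int m) a \<in> Z"
      by (simp_all add: vec_vec_add add_closed) (simp add: vec_def)
    ultimately show ?thesis by (simp add: vec_add_snoc ext_stacked)
  qed
  text \<open>
    Each of the \<open>M\<close> consecutive residues of \<open>a + 1, \<dots>, a + M\<close> lies between
    1 and \<open>M\<close>, and this forces \<open>a\<close> to be divisible by \<open>N > M\<close>.
  \<close>
  have res_0: "res N a = 0" if *: "x @ [a] \<in> X j" "j \<in> {1..J}" for x a j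
  proof (rule ccontr)
    assume "res N a \<noteq> 0"
    have a: "a \<in> Z" using vec'(2)[OF *] .
    have r: "0 < res N a" "res N a < int N"
      using res_range[of N a] \<open>N > M\<close> \<open>res N a \<noteq> 0\<close> a by auto
    have near: "(res N a + int m) mod int N \<in> {1..int M}" if "m \<in> {1..M}" for m
    proof -
      obtain f where "f \<in> F m j" using tiles[OF \<open>m \<in> {1..M}\<close> *(2)] by blast
      from covered[OF * this that] show ?thesis using a \<open>N > M\<close> by (auto simp: res_add)
    qed
    show False
    \<comment> \<open>Without wrap-around, layer M lands above residue M. Otherwise the layer N
      minus the residue of a exists and lands on the residue 0.\<close>
    proof (cases "res N a + int M < int N")
      case True
      with near[of M] r \<open>M \<ge> 1\<close> show False by simp
    next
      case False
      with r have "nat (int N - res N a) \<in> {1..M}" by auto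
      from near[OF this] r show False by simp
    qed
  qed
  show ?thesis unfolding tiling_def
  proof (intro conjI ballI allI impI)
    fix j x assume "j \<in> {1..J}" "x \<in> slice_set (X j)"
    then show "vec d x" using vec' by (auto simp: slice_set_def)
  next
    fix i j f g x y
    assume *: "i \<in> {1..J}" "j \<in> {1..J}" "f \<in> F m i" "g \<in> F m j"
      "x \<in> slice_set (X i)" "y \<in> slice_set (X j)" and eq: "vec_add f x = vec_add g y"
    then have xy: "x @ [zero] \<in> X i" "y @ [zero] \<in> X j" by (simp_all add: slice_set_def)
    then have "length f = length x" "length g = length y"
      using * m len vec'(1) by (metis vec_def)+
    then have "vec_add (f @ [int m]) (x @ [zero]) = vec_add (g @ [int m]) (y @ [zero])"
      using eq by (simp add: vec_add_snoc)
    moreover note til[unfolded tiling_def] *(1,2) stacked[OF *(3) m] stacked[OF *(4) m] xy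
    ultimately have "i = j \<and> f @ [int m] = g @ [int m]" by blast
    then show "i = j" "f = g" by simp_all
  next
    fix y assume y: "vec d y"
    have m_res: "res N (add (int m) zero) = int m"
      using m \<open>N > M\<close> by (simp add: res_add res_zero zero_closed)
    show "(\<exists>j\<in>{1..J}. \<exists>f\<in>F m j. \<exists>x\<in>slice_set (X j). y = vec_add f x) \<longleftrightarrow> ext d (E m) y"
    proof
      assume "\<exists>j\<in>{1..J}. \<exists>f\<in>F m j. \<exists>x\<in>slice_set (X j). y = vec_add f x"
      then obtain j f x where *: "x @ [zero] \<in> X j" "j \<in> {1..J}" "f \<in> F m j" "y = vec_add f x"
        by (auto simp: slice_set_def)
      from covered[OF *(1-3) m] show "ext d (E m) y" using m_res *(4) by auto
    next
      assume "ext d (E m) y"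
      then have "ext (Suc d) (stacked_lists M N E) (y @ [add (int m) zero])"
        using ext_stacked[OF y add_closed[OF zero_closed]] m m_res by blast
      moreover have "vec (Suc d) (y @ [add (int m) zero])"
        using y zero_closed by (auto simp: vec_snoc intro: add_closed)
      ultimately obtain j f' x' where *: "j \<in> {1..J}" "f' \<in> stacked_tiles M F j" "x' \<in> X j"
        "y @ [add (int m) zero] = vec_add f' x'"
        using til unfolding tiling_def by blast
      obtain f l where f: "f' = f @ [int l]" "l \<in> {1..M}" "f \<in> F l j"
        using *(2) by (auto simp: stacked_tiles_def)
      obtain x a where x: "x' = x @ [a]" "vec d x" "a \<in> Z"
        using vec[OF *(3,1)] by (auto simp: vec_snoc)
      have "length f = length x" using f x len *(1) by (auto simp: vec_def)
      with * f x have eq: "y = vec_add f x" "add (int m) zero = add (int l) a"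
        by (simp_all add: vec_add_snoc)
      have "res N (add (int l) a) = int l"
        using res_0[of x a j] x * f \<open>N > M\<close> by (simp add: res_add)
      with m_res eq(2) have "l = m" by simp
      moreover from this have "a = zero" using add_inj[OF x(3) zero_closed] eq(2) by metis
      ultimately have "x \<in> slice_set (X j)" "f \<in> F m j"
        using *(3) f(3) x(1) by (simp_all add: slice_set_def)
      with *(1) eq(1) show "\<exists>j\<in>{1..J}. \<exists>f\<in>F m j. \<exists>x\<in>slice_set (X j). y = vec_add f x"
        by blast
    qed
  qed
qed

text \<open>\<open>adm\<close> stands for what is required of the unknowns besides the tiling:
  nothing or a period in the standard lattice, internality in a model of ZFC.\<close>

theorem stacking:
  assumes lift: "\<And>A. (\<forall>x\<in>A. vec d x) \<Longrightarrow> adm d A \<Longrightarrow> adm (Suc d) (lift_set N A)"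
    and slice: "\<And>A. (\<forall>x\<in>A. vec (Suc d) x) \<Longrightarrow> adm (Suc d) A \<Longrightarrow> adm d (slice_set A)"
  shows "(\<exists>X. (\<forall>j\<in>{1..J}. adm d (X j)) \<and> (\<forall>m\<in>{1..M}. tiling d J (F m) (ext d (E m)) X)) \<longleftrightarrow>
    (\<exists>X. (\<forall>j\<in>{1..J}. adm (Suc d) (X j)) \<and>
      tiling (Suc d) J (stacked_tiles M F) (ext (Suc d) (stacked_lists M N E)) X)"
proof (intro iffI; elim exE conjE)
  fix X assume X: "\<forall>j\<in>{1..J}. adm d (X j)" and til: "\<forall>m\<in>{1..M}. tiling d J (F m) (ext d (E m)) X"
  have "tiling d J (F 1) (ext d (E 1)) X" using til \<open>M \<ge> 1\<close> by simp
  then have "\<forall>j\<in>{1..J}. \<forall>x\<in>X j. vec d x" unfolding tiling_def by blast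
  with X lift have "\<forall>j\<in>{1..J}. adm (Suc d) (lift_set N (X j))" by blast
  moreover have "tiling (Suc d) J (stacked_tiles M F) (ext (Suc d) (stacked_lists M N E))
      (\<lambda>j. lift_set N (X j))"
    by (rule tiling_lift) (use til in blast)
  ultimately show "\<exists>X. (\<forall>j\<in>{1..J}. adm (Suc d) (X j)) \<and>
    tiling (Suc d) J (stacked_tiles M F) (ext (Suc d) (stacked_lists M N E)) X"
    by (intro exI[of _ "\<lambda>j. lift_set N (X j)"] conjI)
next
  fix X assume X: "\<forall>j\<in>{1..J}. adm (Suc d) (X j)"
    and til: "tiling (Suc d) J (stacked_tiles M F) (ext (Suc d) (stacked_lists M N E)) X"
  then have "\<forall>j\<in>{1..J}. \<forall>x\<in>X j. vec (Suc d) x" unfolding tiling_def by blast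
  with X slice have "\<forall>j\<in>{1..J}. adm d (slice_set (X j))" by blast
  moreover have "\<forall>m\<in>{1..M}. tiling d J (F m) (ext d (E m)) (\<lambda>j. slice_set (X j))"
    using tiling_slice[OF til] by blast
  ultimately
  show "\<exists>X. (\<forall>j\<in>{1..J}. adm d (X j)) \<and> (\<forall>m\<in>{1..M}. tiling d J (F m) (ext d (E m)) X)"
    by (intro exI[of _ "\<lambda>j. slice_set (X j)"] conjI)
qed

end

end

section \<open>Integers and vectors inside a model of ZFC\<close>

abbreviation push :: "'a \<Rightarrow> (nat \<Rightarrow> 'a) \<Rightarrow> nat \<Rightarrow> 'a"  (infixr "##" 65)
  where "x ## e \<equiv> case_nat x e"

lemma sat_conjs: "sat mem e (conjs ps) \<longleftrightarrow> (\<forall>p\<in>set ps. sat mem e p)"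
  by (induction ps) (auto simp: conjs_def)

lemma sat_disjs: "sat mem e (disjs ps) \<longleftrightarrow> (\<exists>p\<in>set ps. sat mem e p)"
  by (induction ps) (auto simp: disjs_def)

lemma sat_Exis: "sat mem e ((Exi ^^ n) p) \<longleftrightarrow> (\<exists>e'. (\<forall>i. e' (i + n) = e i) \<and> sat mem e' p)"
proof (induction n arbitrary: e)
  case 0
  then show ?case by (auto simp: ext[of _ e])
next
  case (Suc n)
  have "(\<exists>x. \<forall>i. e' (i + n) = (x ## e) i) \<longleftrightarrow> (\<forall>i. e' (i + Suc n) = e i)" for e'
  proof
    assume "\<exists>x. \<forall>i. e' (i + n) = (x ## e) i"
    then obtain x where *: "\<And>i. e' (i + n) = (x ## e) i" by blast
    show "\<forall>i. e' (i + Suc n) = e i" using *[of "Suc i" for i] by simp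
  next
    assume "\<forall>i. e' (i + Suc n) = e i"
    then show "\<exists>x. \<forall>i. e' (i + n) = (x ## e) i"
      by (intro exI[of _ "e' n"]) (auto split: nat.split)
  qed
  moreover have "sat mem e ((Exi ^^ Suc n) p) \<longleftrightarrow>
      (\<exists>e'. (\<exists>x. \<forall>i. e' (i + n) = (x ## e) i) \<and> sat mem e' p)"
    using Suc by auto
  ultimately show ?case by simp
qed

text \<open>For a bijection this is an action of the standard integers. Applied to the successor, it
  replaces an addition inside the model, since only standard displacements occur.\<close>

definition int_funpow :: "('a \<Rightarrow> 'a) \<Rightarrow> int \<Rightarrow> 'a \<Rightarrow> 'a"
  where "int_funpow f c = (if 0 \<le> c then f ^^ nat c else inv_into UNIV f ^^ nat (- c))"

lemma int_funpow_succ: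
  assumes "bij f"
  shows "int_funpow f (c + 1) x = f (int_funpow f c x)"
proof (cases "0 \<le> c")
  case True
  then have "nat (c + 1) = Suc (nat c)" by simp
  then show ?thesis using True by (simp add: int_funpow_def)
next
  case False
  define k where "k = nat (- c - 1)"
  have "nat (- c) = Suc k" "c + 1 = - int k" using False by (simp_all add: k_def)
  then have "int_funpow f (c + 1) = inv_into UNIV f ^^ k" "int_funpow f c = inv_into UNIV f ^^ Suc k"
    using False by (auto simp: int_funpow_def)
  moreover have "f (inv_into UNIV f y) = y" for y
    using assms by (simp add: bij_is_surj surj_f_inv_f)
  ultimately show ?thesis by simp
qed

lemma int_funpow_add:
  assumes "bij f"
  shows "int_funpow f b (int_funpow f c x) = int_funpow f (b + c) x"
proof (induction b rule: int_induct[where k = 0])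
  case base
  show ?case by (simp add: int_funpow_def)
next
  case (step1 b)
  then show ?case using int_funpow_succ[OF assms] by (metis add.assoc add.commute)
next
  case (step2 b)
  have "f (int_funpow f (b - 1) (int_funpow f c x)) = f (int_funpow f (b - 1 + c) x)"
    using step2 int_funpow_succ[OF assms, of "b - 1"] int_funpow_succ[OF assms, of "b - 1 + c"]
    by (simp add: algebra_simps)
  then show ?case using assms by (meson bij_is_inj injD)
qed

section \<open>Elementary set theory in a model of ZFC\<close>

locale zfc_model =
  fixes mem :: "'a \<Rightarrow> 'a \<Rightarrow> bool" (infix "\<epsilon>" 50)
  assumes ZFC: "p \<in> ZFC \<Longrightarrow> sat mem e p"
begin

lemma extensionality: "(\<And>z. z \<epsilon> x \<longleftrightarrow> z \<epsilon> y) \<Longrightarrow> x = y"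
  using ZFC[of extensionality undefined] by (simp add: ZFC_def extensionality_def eval_nat_numeral)

text \<open>In the axiom, index 1 of the formula is the set A. The auxiliary q skips that index, so
  that in p the parameters follow the element directly.\<close>

lemma separation: "\<exists>B. \<forall>x. x \<epsilon> B \<longleftrightarrow> x \<epsilon> A \<and> sat mem (x ## e) p"
proof -
  define q where "q = ren (lift_ren Suc) p"
  have q: "sat mem (x ## A ## e) q \<longleftrightarrow> sat mem (x ## e) p" for x
  proof -
    have "(x ## A ## e) \<circ> lift_ren Suc = x ## e"
      by (rule ext) (simp add: lift_ren_eq split: nat.split)
    then show ?thesis by (simp only: q_def sat_eq_ren)
  qed
  have "separation q \<in> ZFC" by (simp add: ZFC_def)
  from ZFC[OF this, of e]
  obtain B where B: "\<And>x. x \<epsilon> B \<longleftrightarrow> x \<epsilon> A \<and> sat mem (x ## B ## A ## e) (ren (lift_ren Suc) q)"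
    by (simp add: separation_def eval_nat_numeral) blast
  have "(x ## B ## A ## e) \<circ> lift_ren Suc = x ## A ## e" for x
    by (rule ext) (simp add: lift_ren_eq split: nat.split)
  then have "sat mem (x ## B ## A ## e) (ren (lift_ren Suc) q) \<longleftrightarrow> sat mem (x ## e) p" for x
    by (simp only: sat_eq_ren q)
  with B show ?thesis by blast
qed

text \<open>Pairing, like union and power set below, is axiomatised by the existence of a large
  enough set; separation cuts out the exact one.\<close>

lemma upair_ex: "\<exists>c. \<forall>z. z \<epsilon> c \<longleftrightarrow> z = a \<or> z = b"
proof -
  obtain c where "a \<epsilon> c" "b \<epsilon> c"
    using ZFC[of pairing undefined] by (auto simp: ZFC_def pairing_def eval_nat_numeral)
  then show ?thesis
    using separation[of c "a ## b ## undefined" "(0 \<^bold>= 1) \<^bold>\<or> (0 \<^bold>= 2)"] by (auto simp: eval_nat_numeral)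
qed

lemma union_superset: "\<exists>u. \<forall>b c. c \<epsilon> b \<and> b \<epsilon> a \<longrightarrow> c \<epsilon> u"
  using ZFC[of union_axiom undefined] by (simp add: ZFC_def union_axiom_def eval_nat_numeral) blast

lemma powerset_superset: "\<exists>u. \<forall>x. (\<forall>z. z \<epsilon> x \<longrightarrow> z \<epsilon> a) \<longrightarrow> x \<epsilon> u"
  using ZFC[of powerset undefined] by (simp add: ZFC_def powerset_def eval_nat_numeral) blast

lemma binary_union_superset: "\<exists>u. \<forall>z. z \<epsilon> a \<or> z \<epsilon> b \<longrightarrow> z \<epsilon> u"
  using upair_ex[of a b] union_superset by metis

lemma foundation: "x \<epsilon> a \<Longrightarrow> \<exists>y. y \<epsilon> a \<and> (\<forall>z. z \<epsilon> a \<longrightarrow> \<not> z \<epsilon> y)"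
  using ZFC[of foundation undefined] by (simp add: ZFC_def foundation_def eval_nat_numeral) blast

text \<open>Foundation for the pair {x, y}; this makes \<open>suc\<close> injective.\<close>

lemma no_cycle: "x \<epsilon> y \<Longrightarrow> \<not> y \<epsilon> x"
  using upair_ex[of x y] foundation by metis

definition "Emp = (THE x. \<forall>z. \<not> z \<epsilon> x)"

lemma mem_Emp: "\<not> z \<epsilon> Emp"
proof -
  obtain x where "\<forall>z. \<not> z \<epsilon> x" using separation[of undefined undefined "\<^bold>\<bottom>"] by auto
  then have "\<exists>!x. \<forall>z. \<not> z \<epsilon> x" using extensionality by blast
  from theI'[OF this] show ?thesis by (simp add: Emp_def)
qed

definition "suc x = (THE s. \<forall>z. z \<epsilon> s \<longleftrightarrow> z \<epsilon> x \<or> z = x)"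

lemma mem_suc: "z \<epsilon> suc x \<longleftrightarrow> z \<epsilon> x \<or> z = x"
proof -
  obtain y where "\<forall>z. z \<epsilon> y \<longleftrightarrow> z = x" using upair_ex[of x x] by auto
  moreover obtain u where "\<forall>z. z \<epsilon> x \<or> z \<epsilon> y \<longrightarrow> z \<epsilon> u" using binary_union_superset by blast
  ultimately obtain s where "\<forall>z. z \<epsilon> s \<longleftrightarrow> z \<epsilon> x \<or> z = x"
    using separation[of u "x ## undefined" "(0 \<^bold>\<in> 1) \<^bold>\<or> (0 \<^bold>= 1)"] by auto
  then have "\<exists>!s. \<forall>z. z \<epsilon> s \<longleftrightarrow> z \<epsilon> x \<or> z = x" using extensionality by blast
  from theI'[OF this] show ?thesis by (simp add: suc_def)
qed

definition "upair x y = (THE c. \<forall>z. z \<epsilon> c \<longleftrightarrow> z = x \<or> z = y)"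

lemma mem_upair: "z \<epsilon> upair x y \<longleftrightarrow> z = x \<or> z = y"
proof -
  obtain c where "\<forall>z. z \<epsilon> c \<longleftrightarrow> z = x \<or> z = y" using upair_ex by blast
  then have "\<exists>!c. \<forall>z. z \<epsilon> c \<longleftrightarrow> z = x \<or> z = y" using extensionality by blast
  from theI'[OF this] show ?thesis by (simp add: upair_def)
qed

definition "pair x y = upair (upair x x) (upair x y)"

lemma upair_eq_iff: "upair a b = upair c d \<longleftrightarrow> a = c \<and> b = d \<or> a = d \<and> b = c"
proof
  assume "upair a b = upair c d"
  then have "z = a \<or> z = b \<longleftrightarrow> z = c \<or> z = d" for z using mem_upair by metis
  from this[of a] this[of b] this[of c] this[of d] show "a = c \<and> b = d \<or> a = d \<and> b = c" by auto
next
  have "upair a b = upair b a" by (rule extensionality) (auto simp: mem_upair)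
  then show "a = c \<and> b = d \<or> a = d \<and> b = c \<Longrightarrow> upair a b = upair c d" by auto
qed

lemma pair_inject [simp]: "pair a b = pair c d \<longleftrightarrow> a = c \<and> b = d"
  unfolding pair_def upair_eq_iff by blast

lemma pair_not_Emp [simp]: "pair a b \<noteq> Emp" "Emp \<noteq> pair a b"
  using mem_Emp mem_upair unfolding pair_def by metis+

text \<open>Kuratowski pairs of elements of A lie in the second power set of A.\<close>

lemma pairs_superset: "\<exists>B. \<forall>x y. x \<epsilon> A \<longrightarrow> y \<epsilon> A \<longrightarrow> pair x y \<epsilon> B"
proof -
  obtain P where "\<forall>x. (\<forall>z. z \<epsilon> x \<longrightarrow> z \<epsilon> A) \<longrightarrow> x \<epsilon> P" using powerset_superset by blast
  moreover obtain B where "\<forall>x. (\<forall>z. z \<epsilon> x \<longrightarrow> z \<epsilon> P) \<longrightarrow> x \<epsilon> B" using powerset_superset by blast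
  ultimately have "pair x y \<epsilon> B" if "x \<epsilon> A" "y \<epsilon> A" for x y
    using that unfolding pair_def by (metis mem_upair)
  then show ?thesis by blast
qed

lemma suc_not_Emp [simp]: "suc x \<noteq> Emp" "Emp \<noteq> suc x"
  using mem_Emp mem_suc by metis+

lemma suc_inject [simp]: "suc x = suc y \<longleftrightarrow> x = y"
  using mem_suc no_cycle by metis

lemma sat_is_empty [simp]: "sat mem e (is_empty i) \<longleftrightarrow> e i = Emp"
  using mem_Emp extensionality by (auto simp: is_empty_def)

lemma sat_is_succ [simp]: "sat mem e (is_succ i s) \<longleftrightarrow> e s = suc (e i)"
proof -
  have "sat mem e (is_succ i s) \<longleftrightarrow> (\<forall>z. z \<epsilon> e s \<longleftrightarrow> z \<epsilon> suc (e i))"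
    by (simp add: is_succ_def mem_suc) blast
  then show ?thesis using extensionality by metis
qed

lemma sat_is_upair [simp]: "sat mem e (is_upair i j p) \<longleftrightarrow> e p = upair (e i) (e j)"
proof -
  have "sat mem e (is_upair i j p) \<longleftrightarrow> (\<forall>z. z \<epsilon> e p \<longleftrightarrow> z \<epsilon> upair (e i) (e j))"
    by (simp add: is_upair_def mem_upair) blast
  then show ?thesis using extensionality by metis
qed

lemma sat_is_pair [simp]: "sat mem e (is_pair i j p) \<longleftrightarrow> e p = pair (e i) (e j)"
  by (simp add: is_pair_def pair_def)

subsection \<open>Natural numbers\<close>

definition succ_closed :: "'a \<Rightarrow> bool"
  where "succ_closed I \<longleftrightarrow> Emp \<epsilon> I \<and> (\<forall>x. x \<epsilon> I \<longrightarrow> suc x \<epsilon> I)"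

text \<open>The numbers of the model, collected in the metatheory. In a nonstandard model there are
  more of them than finite iterates of \<open>suc\<close> on \<open>Emp\<close>.\<close>

definition omega :: "'a set"
  where "omega = {n. \<forall>I. succ_closed I \<longrightarrow> n \<epsilon> I}"

lemma sat_is_inductive [simp]: "sat mem e (is_inductive i) \<longleftrightarrow> succ_closed (e i)"
  by (simp add: is_inductive_def succ_closed_def)

lemma sat_is_natural [simp]: "sat mem e (is_natural i) \<longleftrightarrow> e i \<in> omega"
  by (simp add: is_natural_def omega_def)

lemma succ_closed_ex: "\<exists>I. succ_closed I"
  using ZFC[of infinity undefined] by (simp add: ZFC_def infinity_def)

lemma Emp_omega [simp]: "Emp \<in> omega"
  by (simp add: omega_def succ_closed_def)

lemma suc_omega: "n \<in> omega \<Longrightarrow> suc n \<in> omega"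
  by (simp add: omega_def succ_closed_def)

text \<open>The formula p, with parameters in e, turns P into a set B of the model by separation. B
  is inductive and therefore contains n. The environment \<open>undefined\<close> in applications
  goes with formulas without parameters.\<close>

lemma omega_induct [consumes 1, case_names Emp suc definable]:
  assumes "n \<in> omega" "P Emp" "\<And>n. n \<in> omega \<Longrightarrow> P n \<Longrightarrow> P (suc n)"
    and definable: "\<And>n. n \<in> omega \<Longrightarrow> P n \<longleftrightarrow> sat mem (n ## e) p"
  shows "P n"
proof -
  obtain I where I: "succ_closed I" using succ_closed_ex by blast
  obtain B where B: "\<And>n. n \<epsilon> B \<longleftrightarrow> n \<epsilon> I \<and> n \<in> omega \<and> sat mem (n ## e) p"
    using separation[of I e "is_natural 0 \<^bold>\<and> p"] by auto
  have "succ_closed B"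
    using I assms(2,3) suc_omega unfolding succ_closed_def B by (metis definable Emp_omega)
  with assms(1) have "n \<epsilon> B" unfolding omega_def by blast
  with assms(1) definable show ?thesis by (simp add: B)
qed

lemma omega_cases: "n \<in> omega \<Longrightarrow> n = Emp \<or> (\<exists>m\<in>omega. n = suc m)"
proof (induction rule: omega_induct[where e = undefined
      and p = "is_empty 0 \<^bold>\<or> (\<^bold>\<exists> (is_natural 0 \<^bold>\<and> is_succ 0 1))"])
qed auto

lemma suc_omega_iff [simp]: "suc n \<in> omega \<longleftrightarrow> n \<in> omega"
  using omega_cases[of "suc n"] suc_omega by auto

subsection \<open>Integers\<close>

definition "nonneg n = pair Emp n"
definition "neg n = pair (suc Emp) n"
definition integers :: "'a set" where "integers = nonneg ` omega \<union> neg ` omega"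

lemma int_distinct [simp]:
  "nonneg m = nonneg n \<longleftrightarrow> m = n" "neg m = neg n \<longleftrightarrow> m = n" "nonneg m \<noteq> neg n" "neg n \<noteq> nonneg m"
  by (simp_all add: nonneg_def neg_def)

lemma nonneg_integers [simp]: "nonneg n \<in> integers \<longleftrightarrow> n \<in> omega"
  and neg_integers [simp]: "neg n \<in> integers \<longleftrightarrow> n \<in> omega"
  by (auto simp: integers_def)

lemma sat_is_nonneg [simp]: "sat mem e (is_nonneg n a) \<longleftrightarrow> e a = nonneg (e n)"
  by (simp add: is_nonneg_def nonneg_def)

lemma sat_is_negative [simp]: "sat mem e (is_negative n a) \<longleftrightarrow> e a = neg (e n)"
  by (simp add: is_negative_def neg_def)

lemma sat_is_integer [simp]: "sat mem e (is_integer a) \<longleftrightarrow> e a \<in> integers"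
  by (auto simp: is_integer_def integers_def)

definition int_succ :: "'a \<Rightarrow> 'a \<Rightarrow> bool"
  where "int_succ a b \<longleftrightarrow> (\<exists>n. a = nonneg n \<and> b = nonneg (suc n)) \<or>
    (a = neg Emp \<and> b = nonneg Emp) \<or> (\<exists>n. a = neg (suc n) \<and> b = neg n)"

lemma sat_is_int_succ [simp]: "sat mem e (is_int_succ a b) \<longleftrightarrow> int_succ (e a) (e b)"
  by (auto simp: is_int_succ_def int_succ_def)

text \<open>The identity outside the integers makes this a bijection of the whole type, so that its
  inverse can be iterated.\<close>

definition next_int :: "'a \<Rightarrow> 'a"
  where "next_int a = (if a \<in> integers then THE b. int_succ a b else a)"

lemma int_succ_det: "int_succ a b \<Longrightarrow> int_succ a c \<Longrightarrow> b = c"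
  and int_succ_inj: "int_succ a c \<Longrightarrow> int_succ b c \<Longrightarrow> a = b"
  by (auto simp: int_succ_def)

lemma int_succ_integers: "int_succ a b \<Longrightarrow> a \<in> integers \<longleftrightarrow> b \<in> integers"
  by (auto simp: int_succ_def)

lemma int_succ_ex: "a \<in> integers \<Longrightarrow> \<exists>b. int_succ a b" "b \<in> integers \<Longrightarrow> \<exists>a. int_succ a b"
proof -
  have cases: "(\<exists>n. a = nonneg (suc n)) \<or> a = nonneg Emp \<or> a = neg Emp \<or> (\<exists>n. a = neg (suc n))"
    if "a \<in> integers" for a
    using that omega_cases unfolding integers_def by auto
  show "a \<in> integers \<Longrightarrow> \<exists>b. int_succ a b" "b \<in> integers \<Longrightarrow> \<exists>a. int_succ a b"
    using cases[of a] cases[of b] unfolding int_succ_def by auto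
qed

lemma int_succ_next_int: "a \<in> integers \<Longrightarrow> int_succ a (next_int a)"
proof -
  assume a: "a \<in> integers"
  then have "\<exists>!b. int_succ a b" using int_succ_ex(1)[of a] int_succ_det[of a] by blast
  from theI'[OF this] a show ?thesis by (simp add: next_int_def)
qed

lemma int_succ_iff: "a \<in> integers \<or> b \<in> integers \<Longrightarrow> int_succ a b \<longleftrightarrow> a \<in> integers \<and> b = next_int a"
  using int_succ_next_int int_succ_det int_succ_integers by blast

lemma next_int_integers [simp]: "next_int a \<in> integers \<longleftrightarrow> a \<in> integers"
  using int_succ_next_int[of a] int_succ_integers by (cases "a \<in> integers") (auto simp: next_int_def)

lemma bij_next_int: "bij next_int"
proof (rule bijI)
  show "inj next_int"
  proof (rule injI)
    fix a b assume eq: "next_int a = next_int b"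
    show "a = b"
    proof (cases "a \<in> integers")
      case True
      then have "b \<in> integers" using next_int_integers[of a] next_int_integers[of b] eq by simp
      with True have "int_succ a (next_int b)" "int_succ b (next_int b)"
        using int_succ_next_int eq by metis+
      then show ?thesis by (rule int_succ_inj)
    next
      case False
      then have "b \<notin> integers" using next_int_integers[of a] next_int_integers[of b] eq by simp
      with False eq show ?thesis by (simp add: next_int_def)
    qed
  qed
  have "\<exists>a. b = next_int a" for b
  proof (cases "b \<in> integers")
    case True
    then show ?thesis using int_succ_ex(2) int_succ_iff by blast
  next
    case False
    then have "b = next_int b" by (simp add: next_int_def)
    then show ?thesis by blast
  qed
  then show "surj next_int" unfolding surj_def by blast
qed

lemma next_int_simps:
  "n \<in> omega \<Longrightarrow> next_int (nonneg n) = nonneg (suc n)"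
  "next_int (neg Emp) = nonneg Emp"
  "n \<in> omega \<Longrightarrow> next_int (neg (suc n)) = neg n"
  using int_succ_iff[of "nonneg n" "nonneg (suc n)"] int_succ_iff[of "neg Emp" "nonneg Emp"]
    int_succ_iff[of "neg (suc n)" "neg n"] by (simp_all add: int_succ_def)

definition add :: "int \<Rightarrow> 'a \<Rightarrow> 'a"
  where "add = int_funpow next_int"

lemma add_0 [simp]: "add 0 a = a"
  by (simp add: add_def int_funpow_def)

lemma add_add [simp]: "add b (add c a) = add (b + c) a"
  unfolding add_def by (rule int_funpow_add[OF bij_next_int])

lemma add_succ: "add (c + 1) a = next_int (add c a)"
  unfolding add_def by (rule int_funpow_succ[OF bij_next_int])

lemma add_1: "add 1 a = next_int a"
  using add_succ[of 0 a] by simp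

lemma add_integers [simp]: "add c a \<in> integers \<longleftrightarrow> a \<in> integers"
proof (induction c rule: int_induct[where k = 0])
  case (step1 c)
  then show ?case by (simp add: add_succ)
next
  case (step2 c)
  then show ?case using add_succ[of "c - 1" a] by simp
qed simp

lemma add_eq_iff: "b = add c a \<longleftrightarrow> a = add (- c) b"
  using add_add[of c "- c"] add_add[of "- c" c] by auto

definition zero :: 'a where "zero = nonneg Emp"

lemma zero_integers [simp]: "zero \<in> integers"
  by (simp add: zero_def)

text \<open>This and the following facts about signs serve to keep upward and downward multiples
  apart in \<open>not_cong_0\<close>.\<close>

lemma next_nonneg: "a \<in> nonneg ` omega \<Longrightarrow> next_int a \<in> nonneg ` omega - {zero}"
  by (auto simp: next_int_simps zero_def)

lemma add_nonneg: "a \<in> nonneg ` omega \<Longrightarrow> add (int k) a \<in> nonneg ` omega"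
  and add_nonneg_pos: "a \<in> nonneg ` omega \<Longrightarrow> add (int (Suc k)) a \<in> nonneg ` omega - {zero}"
proof -
  have Suc: "add (int (Suc k)) a = next_int (add (int k) a)" for k
    by (simp add: add_1[symmetric])
  show *: "add (int k) a \<in> nonneg ` omega" if "a \<in> nonneg ` omega" for k
    using that by (induction k) (use next_nonneg in \<open>auto simp: Suc simp del: of_nat_Suc\<close>)
  show "add (int (Suc k)) a \<in> nonneg ` omega - {zero}" if "a \<in> nonneg ` omega"
    unfolding Suc by (rule next_nonneg) (rule *[OF that])
qed

lemma prev_neg: "a \<in> insert zero (neg ` omega) \<Longrightarrow> add (- 1) a \<in> neg ` omega"
proof -
  have "add (- 1) zero = neg Emp"
    using add_eq_iff[of zero 1 "neg Emp"] by (simp add: add_1 next_int_simps zero_def)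
  moreover have "add (- 1) (neg n) = neg (suc n)" if "n \<in> omega" for n
    using add_eq_iff[of "neg n" 1 "neg (suc n)"] that by (simp add: add_1 next_int_simps)
  ultimately show "a \<in> insert zero (neg ` omega) \<Longrightarrow> add (- 1) a \<in> neg ` omega" by auto
qed

lemma add_neg: "a \<in> insert zero (neg ` omega) \<Longrightarrow> add (- int k) a \<in> insert zero (neg ` omega)"
  and add_neg_pos: "a \<in> insert zero (neg ` omega) \<Longrightarrow> add (- int (Suc k)) a \<in> neg ` omega"
proof -
  have Suc: "add (- int (Suc k)) a = add (- 1) (add (- int k) a)" for k by simp
  show *: "add (- int k) a \<in> insert zero (neg ` omega)" if "a \<in> insert zero (neg ` omega)" for k
    using that
  proof (induction k)
    case (Suc k)
    then show ?case unfolding \<open>add (- int (Suc k)) a = _\<close> using prev_neg by blast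
  qed simp
  show "add (- int (Suc k)) a \<in> neg ` omega" if "a \<in> insert zero (neg ` omega)"
    unfolding Suc by (rule prev_neg) (rule *[OF that])
qed

lemma sat_is_int_add_nat: "sat mem e (is_int_add_nat n a b) \<longleftrightarrow> (int_succ ^^ n) (e a) (e b)"
  by (induction n arbitrary: e a b) (auto simp: relpowp_Suc_left relcompp_apply simp del: relpowp.simps(2))

lemma relpowp_int_succ:
  "a \<in> integers \<or> b \<in> integers \<Longrightarrow> (int_succ ^^ n) a b \<longleftrightarrow> a \<in> integers \<and> b = add (int n) a"
proof (induction n arbitrary: b)
  case (Suc n)
  have *: "add (int (Suc n)) a = next_int (add (int n) a)" by (simp add: add_1[symmetric])
  have "(int_succ ^^ Suc n) a b \<longleftrightarrow> (\<exists>c. (int_succ ^^ n) a c \<and> int_succ c b)"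
    by (simp add: relcompp_apply)
  also have "\<dots> \<longleftrightarrow> a \<in> integers \<and> b = next_int (add (int n) a)"
    using Suc int_succ_iff next_int_integers add_integers by metis
  finally show ?case unfolding * .
qed auto

text \<open>For negative c the formula counts upwards from b to a, so either end may be the one
  known to be an integer.\<close>

lemma sat_is_int_add:
  assumes "e a \<in> integers \<or> e b \<in> integers"
  shows "sat mem e (is_int_add c a b) \<longleftrightarrow> e a \<in> integers \<and> e b = add c (e a)"
proof (cases "0 \<le> c")
  case True
  then show ?thesis using assms
    by (simp add: is_int_add_def sat_is_int_add_nat relpowp_int_succ)
next
  case False
  then have "sat mem e (is_int_add c a b) \<longleftrightarrow> e b \<in> integers \<and> e a = add (- c) (e b)"
    using assms by (simp add: is_int_add_def sat_is_int_add_nat relpowp_int_succ disj_commute)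
  then show ?thesis using add_eq_iff[of "e b" c "e a"] add_integers by metis
qed

lemma sat_is_int_const [simp]: "sat mem e (is_int_const c a) \<longleftrightarrow> e a = add c zero"
  by (simp add: is_int_const_def sat_is_int_add zero_def)

text \<open>Separation needs an ambient set. Pairs over an inductive set suffice, because the tags 0
  and 1 are themselves numbers.\<close>

lemma integers_superset: "\<exists>V. \<forall>a\<in>integers. a \<epsilon> V"
proof -
  obtain I where I: "succ_closed I" using succ_closed_ex by blast
  then have "n \<epsilon> I" if "n \<in> omega" for n using that by (simp add: omega_def)
  moreover obtain V where "\<forall>x y. x \<epsilon> I \<longrightarrow> y \<epsilon> I \<longrightarrow> pair x y \<epsilon> V" using pairs_superset by blast
  ultimately have "\<forall>a\<in>integers. a \<epsilon> V" unfolding integers_def nonneg_def neg_def by auto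
  then show ?thesis by blast
qed

text \<open>Two inductions on \<open>omega\<close>, one upwards along \<open>nonneg\<close> and one
  downwards along \<open>neg\<close>, both starting from zero.\<close>

lemma integers_induct [consumes 1, case_names zero step definable]:
  assumes "a \<in> integers" "P zero" "\<And>a. a \<in> integers \<Longrightarrow> P a \<Longrightarrow> P (add 1 a) \<and> P (add (- 1) a)"
    and definable: "\<And>a. a \<in> integers \<Longrightarrow> P a \<longleftrightarrow> sat mem (a ## e) p"
  shows "P a"
proof -
  \<comment> \<open>In the formulas for \<open>omega_induct\<close> the code of the integer is bound
    above the number n; q is p made to skip n.\<close>
  define q where "q = ren (lift_ren Suc) p"
  have q: "sat mem (x ## n ## e) q \<longleftrightarrow> sat mem (x ## e) p" for x n
  proof -
    have "(x ## n ## e) \<circ> lift_ren Suc = x ## e"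
      by (rule ext) (simp add: lift_ren_eq split: nat.split)
    then show ?thesis by (simp only: q_def sat_eq_ren)
  qed
  have nonneg: "P (nonneg n)" if "n \<in> omega" for n
    using that
  proof (induction rule: omega_induct[where e = e and p = "\<^bold>\<exists> (is_nonneg 1 0 \<^bold>\<and> q)"])
    case (suc n)
    then show ?case using assms(3)[of "nonneg n"] by (simp add: add_1 next_int_simps)
  qed (use assms(2) definable in \<open>simp_all add: zero_def q\<close>)
  have prev: "add (- 1) (neg n) = neg (suc n)" if "n \<in> omega" for n
    using add_eq_iff[of "neg n" 1 "neg (suc n)"] that by (simp add: add_1 next_int_simps)
  have neg: "P (neg n)" if "n \<in> omega" for n
    using that
  proof (induction rule: omega_induct[where e = e and p = "\<^bold>\<exists> (is_negative 1 0 \<^bold>\<and> q)"])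
    case Emp
    have "add (- 1) zero = neg Emp"
      using add_eq_iff[of zero 1 "neg Emp"] by (simp add: add_1 next_int_simps zero_def)
    then show ?case using assms(3)[of zero] assms(2) by simp
  next
    case (suc n)
    then show ?case using assms(3)[of "neg n"] prev by simp
  qed (use definable in \<open>simp_all add: q\<close>)
  from nonneg neg assms(1) show ?thesis unfolding integers_def by blast
qed

end

context zfc_model begin

subsection \<open>Residues modulo standard moduli\<close>

text \<open>Membership in every closed set of the model that contains c. The step relation is a
  parameter because \<open>not_cong_0\<close> needs steps in a single direction besides the two-way
  steps of \<open>cong\<close>.\<close>

definition reachable :: "('a \<Rightarrow> 'a \<Rightarrow> bool) \<Rightarrow> int \<Rightarrow> 'a \<Rightarrow> bool"
  where "reachable R c a \<longleftrightarrow>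
    (\<forall>s. add c zero \<epsilon> s \<and> (\<forall>x y. x \<epsilon> s \<and> R x y \<longrightarrow> y \<epsilon> s) \<longrightarrow> a \<epsilon> s)"

definition is_reachable :: "fm \<Rightarrow> int \<Rightarrow> nat \<Rightarrow> fm"
  where "is_reachable q c a =
    (\<^bold>\<forall> (((\<^bold>\<exists> (is_int_const c 0 \<^bold>\<and> (0 \<^bold>\<in> 1))) \<^bold>\<and>
         (\<^bold>\<forall> (\<^bold>\<forall> (((1 \<^bold>\<in> 2) \<^bold>\<and> q) \<^bold>\<longrightarrow> (0 \<^bold>\<in> 2)))))
        \<^bold>\<longrightarrow> (Suc a \<^bold>\<in> 0)))"

lemma sat_is_reachable:
  assumes "\<And>x y e. sat mem (y ## x ## e) q \<longleftrightarrow> R x y"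
  shows "sat mem e (is_reachable q c a) \<longleftrightarrow> reachable R c (e a)"
  by (simp add: is_reachable_def reachable_def assms eval_nat_numeral) blast

lemma reachable_base: "reachable R c (add c zero)"
  by (auto simp: reachable_def)

lemma reachable_step: "reachable R c x \<Longrightarrow> R x y \<Longrightarrow> reachable R c y"
  unfolding reachable_def by blast

text \<open>Separation turns the integers with P into a set s of the model. It contains the start
  and is closed under R, so it is one of the sets that must contain a.\<close>

lemma reachable_induct [consumes 1, case_names closed base step definable]:
  assumes "reachable R c a" "\<And>x y. x \<in> integers \<Longrightarrow> R x y \<Longrightarrow> y \<in> integers"
    and "P (add c zero)" "\<And>x y. x \<in> integers \<Longrightarrow> P x \<Longrightarrow> R x y \<Longrightarrow> P y"
    and definable: "\<And>x. x \<in> integers \<Longrightarrow> P x \<longleftrightarrow> sat mem (x ## e) p"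
  shows "P a \<and> a \<in> integers"
proof -
  obtain V where V: "\<And>x. x \<in> integers \<Longrightarrow> x \<epsilon> V" using integers_superset by blast
  obtain s where s: "\<And>x. x \<epsilon> s \<longleftrightarrow> x \<epsilon> V \<and> x \<in> integers \<and> sat mem (x ## e) p"
    using separation[of V e "is_integer 0 \<^bold>\<and> p"] by auto
  have s': "x \<epsilon> s \<longleftrightarrow> x \<in> integers \<and> P x" for x using s V definable by blast
  have "add c zero \<epsilon> s" unfolding s' using assms(3) by simp
  moreover have "y \<epsilon> s" if "x \<epsilon> s" "R x y" for x y
    using that assms(2,4) unfolding s' by blast
  ultimately have "a \<epsilon> s" using assms(1) unfolding reachable_def by blast
  then show ?thesis by (simp add: s')
qed

abbreviation up :: "nat \<Rightarrow> 'a \<Rightarrow> 'a \<Rightarrow> bool" where "up n x y \<equiv> (int_succ ^^ n) x y"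
abbreviation down :: "nat \<Rightarrow> 'a \<Rightarrow> 'a \<Rightarrow> bool" where "down n x y \<equiv> (int_succ ^^ n) y x"

lemma up_iff: "x \<in> integers \<Longrightarrow> up n x y \<longleftrightarrow> y = add (int n) x"
  using relpowp_int_succ by blast

lemma down_iff: "x \<in> integers \<Longrightarrow> down n x y \<longleftrightarrow> y = add (- int n) x"
  using relpowp_int_succ[of y x n] add_eq_iff[of x "int n" y] by auto

definition cong :: "nat \<Rightarrow> int \<Rightarrow> 'a \<Rightarrow> bool"
  where "cong n = reachable (\<lambda>x y. up n x y \<or> down n x y)"

lemma sat_is_int_cong: "sat mem e (is_int_cong n c a) \<longleftrightarrow> cong n c (e a)"
proof -
  have "is_int_cong n c a =
      is_reachable (is_int_add (int n) 1 0 \<^bold>\<or> is_int_add (int n) 0 1) c a"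
    by (simp add: is_int_cong_def is_reachable_def)
  then show ?thesis unfolding cong_def
    by (simp only:) (rule sat_is_reachable, auto simp: is_int_add_def sat_is_int_add_nat)
qed

lemma cong_induct [consumes 1, case_names base up down definable]:
  assumes "cong n c a" "P (add c zero)"
    and "\<And>x. x \<in> integers \<Longrightarrow> P x \<Longrightarrow> P (add (int n) x)"
    and "\<And>x. x \<in> integers \<Longrightarrow> P x \<Longrightarrow> P (add (- int n) x)"
    and "\<And>x. x \<in> integers \<Longrightarrow> P x \<longleftrightarrow> sat mem (x ## e) p"
  shows "P a \<and> a \<in> integers"
  using assms(1) unfolding cong_def
proof (induction rule: reachable_induct[where e = e and p = p])
  case (closed x y)
  then show ?case by (auto simp: up_iff down_iff)
next
  case (step x y)
  then show ?case using assms(3,4)[of x] by (auto simp: up_iff down_iff)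
qed (use assms in blast)+

lemma cong_integers: "cong n c a \<Longrightarrow> a \<in> integers"
  using cong_induct[of n c a "\<lambda>_. True" undefined "\<^bold>\<not> \<^bold>\<bottom>"] by simp

lemma cong_base: "cong n c (add c zero)"
  unfolding cong_def by (rule reachable_base)

lemma cong_step:
  assumes "cong n c a"
  shows "cong n c (add (int n) a)" "cong n c (add (- int n) a)"
  unfolding cong_def
  by (rule reachable_step[OF assms[unfolded cong_def]], simp add: up_iff down_iff cong_integers[OF assms])+

lemma cong_translate: "cong n c a \<Longrightarrow> cong n (c + k) (add k a)"
proof -
  assume "cong n c a"
  then have "cong n (c + k) (add k a) \<and> a \<in> integers"
  proof (induction rule: cong_induct[where e = undefined
        and p = "\<^bold>\<exists> (is_int_add k 1 0 \<^bold>\<and> is_int_cong n (c + k) 0)"])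
    case base
    then show ?case using cong_base[of n "c + k"] by (simp add: add.commute)
  next
    case (up x)
    then show ?case using cong_step(1)[of n "c + k" "add k x"] by (simp add: add.commute)
  next
    case (down x)
    then show ?case using cong_step(2)[of n "c + k" "add k x"] by (simp add: add.commute)
  next
    case (definable x)
    then show ?case by (simp add: sat_is_int_add sat_is_int_cong)
  qed
  then show ?thesis ..
qed

lemma cong_absorb: "cong n c (add c' zero) \<Longrightarrow> cong n c' a \<Longrightarrow> cong n c a"
proof -
  assume base: "cong n c (add c' zero)"
  assume "cong n c' a"
  then have "cong n c a \<and> a \<in> integers"
  proof (induction rule: cong_induct[where e = undefined and p = "is_int_cong n c 0"])
    case (definable x)
    then show ?case by (simp add: sat_is_int_cong)
  qed (use base cong_step in blast)+
  then show ?thesis ..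
qed

lemma cong_multiple: "cong n c a \<Longrightarrow> cong n c (add (int n * k) a)"
proof (induction k rule: int_induct[where k = 0])
  case (step1 k)
  then show ?case using cong_step(1)[of n c "add (int n * k) a"] by (simp add: algebra_simps)
next
  case (step2 k)
  then show ?case using cong_step(2)[of n c "add (int n * k) a"] by (simp add: algebra_simps)
qed simp

lemma cong_mod: "cong n c a \<longleftrightarrow> cong n (c mod int n) a"
proof -
  have "cong n b (add (b + int n * k) zero)" for b k
    using cong_multiple[OF cong_base[of n b], of k] by (simp add: add.commute)
  from cong_absorb[OF this] have *: "cong n (b + int n * k) a \<Longrightarrow> cong n b a" for b k .
  show ?thesis
    using *[of "c mod int n" "c div int n"] *[of c "- (c div int n)"]
    by (auto simp: minus_mult_div_eq_mod mod_mult_div_eq)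
qed

text \<open>
  The multiples of n reached from 0 by upward steps are nonnegative, those reached by downward steps
  are nonpositive, and both kinds together are closed under steps in either direction. Hence r
  could only be reached upwards, from the negative number r - n.
\<close>

lemma not_cong_0:
  assumes "0 < r" "r < int n"
  shows "\<not> cong n 0 (add r zero)"
proof -
  define U where "U = reachable (up n) 0"
  define D where "D = reachable (down n) 0"
  have n: "n > 0" using assms by simp
  have sat_U: "sat mem e (is_reachable (is_int_add (int n) 1 0) 0 a) \<longleftrightarrow> U (e a)" for e a
    unfolding U_def by (rule sat_is_reachable) (simp add: is_int_add_def sat_is_int_add_nat)
  have sat_D: "sat mem e (is_reachable (is_int_add (int n) 0 1) 0 a) \<longleftrightarrow> D (e a)" for e a
    unfolding D_def by (rule sat_is_reachable) (simp add: is_int_add_def sat_is_int_add_nat)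
  have U0: "U zero" and D0: "D zero"
    using reachable_base[of _ 0] by (simp_all add: U_def D_def)
  have U_nonneg: "a \<in> nonneg ` omega" if "U a" for a
  proof -
    from that have "a \<in> nonneg ` omega \<and> a \<in> integers" unfolding U_def
    proof (induction rule: reachable_induct[where e = undefined
          and p = "\<^bold>\<exists> (is_natural 0 \<^bold>\<and> is_nonneg 0 1)"])
      case (step x y)
      then show ?case by (simp add: up_iff add_nonneg)
    qed (auto simp: up_iff zero_def)
    then show ?thesis ..
  qed
  have D_nonpos: "a \<in> insert zero (neg ` omega)" if "D a" for a
  proof -
    from that have "a \<in> insert zero (neg ` omega) \<and> a \<in> integers" unfolding D_def
    proof (induction rule: reachable_induct[where e = undefined
          and p = "is_int_const 0 0 \<^bold>\<or> (\<^bold>\<exists> (is_natural 0 \<^bold>\<and> is_negative 0 1))"])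
      case (step x y)
      then show ?case using add_neg[of x n] by (simp add: down_iff)
    qed (auto simp: down_iff)
    then show ?thesis ..
  qed
  have U_step: "U (add (int n) a)" if "U a" for a
    using that U_nonneg[OF that] up_iff[of a n] reachable_step[of "up n" 0 a] unfolding U_def by auto
  have D_step: "D (add (- int n) a)" if "D a" for a
    using that D_nonpos[OF that] down_iff[of a n] reachable_step[of "down n" 0 a] unfolding D_def by auto
  \<comment> \<open>Every member of U other than zero has its predecessor in U. The invariant
    includes U itself, so that after a step from x the predecessor x is known to lie in U.\<close>
  have U_cases: "a = zero \<or> U (add (- int n) a)" if "U a" for a
  proof -
    from that have "reachable (up n) 0 a" by (simp add: U_def)
    then have "((a = zero \<or> U (add (- int n) a)) \<and> U a) \<and> a \<in> integers"
    proof (induction rule: reachable_induct[where e = undefined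
          and P = "\<lambda>a. (a = zero \<or> U (add (- int n) a)) \<and> U a"
          and p = "(is_int_const 0 0 \<^bold>\<or> (\<^bold>\<exists> (is_int_add (- int n) 1 0 \<^bold>\<and>
            is_reachable (is_int_add (int n) 1 0) 0 0))) \<^bold>\<and> is_reachable (is_int_add (int n) 1 0) 0 0"])
    qed (use U0 U_step sat_U in \<open>auto simp: up_iff sat_is_int_add\<close>)
    then show ?thesis by blast
  qed
  have D_cases: "a = zero \<or> D (add (int n) a)" if "D a" for a
  proof -
    from that have "reachable (down n) 0 a" by (simp add: D_def)
    then have "((a = zero \<or> D (add (int n) a)) \<and> D a) \<and> a \<in> integers"
    proof (induction rule: reachable_induct[where e = undefined
          and P = "\<lambda>a. (a = zero \<or> D (add (int n) a)) \<and> D a"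
          and p = "(is_int_const 0 0 \<^bold>\<or> (\<^bold>\<exists> (is_int_add (int n) 1 0 \<^bold>\<and>
            is_reachable (is_int_add (int n) 0 1) 0 0))) \<^bold>\<and> is_reachable (is_int_add (int n) 0 1) 0 0"])
    qed (use D0 D_step sat_D in \<open>auto simp: down_iff sat_is_int_add\<close>)
    then show ?thesis by blast
  qed
  \<comment> \<open>A step against the direction of U or D stays inside by \<open>U_cases\<close> or
    \<open>D_cases\<close>, except at zero, where it enters the other set.\<close>
  have UD: "U a \<or> D a" if "cong n 0 a" for a
  proof -
    from that have "(U a \<or> D a) \<and> a \<in> integers"
    proof (induction rule: cong_induct[where e = undefined
          and p = "is_reachable (is_int_add (int n) 1 0) 0 0 \<^bold>\<or>
            is_reachable (is_int_add (int n) 0 1) 0 0"])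
      case (up x)
      then show ?case using U_step D_cases[of x] U0 by blast
    next
      case (down x)
      then show ?case using D_step U_cases[of x] D0 by blast
    qed (use U0 sat_U sat_D in auto)
    then show ?thesis ..
  qed
  \<comment> \<open>The sign lemmas speak of \<open>Suc k\<close> steps, hence k is one less than
    the distance from zero, here and in the next fact.\<close>
  have r_pos: "add r zero \<in> nonneg ` omega - {zero}"
    using add_nonneg_pos[of zero "nat r - 1"] assms(1) by (simp add: zero_def)
  have r_neg: "add (r - int n) zero \<in> neg ` omega"
    using add_neg_pos[of zero "nat (int n - r) - 1"] assms(2) by simp
  show ?thesis
  proof
    assume "cong n 0 (add r zero)"
    then consider "U (add r zero)" | "D (add r zero)" using UD by blast
    then show False
    proof cases
      case 1
      then have "U (add (r - int n) zero)" using U_cases[of "add r zero"] r_pos by auto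
      with U_nonneg r_neg show False by fastforce
    next
      case 2
      with D_nonpos r_pos show False by fastforce
    qed
  qed
qed

text \<open>Translation by -b makes the two classes those of 0 and k. If zero were not in the class
  of k, the complement of that class would be closed under steps of n and contain x, which lies in
  both classes. So zero is in it, and for k > 0 a further translation puts n - k into the class of
  0, against \<open>not_cong_0\<close>.\<close>

lemma cong_unique:
  assumes "n > 0" "cong n b a" "cong n c a"
  shows "b mod int n = c mod int n"
proof -
  define k where "k = (c - b) mod int n"
  have k: "0 \<le> k" "k < int n" using assms(1) by (simp_all add: k_def)
  define x where "x = add (- b) a"
  have x: "cong n 0 x" "cong n k x"
    using cong_translate[OF assms(2), of "- b"] cong_translate[OF assms(3), of "- b"]
      cong_mod[of n "c - b" x] by (simp_all add: x_def k_def)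
  have "k = 0"
  proof (rule ccontr)
    assume "k \<noteq> 0"
    have "cong n k zero"
    proof (rule ccontr)
      assume *: "\<not> cong n k zero"
      from x(1) have "\<not> cong n k x \<and> x \<in> integers"
      proof (induction rule: cong_induct[where e = undefined and p = "\<^bold>\<not> is_int_cong n k 0"])
        case (up x)
        then show ?case using cong_step(2)[of n k "add (int n) x"] by auto
      next
        case (down x)
        then show ?case using cong_step(1)[of n k "add (- int n) x"] by auto
      qed (use * in \<open>simp_all add: sat_is_int_cong\<close>)
      with x(2) show False by blast
    qed
    from cong_step(1)[OF cong_translate[OF this, of "- k"]]
    have "cong n 0 (add (int n - k) zero)" by simp
    with not_cong_0[of "int n - k" n] k \<open>k \<noteq> 0\<close> show False by simp
  qed
  then have "int n dvd c - b" by (simp add: k_def mod_eq_0_iff_dvd)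
  then show ?thesis by (metis mod_eq_dvd_iff)
qed

text \<open>As n is standard, the existence of a residue is a finite disjunction. Hence it is a
  formula, and induction on the integers of the model applies.\<close>

lemma cong_ex:
  assumes "n > 0" "a \<in> integers"
  shows "\<exists>c. 0 \<le> c \<and> c < int n \<and> cong n c a"
proof -
  have reduce: "\<exists>k<n. cong n (int k) x" if "cong n c x" for c x
    using that cong_mod[of n c x] assms(1)
    by (intro exI[of _ "nat (c mod int n)"]) (simp add: nat_less_iff)
  have "\<exists>k<n. cong n (int k) a"
    using assms(2)
  proof (induction rule: integers_induct[where e = undefined
        and p = "disjs (map (\<lambda>k. is_int_cong n (int k) 0) [0..<n])"])
    case zero
    show ?case using cong_base[of n 0] reduce by simp
  next
    case (step a)
    then show ?case using cong_translate reduce by metis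
  next
    case (definable a)
    then show ?case by (auto simp: sat_disjs sat_is_int_cong)
  qed
  then obtain k where "k < n" "cong n (int k) a" by blast
  then show ?thesis by (intro exI[of _ "int k"]) simp
qed

definition res :: "nat \<Rightarrow> 'a \<Rightarrow> int"
  where "res n a = (THE c. 0 \<le> c \<and> c < int n \<and> cong n c a)"

lemma res:
  assumes "n > 0" "a \<in> integers"
  shows "0 \<le> res n a \<and> res n a < int n \<and> cong n (res n a) a"
proof -
  have "\<exists>!c. 0 \<le> c \<and> c < int n \<and> cong n c a"
    using cong_ex[OF assms] cong_unique[OF assms(1)] by (metis mod_pos_pos_trivial)
  from theI'[OF this] show ?thesis by (simp add: res_def)
qed

lemma cong_iff_res:
  assumes "n > 0" "a \<in> integers"
  shows "cong n c a \<longleftrightarrow> res n a = c mod int n"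
  using res[OF assms] cong_unique[of n c a "res n a"] cong_mod[of n c a] by auto

lemma cong_dvd:
  assumes "n dvd l" "cong l c a"
  shows "cong n c a"
proof -
  obtain k where l: "int l = int n * k" using assms(1) by (metis dvdE of_nat_mult)
  from assms(2) have "cong n c a \<and> a \<in> integers"
  proof (induction rule: cong_induct[where e = undefined and p = "is_int_cong n c 0"])
    case (up x)
    then show ?case using cong_multiple[of n c x k] by (simp add: l)
  next
    case (down x)
    then show ?case using cong_multiple[of n c x "- k"] by (simp add: l)
  qed (simp_all add: cong_base sat_is_int_cong)
  then show ?thesis ..
qed

sublocale integer_model integers add zero res
proof
  fix n l :: nat and a b c
  show "n > 0 \<Longrightarrow> res n zero = 0"
    using cong_iff_res[of n zero 0] cong_base[of n 0] by simp
  show "n > 0 \<Longrightarrow> a \<in> integers \<Longrightarrow> res n (add c a) = (res n a + c) mod int n"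
    using cong_translate[of n "res n a" a c] res[of n a] cong_iff_res[of n "add c a" "res n a + c"]
    by simp
  show "n > 0 \<Longrightarrow> n dvd l \<Longrightarrow> l > 0 \<Longrightarrow> a \<in> integers \<Longrightarrow> res n a = res l a mod int n"
    using cong_dvd[of n l "res l a" a] res[of l a] cong_iff_res[of n a "res l a"] by simp
qed (use res in \<open>auto simp: add.commute\<close>)

end

section \<open>The standard lattice in coordinates\<close>

definition coords :: "nat \<Rightarrow> (nat \<Rightarrow> int) \<Rightarrow> int list"
  where "coords k v = map v [0..<k]"

lemma carrier_lattice: "carrier (lattice_group k) = PiE {..<k} (\<lambda>_. UNIV)"
  by (simp add: lattice_group_def)

lemma mult_lattice: "v \<otimes>\<^bsub>lattice_group k\<^esub> w = (\<lambda>i\<in>{..<k}. v i + w i)"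
  by (simp add: lattice_group_def)

lemma one_lattice: "\<one>\<^bsub>lattice_group k\<^esub> = (\<lambda>i\<in>{..<k}. 0)"
  by (simp add: lattice_group_def)

lemma lattice_comm_group: "comm_group (lattice_group k)"
proof -
  have "group (lattice_group k)" by (simp add: lattice_group_def)
  then show ?thesis by (rule group.group_comm_groupI) (simp add: mult_lattice add.commute)
qed

lemma lattice_eqI:
  assumes "v \<in> carrier (lattice_group k)" "w \<in> carrier (lattice_group k)" "\<And>i. i < k \<Longrightarrow> v i = w i"
  shows "v = w"
  using assms unfolding carrier_lattice by (intro PiE_ext[of v "{..<k}" _ w]) auto

lemma pow_lattice: "i < k \<Longrightarrow> (v [^]\<^bsub>lattice_group k\<^esub> (n::nat)) i = int n * v i"
  by (induction n) (simp_all add: nat_pow_def one_lattice mult_lattice algebra_simps)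

lemma length_coords [simp]: "length (coords k v) = k"
  by (simp add: coords_def)

lemma coords_eq_iff: "coords k v = coords k w \<longleftrightarrow> (\<forall>i<k. v i = w i)"
  by (auto simp: coords_def)

lemma map_coords_eq_iff: "map f (coords k v) = map f (coords k w) \<longleftrightarrow> (\<forall>i<k. f (v i) = f (w i))"
  by (auto simp: coords_def)

lemma inj_coords: "inj_on (coords k) (carrier (lattice_group k))"
  by (intro inj_onI lattice_eqI) (auto simp: coords_eq_iff)

lemma coords_surj:
  assumes "length l = k"
  obtains v where "v \<in> carrier (lattice_group k)" "coords k v = l"
proof
  show "(\<lambda>i\<in>{..<k}. l ! i) \<in> carrier (lattice_group k)" by (simp add: carrier_lattice)
  show "coords k (\<lambda>i\<in>{..<k}. l ! i) = l"
    using assms by (intro nth_equalityI) (auto simp: coords_def)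
qed

lemma coords_mem_iff:
  "A \<subseteq> carrier (lattice_group k) \<Longrightarrow> v \<in> carrier (lattice_group k) \<Longrightarrow>
    coords k v \<in> coords k ` A \<longleftrightarrow> v \<in> A"
  using inj_on_image_mem_iff[OF inj_coords] by blast

section \<open>Periodic sets and their periods\<close>

text \<open>The right-hand side is the condition minimised in \<open>least_period\<close>.\<close>

lemma periodic_coords_iff:
  assumes "A \<subseteq> carrier (lattice_group k)"
  shows "periodic_list k n (coords k ` A) \<longleftrightarrow>
    (\<forall>v\<in>carrier (lattice_group k). \<forall>w\<in>carrier (lattice_group k).
       (\<forall>i<k. v i mod int n = w i mod int n) \<longrightarrow> v \<in> A \<longrightarrow> w \<in> A)" (is "_ \<longleftrightarrow> ?r")
proof
  assume per: "periodic_list k n (coords k ` A)"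
  show ?r
  proof (intro ballI impI)
    fix v w assume vw: "v \<in> carrier (lattice_group k)" "w \<in> carrier (lattice_group k)"
      and eq: "\<forall>i<k. v i mod int n = w i mod int n" and "v \<in> A"
    have "map (\<lambda>a. a mod int n) (coords k v) = map (\<lambda>a. a mod int n) (coords k w)"
      using eq by (simp add: map_coords_eq_iff)
    from periodic_list_iff[OF per this] \<open>v \<in> A\<close> show "w \<in> A"
      using coords_mem_iff[OF assms] vw by simp
  qed
next
  assume r: ?r
  show "periodic_list k n (coords k ` A)" unfolding periodic_list_def
  proof (intro conjI allI impI)
    show "coords k ` A \<subseteq> {v. length v = k}" by auto
  next
    fix x y assume eq: "map (\<lambda>a. a mod int n) x = map (\<lambda>a. a mod int n) y" and "x \<in> coords k ` A"
    then obtain v where v: "v \<in> A" "x = coords k v" by blast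
    have "length y = k" using map_eq_imp_length_eq[OF eq] v by simp
    then obtain w where w: "w \<in> carrier (lattice_group k)" "coords k w = y" by (rule coords_surj)
    have "\<forall>i<k. v i mod int n = w i mod int n"
      using eq unfolding v(2) w(2)[symmetric] map_coords_eq_iff .
    moreover have "v \<in> carrier (lattice_group k)" using v(1) assms by blast
    ultimately have "w \<in> A" using bspec[OF bspec[OF r] w(1)] v(1) by blast
    with w show "y \<in> coords k ` A" by blast
  qed
qed

text \<open>The order n of the finite quotient by H annihilates it, so H contains all multiples of
  n. Vectors congruent modulo n therefore lie in the same coset of H.\<close>

lemma periodic_set_imp:
  assumes "periodic_set (lattice_group k) A"
  shows "A \<subseteq> carrier (lattice_group k) \<and> (\<exists>n>0. periodic_list k n (coords k ` A))"
proof -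
  let ?G = "lattice_group k"
  interpret comm_group ?G by (rule lattice_comm_group)
  obtain H C where H: "subgroup H ?G" "finite (rcosets\<^bsub>?G\<^esub> H)" and C: "C \<subseteq> rcosets\<^bsub>?G\<^esub> H" "A = \<Union>C"
    using assms unfolding periodic_set_def by blast
  have A: "A \<subseteq> carrier ?G"
    using C rcosets_part_G[OF H(1)] by blast
  interpret normal H ?G using subgroup_imp_normal[OF H(1)] .
  interpret Q: comm_group "?G Mod H" by (rule abelian_FactGroup[OF H(1)])
  define n where "n = card (carrier (?G Mod H))"
  have fin: "finite (carrier (?G Mod H))" using H(2) by (simp add: FactGroup_def)
  then have "n > 0" using Q.one_closed by (auto simp: n_def card_gt_0_iff)
  have pow: "u [^]\<^bsub>?G\<^esub> n \<in> H" if u: "u \<in> carrier ?G" for u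
  proof -
    have "H #>\<^bsub>?G\<^esub> u \<in> carrier (?G Mod H)" using u by (simp add: FactGroup_def rcosetsI subset)
    from Q.power_order_eq_one[OF fin this] have "(H #>\<^bsub>?G\<^esub> u) [^]\<^bsub>?G Mod H\<^esub> n = H"
      by (simp add: n_def FactGroup_def)
    then have "H #>\<^bsub>?G\<^esub> (u [^]\<^bsub>?G\<^esub> n) = H" using FactGroup_pow u by metis
    then show ?thesis using rcos_self[of "u [^]\<^bsub>?G\<^esub> n" H] u H(1) by simp
  qed
  have "w \<in> A" if vw: "v \<in> carrier ?G" "w \<in> carrier ?G"
    and eq: "\<forall>i<k. v i mod int n = w i mod int n" and "v \<in> A" for v w
  proof -
    define u where "u = (\<lambda>i\<in>{..<k}. (w i - v i) div int n)"
    have u: "u \<in> carrier ?G" by (simp add: u_def carrier_lattice)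
    have "w = u [^]\<^bsub>?G\<^esub> n \<otimes>\<^bsub>?G\<^esub> v"
    proof (rule lattice_eqI)
      show "u [^]\<^bsub>?G\<^esub> n \<otimes>\<^bsub>?G\<^esub> v \<in> carrier ?G" using u vw by simp
      fix i assume i: "i < k"
      then have "int n dvd w i - v i" using eq by (metis mod_eq_dvd_iff)
      then show "w i = (u [^]\<^bsub>?G\<^esub> n \<otimes>\<^bsub>?G\<^esub> v) i" using i by (simp add: mult_lattice pow_lattice u_def)
    qed (rule vw)
    moreover obtain c where c: "c \<in> C" "v \<in> c" using \<open>v \<in> A\<close> C by blast
    moreover obtain x where x: "x \<in> carrier ?G" "c = H #>\<^bsub>?G\<^esub> x"
      using c C(1) unfolding RCOSETS_def by blast
    moreover have "c = H #>\<^bsub>?G\<^esub> v" using repr_independence[OF _ x(1) H(1)] c x by blast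
    ultimately have "w \<in> c" using pow[OF u] unfolding r_coset_def by blast
    then show ?thesis using c C by blast
  qed
  then have "periodic_list k n (coords k ` A)" unfolding periodic_coords_iff[OF A] by blast
  then show ?thesis using A \<open>n > 0\<close> by blast
qed

text \<open>The subgroup is that of the multiples of n. Its index is finite because every coset has
  a representative with entries in 0, ..., n - 1.\<close>

lemma periodic_set_if:
  assumes A: "A \<subseteq> carrier (lattice_group k)" and "n > 0" and per: "periodic_list k n (coords k ` A)"
  shows "periodic_set (lattice_group k) A"
proof -
  let ?G = "lattice_group k"
  interpret comm_group ?G by (rule lattice_comm_group)
  define H where "H = {v \<in> carrier ?G. \<forall>i<k. int n dvd v i}"
  have inv: "(inv\<^bsub>?G\<^esub> v) i = - v i" if "v \<in> carrier ?G" "i < k" for v i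
  proof -
    have "(v \<otimes>\<^bsub>?G\<^esub> inv\<^bsub>?G\<^esub> v) i = 0" using r_inv[OF that(1)] that(2) by (simp add: one_lattice)
    then show ?thesis using that(2) by (simp add: mult_lattice)
  qed
  have H: "subgroup H ?G"
  proof
    show "H \<subseteq> carrier ?G" by (auto simp: H_def)
    show "x \<otimes>\<^bsub>?G\<^esub> y \<in> H" if "x \<in> H" "y \<in> H" for x y
      using that m_closed[of x y] by (auto simp: H_def mult_lattice)
    show "\<one>\<^bsub>?G\<^esub> \<in> H" using one_closed by (auto simp: H_def one_lattice)
    show "inv\<^bsub>?G\<^esub> x \<in> H" if "x \<in> H" for x
      using that inv_closed[of x] inv[of x] by (auto simp: H_def)
  qed
  have mem: "w \<in> H #>\<^bsub>?G\<^esub> v \<longleftrightarrow> w \<in> carrier ?G \<and> (\<forall>i<k. v i mod int n = w i mod int n)"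
    if v: "v \<in> carrier ?G" for v w
  proof
    assume "w \<in> H #>\<^bsub>?G\<^esub> v"
    then obtain h where h: "h \<in> H" "w = h \<otimes>\<^bsub>?G\<^esub> v" unfolding r_coset_def by blast
    then have "w \<in> carrier ?G" using v H subgroup.mem_carrier[OF H] by simp
    moreover have "v i mod int n = w i mod int n" if "i < k" for i
      using h that by (auto simp: mult_lattice H_def elim!: dvdE)
    ultimately show "w \<in> carrier ?G \<and> (\<forall>i<k. v i mod int n = w i mod int n)" by blast
  next
    assume w: "w \<in> carrier ?G \<and> (\<forall>i<k. v i mod int n = w i mod int n)"
    define h where "h = (\<lambda>i\<in>{..<k}. w i - v i)"
    have "h \<in> H" using w by (auto simp: H_def h_def carrier_lattice) (metis mod_eq_dvd_iff)
    moreover have "w = h \<otimes>\<^bsub>?G\<^esub> v"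
      using w v m_closed[OF subgroup.mem_carrier[OF H \<open>h \<in> H\<close>] v]
      by (intro lattice_eqI) (auto simp: mult_lattice h_def)
    ultimately show "w \<in> H #>\<^bsub>?G\<^esub> v" unfolding r_coset_def by blast
  qed
  have "rcosets\<^bsub>?G\<^esub> H \<subseteq> (\<lambda>v. H #>\<^bsub>?G\<^esub> v) ` PiE {..<k} (\<lambda>_. {0..<int n})"
  proof
    fix c assume "c \<in> rcosets\<^bsub>?G\<^esub> H"
    then obtain v where v: "v \<in> carrier ?G" "c = H #>\<^bsub>?G\<^esub> v" unfolding RCOSETS_def by blast
    define w where "w = (\<lambda>i\<in>{..<k}. v i mod int n)"
    have w: "w \<in> PiE {..<k} (\<lambda>_. {0..<int n})" using \<open>n > 0\<close> by (simp add: w_def)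
    then have w': "w \<in> carrier ?G" unfolding carrier_lattice by (auto simp: PiE_iff)
    have "c = H #>\<^bsub>?G\<^esub> w" unfolding v(2) using mem[OF v(1)] mem[OF w'] by (auto simp: w_def)
    with w show "c \<in> (\<lambda>v. H #>\<^bsub>?G\<^esub> v) ` PiE {..<k} (\<lambda>_. {0..<int n})" by blast
  qed
  then have "finite (rcosets\<^bsub>?G\<^esub> H)" by (rule finite_subset) (intro finite_imageI finite_PiE, auto)
  moreover have "A = \<Union>((\<lambda>v. H #>\<^bsub>?G\<^esub> v) ` A)"
  proof
    show "A \<subseteq> \<Union>((\<lambda>v. H #>\<^bsub>?G\<^esub> v) ` A)" using mem A by blast
    show "\<Union>((\<lambda>v. H #>\<^bsub>?G\<^esub> v) ` A) \<subseteq> A"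
    proof
      fix w assume "w \<in> \<Union>((\<lambda>v. H #>\<^bsub>?G\<^esub> v) ` A)"
      then obtain v where "v \<in> A" "w \<in> H #>\<^bsub>?G\<^esub> v" by blast
      moreover from this have "v \<in> carrier ?G" using A by blast
      ultimately show "w \<in> A" using mem[of v w] per unfolding periodic_coords_iff[OF A] by simp
    qed
  qed
  moreover have "(\<lambda>v. H #>\<^bsub>?G\<^esub> v) ` A \<subseteq> rcosets\<^bsub>?G\<^esub> H" using A unfolding RCOSETS_def by blast
  ultimately show ?thesis using H unfolding periodic_set_def by blast
qed

lemma periodic_set_iff:
  "periodic_set (lattice_group k) A \<longleftrightarrow>
    A \<subseteq> carrier (lattice_group k) \<and> (\<exists>n>0. periodic_list k n (coords k ` A))"
  using periodic_set_imp periodic_set_if by blast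

lemma least_period:
  assumes "periodic_set (lattice_group k) A"
  shows "least_period k A > 0 \<and> periodic_list k (least_period k A) (coords k ` A)"
proof -
  have A: "A \<subseteq> carrier (lattice_group k)" using assms by (simp add: periodic_set_iff)
  have "least_period k A = (LEAST n. n > 0 \<and> periodic_list k n (coords k ` A))"
    unfolding least_period_def periodic_coords_iff[OF A] ..
  then show ?thesis using periodic_set_imp[OF assms] by (metis (mono_tags, lifting) LeastI_ex)
qed

lemma set_vec_list: "finite A \<Longrightarrow> set (vec_list k A) = coords k ` A"
  by (simp add: vec_list_def coords_def[abs_def])

lemma finite_coset_representatives:
  assumes "A \<subseteq> carrier (lattice_group k)"
  shows "finite (coset_representatives k A)"
proof (rule finite_subset)
  show "coset_representatives k A \<subseteq> PiE {..<k} (\<lambda>_. {0..<int (least_period k A)})"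
    using assms unfolding coset_representatives_def carrier_lattice by (auto simp: PiE_iff)
qed (intro finite_PiE, auto)

lemma coords_coset_representatives:
  "l \<in> coords k ` coset_representatives k A \<longleftrightarrow>
    l \<in> coords k ` A \<and> (\<forall>a\<in>set l. 0 \<le> a \<and> a < int (least_period k A))"
  by (auto simp: coset_representatives_def coords_def)

section \<open>Coordinates of the stacked tiles and of the stacked right-hand side\<close>

lemma coords_times_lattice:
  "coords (Suc d) ` times_lattice d A B = {v @ [c] | v c. v \<in> coords d ` A \<and> c \<in> B}"
proof -
  have "coords (Suc d) (v(d := c)) = coords d v @ [c]" for v c by (auto simp: coords_def)
  then show ?thesis unfolding times_lattice_def by (auto simp: image_iff) metis
qed

lemma coords_stacked_tile:
  "coords (Suc d) ` stacked_tile d M F j = stacked_tiles M (\<lambda>m j. coords d ` F m j) j"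
  unfolding stacked_tile_def stacked_tiles_def image_UN coords_times_lattice by blast

lemma coords_stacked_set:
  assumes "N > M"
  shows "coords (Suc d) ` stacked_set d M N E = stacked_lists M N (\<lambda>m. coords d ` E m)"
proof -
  have "{int N * q + int m | q. True} = {c. c mod int N = int m}" if "m \<in> {1..M}" for m
  proof (intro equalityI subsetI CollectI)
    fix c assume "c \<in> {c. c mod int N = int m}"
    then have "c = int N * (c div int N) + int m" using mult_div_mod_eq[of "int N" c] by simp
    then show "\<exists>q. c = int N * q + int m \<and> True" by blast
  qed (use that assms in auto)
  then have "coords (Suc d) ` stacked_set d M N E =
      (\<Union>m\<in>{1..M}. {v @ [c] | v c. v \<in> coords d ` E m \<and> c \<in> {c. c mod int N = int m}})"
    unfolding stacked_set_def image_UN coords_times_lattice by (intro SUP_cong refl) (simp only:)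
  then show ?thesis unfolding stacked_lists_def by auto
qed

lemma times_lattice_carrier:
  "A \<subseteq> carrier (lattice_group d) \<Longrightarrow> times_lattice d A B \<subseteq> carrier (lattice_group (Suc d))"
proof
  fix w assume A: "A \<subseteq> carrier (lattice_group d)" and "w \<in> times_lattice d A B"
  then obtain v c where "v \<in> A" "w = v(d := c)" unfolding times_lattice_def by blast
  moreover from this have "v i = undefined" if "i \<ge> d" for i
    using A that unfolding carrier_lattice by (intro PiE_arb[of v "{..<d}"]) auto
  ultimately show "w \<in> carrier (lattice_group (Suc d))"
    unfolding carrier_lattice by (auto simp: PiE_iff extensional_def)
qed

lemma finite_times_lattice:
  assumes "finite A" "finite B"
  shows "finite (times_lattice d A B)"
proof -
  have "times_lattice d A B = (\<lambda>(v, n). v(d := n)) ` (A \<times> B)"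
    by (auto simp: times_lattice_def)
  with assms show ?thesis by simp
qed

subsection \<open>Tilings of the standard lattice\<close>

interpretation std: integer_model UNIV "(+)" "0 :: int" "\<lambda>n a. a mod int n"
  by unfold_locales (simp_all add: mod_mod_cancel mod_simps add.commute add.left_commute)

lemma std_ext: "n > 0 \<Longrightarrow> periodic_list k n E \<Longrightarrow> std.ext k E y \<longleftrightarrow> y \<in> E"
  using std.ext_iff[of n k E y] periodic_list_iff[of k n E "map (\<lambda>a. a mod int n) y" y] by simp

lemma coords_mult: "coords k (v \<otimes>\<^bsub>lattice_group k\<^esub> f) = std.vec_add (coords k f) (coords k v)"
  unfolding std.vec_add_def by (rule nth_equalityI) (simp_all add: coords_def mult_lattice)

text \<open>\<open>distinct_sums\<close> is the meeting point: in the group it amounts to directness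
  and disjointness together, and the injectivity of \<open>coords\<close> carries it over to
  lists.\<close>

lemma solves_tile_iff:
  assumes F: "\<And>j. j \<in> {1..J} \<Longrightarrow> F j \<subseteq> carrier (lattice_group k)"
    and E: "E \<subseteq> carrier (lattice_group k)"
    and X: "\<And>j. j \<in> {1..J} \<Longrightarrow> X j \<subseteq> carrier (lattice_group k)"
  shows "solves_tile (lattice_group k) J F E X \<longleftrightarrow>
    std.tiling k J (\<lambda>j. coords k ` F j) (\<lambda>y. y \<in> coords k ` E) (\<lambda>j. coords k ` X j)"
proof -
  let ?G = "lattice_group k"
  interpret comm_group ?G by (rule lattice_comm_group)
  have coords_sum: "std.vec_add (coords k f) (coords k x) = coords k v \<longleftrightarrow> x \<otimes>\<^bsub>?G\<^esub> f = v"
    if "x \<in> carrier ?G" "f \<in> carrier ?G" "v \<in> carrier ?G" for x f v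
    using inj_onD[OF inj_coords, of k "x \<otimes>\<^bsub>?G\<^esub> f" v] that
    unfolding coords_mult[symmetric] by auto
  define distinct_sums where "distinct_sums \<longleftrightarrow>
    (\<forall>i\<in>{1..J}. \<forall>j\<in>{1..J}. \<forall>f\<in>F i. \<forall>g\<in>F j. \<forall>x\<in>X i. \<forall>y\<in>X j.
      x \<otimes>\<^bsub>?G\<^esub> f = y \<otimes>\<^bsub>?G\<^esub> g \<longrightarrow> i = j \<and> f = g)"
  have direct: "(\<forall>j\<in>{1..J}. direct_sum_defined ?G (X j) (F j)) \<and>
      disjoint_family_on (\<lambda>j. X j <#>\<^bsub>?G\<^esub> F j) {1..J} \<longleftrightarrow> distinct_sums" (is "?l \<longleftrightarrow> _")
  proof
    assume l: ?l
    show distinct_sums unfolding distinct_sums_def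
    proof (intro ballI impI)
      fix i j f g x y assume *: "i \<in> {1..J}" "j \<in> {1..J}" "f \<in> F i" "g \<in> F j" "x \<in> X i" "y \<in> X j"
        "x \<otimes>\<^bsub>?G\<^esub> f = y \<otimes>\<^bsub>?G\<^esub> g"
      have "i = j"
      proof (rule ccontr)
        assume "i \<noteq> j"
        with l * have "(X i <#>\<^bsub>?G\<^esub> F i) \<inter> (X j <#>\<^bsub>?G\<^esub> F j) = {}"
          unfolding disjoint_family_on_def by blast
        moreover have "x \<otimes>\<^bsub>?G\<^esub> f \<in> (X i <#>\<^bsub>?G\<^esub> F i) \<inter> (X j <#>\<^bsub>?G\<^esub> F j)"
          using * unfolding set_mult_def by blast
        ultimately show False by blast
      qed
      moreover from this have "(x, f) = (y, g)"
        using l * unfolding direct_sum_defined_def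
        by (intro inj_onD[of "\<lambda>(a, f). a \<otimes>\<^bsub>?G\<^esub> f" "X i \<times> F i"]) auto
      ultimately show "i = j \<and> f = g" by simp
    qed
  next
    assume r: distinct_sums
    show ?l
    proof
      show "\<forall>j\<in>{1..J}. direct_sum_defined ?G (X j) (F j)" unfolding direct_sum_defined_def
      proof (intro ballI inj_onI, clarify)
        fix j x f y g assume *: "j \<in> {1..J}" "x \<in> X j" "f \<in> F j" "y \<in> X j" "g \<in> F j"
          "x \<otimes>\<^bsub>?G\<^esub> f = y \<otimes>\<^bsub>?G\<^esub> g"
        then have "f = g" using r unfolding distinct_sums_def by blast
        moreover have "f \<in> carrier ?G" "x \<in> carrier ?G" "y \<in> carrier ?G" using * F X by blast+
        ultimately have "x = y" using *(6) by simp
        with \<open>f = g\<close> show "x = y \<and> f = g" by blast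
      qed
      show "disjoint_family_on (\<lambda>j. X j <#>\<^bsub>?G\<^esub> F j) {1..J}"
        using r unfolding distinct_sums_def disjoint_family_on_def set_mult_def by blast
    qed
  qed
  have distinct: "distinct_sums \<longleftrightarrow> (\<forall>i\<in>{1..J}. \<forall>j\<in>{1..J}. \<forall>f\<in>coords k ` F i. \<forall>g\<in>coords k ` F j.
      \<forall>x\<in>coords k ` X i. \<forall>y\<in>coords k ` X j.
      std.vec_add f x = std.vec_add g y \<longrightarrow> i = j \<and> f = g)"
  proof -
    have iff: "(std.vec_add (coords k f) (coords k x) = std.vec_add (coords k g) (coords k y)
        \<longrightarrow> i = j \<and> coords k f = coords k g) \<longleftrightarrow>
      (x \<otimes>\<^bsub>?G\<^esub> f = y \<otimes>\<^bsub>?G\<^esub> g \<longrightarrow> i = j \<and> f = g)"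
      if *: "i \<in> {1..J}" "j \<in> {1..J}" "f \<in> F i" "g \<in> F j" "x \<in> X i" "y \<in> X j" for i j f g x y
    proof -
      have c: "f \<in> carrier ?G" "g \<in> carrier ?G" "x \<in> carrier ?G" "y \<in> carrier ?G"
        using * F X by blast+
      then show ?thesis
        using coords_sum[of x f "y \<otimes>\<^bsub>?G\<^esub> g"] inj_onD[OF inj_coords, of k f g]
        unfolding coords_mult[of k y g, symmetric] by auto
    qed
    show ?thesis unfolding distinct_sums_def ball_simps(9)
      by (intro ball_cong[OF refl], rule iff[symmetric])
  qed
  have union: "(\<Union>j\<in>{1..J}. X j <#>\<^bsub>?G\<^esub> F j) = E \<longleftrightarrow>
    (\<forall>y. std.vec k y \<longrightarrow> ((\<exists>j\<in>{1..J}. \<exists>f\<in>coords k ` F j. \<exists>x\<in>coords k ` X j. y = std.vec_add f x)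
      \<longleftrightarrow> y \<in> coords k ` E))"
  proof -
    have sub: "(\<Union>j\<in>{1..J}. X j <#>\<^bsub>?G\<^esub> F j) \<subseteq> carrier ?G"
      by (intro UN_least set_mult_closed X F)
    have mem: "(\<exists>j\<in>{1..J}. \<exists>f\<in>coords k ` F j. \<exists>x\<in>coords k ` X j. coords k v = std.vec_add f x)
        \<longleftrightarrow> v \<in> (\<Union>j\<in>{1..J}. X j <#>\<^bsub>?G\<^esub> F j)" if v: "v \<in> carrier ?G" for v
    proof -
      have "coords k v = std.vec_add (coords k f) (coords k x) \<longleftrightarrow> v = x \<otimes>\<^bsub>?G\<^esub> f"
        if "j \<in> {1..J}" "f \<in> F j" "x \<in> X j" for j f x
      proof -
        have "f \<in> carrier ?G" "x \<in> carrier ?G" using that F X by blast+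
        from coords_sum[OF this(2,1) v] show ?thesis by (auto simp: eq_commute)
      qed
      then have "(\<exists>j\<in>{1..J}. \<exists>f\<in>F j. \<exists>x\<in>X j. coords k v = std.vec_add (coords k f) (coords k x))
          \<longleftrightarrow> (\<exists>j\<in>{1..J}. \<exists>f\<in>F j. \<exists>x\<in>X j. v = x \<otimes>\<^bsub>?G\<^esub> f)"
        by (intro bex_cong refl)
      then show ?thesis unfolding set_mult_def bex_simps(7) by blast
    qed
    have "(\<Union>j\<in>{1..J}. X j <#>\<^bsub>?G\<^esub> F j) = E \<longleftrightarrow>
        (\<forall>v\<in>carrier ?G. v \<in> (\<Union>j\<in>{1..J}. X j <#>\<^bsub>?G\<^esub> F j) \<longleftrightarrow> v \<in> E)"
      using sub E by blast
    also have "\<dots> \<longleftrightarrow> (\<forall>v\<in>carrier ?G.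
      (\<exists>j\<in>{1..J}. \<exists>f\<in>coords k ` F j. \<exists>x\<in>coords k ` X j. coords k v = std.vec_add f x) \<longleftrightarrow>
      coords k v \<in> coords k ` E)"
      using mem coords_mem_iff[OF E] by (intro ball_cong refl) (simp only:)
    also have "\<dots> \<longleftrightarrow> (\<forall>y. std.vec k y \<longrightarrow>
      ((\<exists>j\<in>{1..J}. \<exists>f\<in>coords k ` F j. \<exists>x\<in>coords k ` X j. y = std.vec_add f x)
      \<longleftrightarrow> y \<in> coords k ` E))"
      (is "(\<forall>v\<in>carrier ?G. ?P (coords k v)) \<longleftrightarrow> (\<forall>y. std.vec k y \<longrightarrow> ?P y)")
    proof
      assume l: "\<forall>v\<in>carrier ?G. ?P (coords k v)"
      show "\<forall>y. std.vec k y \<longrightarrow> ?P y"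
      proof (intro allI impI)
        fix y assume "std.vec k y"
        then have "length y = k" by (simp add: std.vec_def)
        then obtain v where v: "v \<in> carrier ?G" "coords k v = y" by (rule coords_surj)
        from bspec[OF l v(1)] show "?P y" unfolding v(2) .
      qed
    next
      assume r: "\<forall>y. std.vec k y \<longrightarrow> ?P y"
      show "\<forall>v\<in>carrier ?G. ?P (coords k v)"
      proof
        fix v
        have "std.vec k (coords k v)" by (simp add: std.vec_def)
        from mp[OF spec[OF r] this] show "?P (coords k v)" .
      qed
    qed
    finally show ?thesis .
  qed
  have vec: "\<forall>j\<in>{1..J}. X j \<subseteq> carrier ?G" "\<forall>j\<in>{1..J}. \<forall>x\<in>coords k ` X j. std.vec k x"
    using X by (auto simp: std.vec_def)
  have "(\<forall>j\<in>{1..J}. direct_sum_defined ?G (X j) (F j)) \<and>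
      disjoint_family_on (\<lambda>j. X j <#>\<^bsub>?G\<^esub> F j) {1..J} \<and> Q \<longleftrightarrow> distinct_sums \<and> Q" for Q
    by (simp only: direct conj_assoc[symmetric])
  then show ?thesis
    unfolding solves_tile_def std.tiling_def vec[THEN eqTrueI] union distinct[symmetric] simp_thms .
qed

text \<open>P carries a condition on the unknowns along, so that the same equivalence serves for
  solutions and for periodic solutions.\<close>

lemma solves_system_iff:
  assumes "M \<ge> 1"
    and F: "\<And>m j. m \<in> {1..M} \<Longrightarrow> j \<in> {1..J} \<Longrightarrow> F m j \<subseteq> carrier (lattice_group k)"
    and E: "\<And>m. m \<in> {1..M} \<Longrightarrow> periodic_set (lattice_group k) (E m)"
  shows "(\<exists>X. solves_system k J M F E X \<and> (\<forall>j\<in>{1..J}. P (coords k ` X j))) \<longleftrightarrow>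
    (\<exists>Y. (\<forall>j\<in>{1..J}. P (Y j)) \<and>
      (\<forall>m\<in>{1..M}. std.tiling k J (\<lambda>j. coords k ` F m j) (std.ext k (coords k ` E m)) Y))"
proof -
  let ?G = "lattice_group k"
  have E': "E m \<subseteq> carrier ?G" if "m \<in> {1..M}" for m
    using E[OF that] by (simp add: periodic_set_iff)
  have ext: "std.ext k (coords k ` E m) = (\<lambda>y. y \<in> coords k ` E m)" if "m \<in> {1..M}" for m
    using E[OF that] by (auto simp: periodic_set_iff std_ext fun_eq_iff)
  have iff: "solves_system k J M F E X \<longleftrightarrow> (\<forall>m\<in>{1..M}.
      std.tiling k J (\<lambda>j. coords k ` F m j) (std.ext k (coords k ` E m)) (\<lambda>j. coords k ` X j))"
    if X: "\<And>j. j \<in> {1..J} \<Longrightarrow> X j \<subseteq> carrier ?G" for X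
    unfolding solves_system_def
  proof (rule ball_cong[OF refl])
    fix m assume m: "m \<in> {1..M}"
    show "solves_tile ?G J (F m) (E m) X \<longleftrightarrow>
      std.tiling k J (\<lambda>j. coords k ` F m j) (std.ext k (coords k ` E m)) (\<lambda>j. coords k ` X j)"
      unfolding ext[OF m] by (rule solves_tile_iff[OF F[OF m] E'[OF m] X])
  qed
  show ?thesis
  proof (intro iffI; elim exE conjE)
    fix X assume X: "solves_system k J M F E X" and P: "\<forall>j\<in>{1..J}. P (coords k ` X j)"
    have "solves_tile ?G J (F 1) (E 1) X" using X \<open>M \<ge> 1\<close> by (simp add: solves_system_def)
    then have "X j \<subseteq> carrier ?G" if "j \<in> {1..J}" for j using that by (simp add: solves_tile_def)
    from iff[of X, OF this] X P show "\<exists>Y. (\<forall>j\<in>{1..J}. P (Y j)) \<and>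
      (\<forall>m\<in>{1..M}. std.tiling k J (\<lambda>j. coords k ` F m j) (std.ext k (coords k ` E m)) Y)"
      by (intro exI[of _ "\<lambda>j. coords k ` X j"]) blast
  next
    fix Y assume P: "\<forall>j\<in>{1..J}. P (Y j)"
      and Y: "\<forall>m\<in>{1..M}. std.tiling k J (\<lambda>j. coords k ` F m j) (std.ext k (coords k ` E m)) Y"
    have "std.tiling k J (\<lambda>j. coords k ` F 1 j) (std.ext k (coords k ` E 1)) Y"
      using Y \<open>M \<ge> 1\<close> by simp
    then have len: "length y = k" if "y \<in> Y j" "j \<in> {1..J}" for y j
      using that unfolding std.tiling_def std.vec_def by blast
    \<comment> \<open>The lists are pulled back to functions. All of them have length k, by the
      equation m = 1, so \<open>coords\<close> maps the preimage onto \<open>Y j\<close>.\<close>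
    define X where "X j = {v \<in> carrier ?G. coords k v \<in> Y j}" for j
    have X: "X j \<subseteq> carrier ?G" for j by (auto simp: X_def)
    have XY: "coords k ` X j = Y j" if j: "j \<in> {1..J}" for j
    proof
      show "Y j \<subseteq> coords k ` X j"
      proof
        fix y assume y: "y \<in> Y j"
        obtain v where "v \<in> carrier ?G" "coords k v = y" using coords_surj[OF len[OF y j]] .
        with y show "y \<in> coords k ` X j" by (auto simp: X_def)
      qed
    qed (auto simp: X_def)
    have "std.tiling k J G Q (\<lambda>j. coords k ` X j) \<longleftrightarrow> std.tiling k J G Q Y" for G Q
      using XY unfolding std.tiling_def by simp
    then show "\<exists>X. solves_system k J M F E X \<and> (\<forall>j\<in>{1..J}. P (coords k ` X j))"
      using iff[of X, OF X] Y P XY by (intro exI[of _ X]) auto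
  qed
qed

context zfc_model begin

subsection \<open>Vectors and the solvability sentence\<close>

definition enc :: "'a list \<Rightarrow> 'a"
  where "enc l = foldr pair l Emp"

lemma enc_simps [simp]: "enc [] = Emp" "enc (a # l) = pair a (enc l)"
  by (simp_all add: enc_def)

lemma enc_inject [simp]: "enc l = enc l' \<longleftrightarrow> l = l'"
proof (induction l arbitrary: l')
  case Nil
  then show ?case by (cases l') auto
next
  case (Cons a l)
  then show ?case by (cases l') auto
qed

lemma vec_0 [simp]: "vec 0 l \<longleftrightarrow> l = []"
  by (auto simp: vec_def)

lemma vec_Suc: "vec (Suc k) l \<longleftrightarrow> (\<exists>a l'. l = a # l' \<and> a \<in> integers \<and> vec k l')"
  by (cases l) (auto simp: vec_def)

lemma vec_add_simps [simp]: "vec_add [] [] = []" "vec_add (c # f) (a # l) = add c a # vec_add f l"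
  by (simp_all add: vec_add_def)

lemma vec_add_inj:
  "length f = k \<Longrightarrow> vec k x \<Longrightarrow> vec k y \<Longrightarrow> vec_add f x = vec_add f y \<Longrightarrow> x = y"
proof (induction f arbitrary: k x y)
  case (Cons c f)
  obtain n where k: "k = Suc n" using Cons.prems(1) by (cases k) auto
  obtain a l b l' where x: "x = a # l" "a \<in> integers" "vec n l" and y: "y = b # l'" "b \<in> integers" "vec n l'"
    using Cons.prems(2,3) unfolding k vec_Suc by blast
  have "add c a = add c b" "vec_add f l = vec_add f l'" using Cons.prems(4) x(1) y(1) by simp_all
  then have "a = b" "l = l'"
    using add_inj[OF x(2) y(2)] Cons.IH[of n l l'] Cons.prems(1) k x(3) y(3) by simp_all
  then show ?case by (simp add: x(1) y(1))
qed auto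

lemma sat_is_vector: "sat mem e (is_vector k x) \<longleftrightarrow> (\<exists>l. vec k l \<and> e x = enc l)"
proof (induction k arbitrary: e x)
  case (Suc k)
  have "sat mem e (is_vector (Suc k) x) \<longleftrightarrow>
      (\<exists>a v. a \<in> integers \<and> (\<exists>l. vec k l \<and> v = enc l) \<and> e x = pair a v)"
    using Suc by simp
  also have "\<dots> \<longleftrightarrow> (\<exists>a l. a \<in> integers \<and> vec k l \<and> e x = enc (a # l))" by auto
  also have "\<dots> \<longleftrightarrow> (\<exists>l. vec (Suc k) l \<and> e x = enc l)" unfolding vec_Suc by blast
  finally show ?case .
qed simp

lemma sat_is_vec_add:
  "vec (length f) l \<Longrightarrow> e x = enc l \<Longrightarrow> sat mem e (is_vec_add f x y) \<longleftrightarrow> e y = enc (vec_add f l)"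
proof (induction f arbitrary: l e x y)
  case (Cons c f)
  then obtain a l' where l: "l = a # l'" "a \<in> integers" "vec (length f) l'" by (auto simp: vec_Suc)
  have "sat mem e (is_vec_add (c # f) x y) \<longleftrightarrow>
    (\<exists>p q r s. pair a (enc l') = pair p q \<and> e y = pair r s \<and>
      sat mem (s ## r ## q ## p ## e) (is_int_add c 3 1) \<and>
      sat mem (s ## r ## q ## p ## e) (is_vec_add f 2 0))"
    using Cons.prems l by (simp add: eval_nat_numeral conj_ac)
  also have "\<dots> \<longleftrightarrow> (\<exists>r s. e y = pair r s \<and>
      sat mem (s ## r ## enc l' ## a ## e) (is_int_add c 3 1) \<and>
      sat mem (s ## r ## enc l' ## a ## e) (is_vec_add f 2 0))"
    by simp
  also have "\<dots> \<longleftrightarrow> (\<exists>r s. e y = pair r s \<and> r = add c a \<and> s = enc (vec_add f l'))"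
    using l(2) Cons.IH[OF l(3)] by (simp add: sat_is_int_add eval_nat_numeral)
  also have "\<dots> \<longleftrightarrow> e y = enc (vec_add (c # f) l)" by (auto simp: l)
  finally show ?case .
qed auto

lemma sat_is_vec_cong:
  assumes "n > 0"
  shows "vec (length r) l \<Longrightarrow> e x = enc l \<Longrightarrow>
    sat mem e (is_vec_cong n r x) \<longleftrightarrow> map (res n) l = map (\<lambda>c. c mod int n) r"
proof (induction r arbitrary: l e x)
  case (Cons c r)
  then obtain a l' where l: "l = a # l'" "a \<in> integers" "vec (length r) l'" by (auto simp: vec_Suc)
  have "sat mem e (is_vec_cong n (c # r) x) \<longleftrightarrow> (\<exists>p q. pair a (enc l') = pair p q \<and>
      cong n c p \<and> sat mem (q ## p ## e) (is_vec_cong n r 0))"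
    using Cons.prems l by (simp add: sat_is_int_cong)
  also have "\<dots> \<longleftrightarrow> cong n c a \<and> sat mem (enc l' ## a ## e) (is_vec_cong n r 0)"
    by simp
  also have "\<dots> \<longleftrightarrow> map (res n) l = map (\<lambda>c. c mod int n) (c # r)"
    using l Cons.IH[OF l(3), of "enc l' ## a ## e" 0] cong_iff_res[OF assms l(2)] by simp
  finally show ?case .
qed auto

text \<open>A representative has entries in 0, ..., n - 1 and thus equals its own residues, so the
  coset formula says that the residues of the vector are the representative. \<open>ext\<close> then
  forgets which period was used.\<close>

lemma sat_in_periodic:
  assumes E: "periodic_set (lattice_group k) E" and l: "vec k l" "e x = enc l"
  shows "sat mem e (in_periodic k E x) \<longleftrightarrow> ext k (coords k ` E) l"
proof -
  define n where "n = least_period k E"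
  have n: "n > 0" "periodic_list k n (coords k ` E)" using least_period[OF E] by (simp_all add: n_def)
  have fin: "finite (coset_representatives k E)"
    using E by (intro finite_coset_representatives) (simp add: periodic_set_iff)
  have "sat mem e (in_periodic k E x) \<longleftrightarrow>
      (\<exists>r\<in>coords k ` coset_representatives k E. sat mem e (is_vec_cong n r x))"
    by (simp add: in_periodic_def sat_disjs set_vec_list[OF fin] n_def)
  also have "\<dots> \<longleftrightarrow> (\<exists>r\<in>coords k ` coset_representatives k E. map (res n) l = r)"
  proof (rule bex_cong[OF refl])
    fix r assume "r \<in> coords k ` coset_representatives k E"
    then have r: "length r = k" "\<forall>a\<in>set r. 0 \<le> a \<and> a < int n"
      using coords_coset_representatives[of r k E] by (auto simp: n_def)
    then have "map (\<lambda>c. c mod int n) r = r" by (intro map_idI) auto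
    with sat_is_vec_cong[OF n(1), of r l e x] l r(1)
    show "sat mem e (is_vec_cong n r x) \<longleftrightarrow> map (res n) l = r" by simp
  qed
  also have "\<dots> \<longleftrightarrow> map (res n) l \<in> coords k ` coset_representatives k E" by blast
  also have "\<dots> \<longleftrightarrow> map (res n) l \<in> coords k ` E"
    unfolding coords_coset_representatives using l(1) res_range[OF n(1)] by (auto simp: vec_def n_def)
  also have "\<dots> \<longleftrightarrow> ext k (coords k ` E) l"
    using ext_iff[OF n, of l] l(1) by (simp add: vec_def)
  finally show ?thesis .
qed

definition codes :: "'a \<Rightarrow> 'a list set \<Rightarrow> bool"
  where "codes s A \<longleftrightarrow> (\<forall>x. x \<epsilon> s \<longleftrightarrow> (\<exists>l\<in>A. x = enc l))"

lemma sat_sums_coincide_only_if: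
  assumes "codes (e (i - 1)) A" "codes (e (j - 1)) B" "\<forall>l\<in>A. vec k l" "\<forall>l\<in>B. vec k l"
    and "length f = k" "length g = k"
  shows "sat mem e (sums_coincide_only_if p i f j g) \<longleftrightarrow>
    (\<forall>x\<in>A. \<forall>y\<in>B. vec_add f x = vec_add g y \<longrightarrow>
      sat mem (enc (vec_add f x) ## enc y ## enc x ## e) p)"
proof -
  have "sat mem e (sums_coincide_only_if p i f j g) \<longleftrightarrow>
    (\<forall>u v w. u \<epsilon> e (i - 1) \<and> v \<epsilon> e (j - 1) \<and> sat mem (w ## v ## u ## e) (is_vec_add f 2 0) \<and>
      sat mem (w ## v ## u ## e) (is_vec_add g 1 0) \<longrightarrow> sat mem (w ## v ## u ## e) p)"
    by (simp add: sums_coincide_only_if_def eval_nat_numeral conj_ac)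
  also have "\<dots> \<longleftrightarrow> (\<forall>x\<in>A. \<forall>y\<in>B. \<forall>w. sat mem (w ## enc y ## enc x ## e) (is_vec_add f 2 0) \<and>
      sat mem (w ## enc y ## enc x ## e) (is_vec_add g 1 0) \<longrightarrow> sat mem (w ## enc y ## enc x ## e) p)"
    using assms(1,2) unfolding codes_def by auto
  also have "\<dots> \<longleftrightarrow> (\<forall>x\<in>A. \<forall>y\<in>B. \<forall>w. w = enc (vec_add f x) \<and> w = enc (vec_add g y) \<longrightarrow>
      sat mem (w ## enc y ## enc x ## e) p)"
  proof (intro ball_cong[OF refl] all_cong1)
    fix x y w assume "x \<in> A" "y \<in> B"
    then have "vec (length f) x" "vec (length g) y" using assms by simp_all
    then show "(sat mem (w ## enc y ## enc x ## e) (is_vec_add f 2 0) \<and>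
        sat mem (w ## enc y ## enc x ## e) (is_vec_add g 1 0) \<longrightarrow>
        sat mem (w ## enc y ## enc x ## e) p) \<longleftrightarrow>
      (w = enc (vec_add f x) \<and> w = enc (vec_add g y) \<longrightarrow> sat mem (w ## enc y ## enc x ## e) p)"
      using sat_is_vec_add[of f x "w ## enc y ## enc x ## e" 2 0]
        sat_is_vec_add[of g y "w ## enc y ## enc x ## e" 1 0] by (simp add: eval_nat_numeral)
  qed
  also have "\<dots> \<longleftrightarrow> (\<forall>x\<in>A. \<forall>y\<in>B. vec_add f x = vec_add g y \<longrightarrow>
      sat mem (enc (vec_add f x) ## enc y ## enc x ## e) p)"
    by simp
  finally show ?thesis .
qed

text \<open>The formula treats equal and different indices of tiles separately, whereas
  \<open>tiling\<close> has one clause. For f = g in the same tile, the conclusion x = y holds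
  automatically, by \<open>vec_add_inj\<close>.\<close>

lemma sat_tile_fm:
  assumes X: "\<And>j. j \<in> {1..J} \<Longrightarrow> codes (e (j - 1)) (X j)" "\<And>j. j \<in> {1..J} \<Longrightarrow> \<forall>l\<in>X j. vec k l"
    and F: "\<And>j. j \<in> {1..J} \<Longrightarrow> finite (F j)"
    and E: "periodic_set (lattice_group k) E"
  shows "sat mem e (tile_fm k J F E) \<longleftrightarrow>
    tiling k J (\<lambda>j. coords k ` F j) (ext k (coords k ` E)) X"
proof -
  define P where "P i f j g \<longleftrightarrow> (\<forall>x\<in>X i. \<forall>y\<in>X j. vec_add f x \<noteq> vec_add g y)" for i f j g
  have vl: "set (vec_list k (F j)) = coords k ` F j" if "j \<in> {1..J}" for j
    using set_vec_list F[OF that] by blast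
  have idx: "set [1..<Suc J] = {1..J}" by auto
  have same: "sat mem e (sums_coincide_only_if (if f = g then 2 \<^bold>= 1 else \<^bold>\<bottom>) j f j g) \<longleftrightarrow> f = g \<or> P j f j g"
    if "j \<in> {1..J}" "length f = k" "length g = k" for j f g
  proof (cases "f = g")
    case True
    have "x = y" if "x \<in> X j" "y \<in> X j" "vec_add g x = vec_add g y" for x y
      using vec_add_inj[of g k x y] X(2)[OF \<open>j \<in> {1..J}\<close>] \<open>length g = k\<close> that by blast
    then show ?thesis
      using True sat_sums_coincide_only_if[of e j "X j" j "X j" k f g "2 \<^bold>= 1"] that X[OF that(1)]
      by (simp add: eval_nat_numeral)
  next
    case False
    then show ?thesis
      using sat_sums_coincide_only_if[of e j "X j" j "X j" k f g "\<^bold>\<bottom>"] that X[OF that(1)]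
      by (simp add: P_def)
  qed
  have diff: "sat mem e (sums_coincide_only_if \<^bold>\<bottom> i f j g) \<longleftrightarrow> P i f j g"
    if "i \<in> {1..J}" "j \<in> {1..J}" "length f = k" "length g = k" for i j f g
    using sat_sums_coincide_only_if[of e i "X i" j "X j" k f g "\<^bold>\<bottom>"] that X[OF that(1)] X[OF that(2)]
    by (simp add: P_def)
  have 1: "sat mem e (conjs [sums_coincide_only_if (if f = g then 2 \<^bold>= 1 else \<^bold>\<bottom>) j f j g.
       j \<leftarrow> [1..<Suc J], f \<leftarrow> vec_list k (F j), g \<leftarrow> vec_list k (F j)]) \<longleftrightarrow>
    (\<forall>j\<in>{1..J}. \<forall>f\<in>coords k ` F j. \<forall>g\<in>coords k ` F j. f = g \<or> P j f j g)"
  proof -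
    have "sat mem e (conjs [sums_coincide_only_if (if f = g then 2 \<^bold>= 1 else \<^bold>\<bottom>) j f j g.
       j \<leftarrow> [1..<Suc J], f \<leftarrow> vec_list k (F j), g \<leftarrow> vec_list k (F j)]) \<longleftrightarrow>
      (\<forall>j\<in>{1..J}. \<forall>f\<in>set (vec_list k (F j)). \<forall>g\<in>set (vec_list k (F j)).
        sat mem e (sums_coincide_only_if (if f = g then 2 \<^bold>= 1 else \<^bold>\<bottom>) j f j g))"
      by (simp only: sat_conjs set_concat set_map image_image idx ball_UN ball_simps(9))
    also have "\<dots> \<longleftrightarrow> (\<forall>j\<in>{1..J}. \<forall>f\<in>coords k ` F j. \<forall>g\<in>coords k ` F j. f = g \<or> P j f j g)"
    proof (intro ball_cong vl)
      fix j f g assume "j \<in> {1..J}" "f \<in> coords k ` F j" "g \<in> coords k ` F j"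
      then show "sat mem e (sums_coincide_only_if (if f = g then 2 \<^bold>= 1 else \<^bold>\<bottom>) j f j g) \<longleftrightarrow>
          f = g \<or> P j f j g"
        by (intro same) auto
    qed simp_all
    finally show ?thesis .
  qed
  have 2: "sat mem e (conjs [sums_coincide_only_if \<^bold>\<bottom> i f j g.
       i \<leftarrow> [1..<Suc J], j \<leftarrow> [1..<Suc J], i \<noteq> j, f \<leftarrow> vec_list k (F i), g \<leftarrow> vec_list k (F j)]) \<longleftrightarrow>
    (\<forall>i\<in>{1..J}. \<forall>j\<in>{1..J}. i \<noteq> j \<longrightarrow> (\<forall>f\<in>coords k ` F i. \<forall>g\<in>coords k ` F j. P i f j g))"
  proof -
    \<comment> \<open>The side condition of the list comprehension unfolds to a conditional with an
      empty alternative.\<close>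
    have guard: "(\<forall>x\<in>set (if b then L else []). Q x) \<longleftrightarrow> (b \<longrightarrow> (\<forall>x\<in>set L. Q x))" for b and L :: "'b list" and Q
      by auto
    have "sat mem e (conjs [sums_coincide_only_if \<^bold>\<bottom> i f j g.
       i \<leftarrow> [1..<Suc J], j \<leftarrow> [1..<Suc J], i \<noteq> j, f \<leftarrow> vec_list k (F i), g \<leftarrow> vec_list k (F j)]) \<longleftrightarrow>
      (\<forall>i\<in>{1..J}. \<forall>j\<in>{1..J}. i \<noteq> j \<longrightarrow> (\<forall>f\<in>set (vec_list k (F i)). \<forall>g\<in>set (vec_list k (F j)).
        sat mem e (sums_coincide_only_if \<^bold>\<bottom> i f j g)))"
      by (simp only: sat_conjs set_concat set_map image_image idx ball_UN ball_simps(9) guard)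
    also have "\<dots> \<longleftrightarrow>
      (\<forall>i\<in>{1..J}. \<forall>j\<in>{1..J}. i \<noteq> j \<longrightarrow> (\<forall>f\<in>coords k ` F i. \<forall>g\<in>coords k ` F j. P i f j g))"
    proof (intro ball_cong imp_cong refl vl)
      fix i j f g assume "i \<in> {1..J}" "j \<in> {1..J}" "f \<in> coords k ` F i" "g \<in> coords k ` F j"
      then show "sat mem e (sums_coincide_only_if \<^bold>\<bottom> i f j g) \<longleftrightarrow> P i f j g"
        by (intro diff) auto
    qed
    finally show ?thesis .
  qed
  have 3: "sat mem e (\<^bold>\<forall> (is_vector k 0 \<^bold>\<longrightarrow>
        (disjs [\<^bold>\<exists> ((0 \<^bold>\<in> (j - 1) + 2) \<^bold>\<and> is_vec_add f 0 1).
           j \<leftarrow> [1..<Suc J], f \<leftarrow> vec_list k (F j)]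
         \<^bold>\<longleftrightarrow> in_periodic k E 0))) \<longleftrightarrow>
    (\<forall>y. vec k y \<longrightarrow> ((\<exists>j\<in>{1..J}. \<exists>f\<in>coords k ` F j. \<exists>x\<in>X j. y = vec_add f x) \<longleftrightarrow>
      ext k (coords k ` E) y))"
  proof -
    have "sat mem (enc y ## e) (disjs [\<^bold>\<exists> ((0 \<^bold>\<in> (j - 1) + 2) \<^bold>\<and> is_vec_add f 0 1).
           j \<leftarrow> [1..<Suc J], f \<leftarrow> vec_list k (F j)]) \<longleftrightarrow>
        (\<exists>j\<in>{1..J}. \<exists>f\<in>coords k ` F j. \<exists>x\<in>X j. y = vec_add f x)" if "vec k y" for y
    proof -
      have "sat mem (enc y ## e) (disjs [\<^bold>\<exists> ((0 \<^bold>\<in> (j - 1) + 2) \<^bold>\<and> is_vec_add f 0 1).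
           j \<leftarrow> [1..<Suc J], f \<leftarrow> vec_list k (F j)]) \<longleftrightarrow>
        (\<exists>j\<in>{1..J}. \<exists>f\<in>set (vec_list k (F j)).
          sat mem (enc y ## e) (\<^bold>\<exists> ((0 \<^bold>\<in> (j - 1) + 2) \<^bold>\<and> is_vec_add f 0 1)))"
        by (simp only: sat_disjs set_concat set_map image_image idx bex_UN bex_simps(7))
      also have "\<dots> \<longleftrightarrow> (\<exists>j\<in>{1..J}. \<exists>f\<in>coords k ` F j. \<exists>x\<in>X j. y = vec_add f x)"
      proof (rule bex_cong[OF refl], rule bex_cong)
        fix j f assume j: "j \<in> {1..J}" and "f \<in> coords k ` F j"
        then have "length f = k" by auto
        then have "sat mem (enc x ## enc y ## e) (is_vec_add f 0 1) \<longleftrightarrow> y = vec_add f x"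
          if "x \<in> X j" for x
          using X(2)[OF j] that sat_is_vec_add[of f x "enc x ## enc y ## e" 0 1] by simp
        then show "sat mem (enc y ## e) (\<^bold>\<exists> ((0 \<^bold>\<in> (j - 1) + 2) \<^bold>\<and> is_vec_add f 0 1)) \<longleftrightarrow>
            (\<exists>x\<in>X j. y = vec_add f x)"
          using X(1)[OF j] by (auto simp: codes_def)
      qed (rule vl)
      finally show ?thesis .
    qed
    moreover have "sat mem (enc y ## e) (in_periodic k E 0) \<longleftrightarrow> ext k (coords k ` E) y" if "vec k y" for y
      using sat_in_periodic[OF E that] by simp
    moreover have "sat mem e (\<^bold>\<forall> (is_vector k 0 \<^bold>\<longrightarrow> (p \<^bold>\<longleftrightarrow> q))) \<longleftrightarrow>
        (\<forall>y. vec k y \<longrightarrow> (sat mem (enc y ## e) p \<longleftrightarrow> sat mem (enc y ## e) q))" for p q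
    proof -
      have "sat mem e (\<^bold>\<forall> (is_vector k 0 \<^bold>\<longrightarrow> (p \<^bold>\<longleftrightarrow> q))) \<longleftrightarrow>
          (\<forall>u. (\<exists>l. vec k l \<and> u = enc l) \<longrightarrow> (sat mem (u ## e) p \<longleftrightarrow> sat mem (u ## e) q))"
        using sat_is_vector[of "u ## e" k 0 for u] by (auto simp: iff_conv_conj_imp)
      then show ?thesis by auto
    qed
    ultimately show ?thesis by (simp only: cong: imp_cong)
  qed
  have coords_distinct: "(\<forall>j\<in>{1..J}. \<forall>f\<in>coords k ` F j. \<forall>g\<in>coords k ` F j. f = g \<or> P j f j g) \<and>
      (\<forall>i\<in>{1..J}. \<forall>j\<in>{1..J}. i \<noteq> j \<longrightarrow> (\<forall>f\<in>coords k ` F i. \<forall>g\<in>coords k ` F j. P i f j g)) \<longleftrightarrow>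
    (\<forall>i\<in>{1..J}. \<forall>j\<in>{1..J}. \<forall>f\<in>coords k ` F i. \<forall>g\<in>coords k ` F j. \<forall>x\<in>X i. \<forall>y\<in>X j.
      vec_add f x = vec_add g y \<longrightarrow> i = j \<and> f = g)" (is "?l \<longleftrightarrow> ?r")
  proof -
    have "?l \<longleftrightarrow> (\<forall>i\<in>{1..J}. \<forall>j\<in>{1..J}. \<forall>f\<in>coords k ` F i. \<forall>g\<in>coords k ` F j.
        i = j \<and> f = g \<or> P i f j g)" (is "_ \<longleftrightarrow> ?m")
    proof
      assume l: ?l
      show ?m
      proof (intro ballI)
        fix i j f g assume "i \<in> {1..J}" "j \<in> {1..J}" "f \<in> coords k ` F i" "g \<in> coords k ` F j"
        with l show "i = j \<and> f = g \<or> P i f j g" by (cases "i = j") blast+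
      qed
    qed blast
    also have "\<dots> \<longleftrightarrow> ?r" unfolding P_def by (intro ball_cong refl) blast
    finally show ?thesis .
  qed
  have vecs: "\<forall>j\<in>{1..J}. \<forall>x\<in>X j. vec k x" using X(2) by blast
  have con: "sat mem e (p \<^bold>\<and> q) \<longleftrightarrow> sat mem e p \<and> sat mem e q" for p q by simp
  show ?thesis
    unfolding tile_fm_def tiling_def con 1 2 3 vecs[THEN eqTrueI] coords_distinct[symmetric]
      simp_thms conj_assoc ..
qed

text \<open>These are the sets of vectors over which the existential quantifiers of the sentence
  range; an external set of lists need not have a code in the model.\<close>

definition internal :: "nat \<Rightarrow> 'a list set \<Rightarrow> bool"
  where "internal k A \<longleftrightarrow> (\<forall>l\<in>A. vec k l) \<and> (\<exists>s. codes s A)"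

lemma sat_solvable_sentence:
  assumes F: "\<And>m j. m \<in> {1..M} \<Longrightarrow> j \<in> {1..J} \<Longrightarrow> finite (F m j)"
    and E: "\<And>m. m \<in> {1..M} \<Longrightarrow> periodic_set (lattice_group k) (E m)"
  shows "sat mem e (solvable_sentence k J M F E) \<longleftrightarrow>
    (\<exists>X. (\<forall>j\<in>{1..J}. internal k (X j)) \<and>
      (\<forall>m\<in>{1..M}. tiling k J (\<lambda>j. coords k ` F m j) (ext k (coords k ` E m)) X))"
proof -
  have body: "sat mem e' (conjs [\<^bold>\<forall> ((0 \<^bold>\<in> (j - 1) + 1) \<^bold>\<longrightarrow> is_vector k 0). j \<leftarrow> [1..<Suc J]] \<^bold>\<and>
       conjs [tile_fm k J (F m) (E m). m \<leftarrow> [1..<Suc M]]) \<longleftrightarrow>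
    (\<forall>j\<in>{1..J}. \<forall>u. u \<epsilon> e' (j - 1) \<longrightarrow> (\<exists>l. vec k l \<and> u = enc l)) \<and>
    (\<forall>m\<in>{1..M}. sat mem e' (tile_fm k J (F m) (E m)))" for e'
  proof -
    have *: "sat mem e' (\<^bold>\<forall> ((0 \<^bold>\<in> (j - 1) + 1) \<^bold>\<longrightarrow> is_vector k 0)) \<longleftrightarrow>
        (\<forall>u. u \<epsilon> e' (j - 1) \<longrightarrow> (\<exists>l. vec k l \<and> u = enc l))" for j
      by (simp add: sat_is_vector)
    have con: "sat mem e' (p \<^bold>\<and> q) \<longleftrightarrow> sat mem e' p \<and> sat mem e' q" for p q by simp
    have idx: "set [1..<Suc n] = {1..n}" for n by auto
    show ?thesis unfolding con sat_conjs set_map ball_simps(9) idx * ..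
  qed
  have tile: "(\<forall>m\<in>{1..M}. sat mem e' (tile_fm k J (F m) (E m))) \<longleftrightarrow>
      (\<forall>m\<in>{1..M}. tiling k J (\<lambda>j. coords k ` F m j) (ext k (coords k ` E m)) X)"
    if "\<And>j. j \<in> {1..J} \<Longrightarrow> codes (e' (j - 1)) (X j)" "\<And>j. j \<in> {1..J} \<Longrightarrow> \<forall>l\<in>X j. vec k l" for e' X
    using that F E by (intro ball_cong refl sat_tile_fm) blast+
  show ?thesis
  proof
    assume "sat mem e (solvable_sentence k J M F E)"
    then obtain e' where e': "\<forall>j\<in>{1..J}. \<forall>u. u \<epsilon> e' (j - 1) \<longrightarrow> (\<exists>l. vec k l \<and> u = enc l)"
      "\<forall>m\<in>{1..M}. sat mem e' (tile_fm k J (F m) (E m))"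
      unfolding solvable_sentence_def sat_Exis body by blast
    define X where "X j = {l. vec k l \<and> enc l \<epsilon> e' (j - 1)}" for j
    have X: "codes (e' (j - 1)) (X j)" if "j \<in> {1..J}" for j
      using e'(1) that unfolding codes_def X_def by blast
    have X': "\<forall>l\<in>X j. vec k l" for j by (simp add: X_def)
    have "\<forall>j\<in>{1..J}. internal k (X j)" using X X' unfolding internal_def by blast
    moreover have "\<forall>m\<in>{1..M}. tiling k J (\<lambda>j. coords k ` F m j) (ext k (coords k ` E m)) X"
      using tile[of e' X, OF X X'] e'(2) by simp
    ultimately show "\<exists>X. (\<forall>j\<in>{1..J}. internal k (X j)) \<and>
      (\<forall>m\<in>{1..M}. tiling k J (\<lambda>j. coords k ` F m j) (ext k (coords k ` E m)) X)" by blast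
  next
    assume "\<exists>X. (\<forall>j\<in>{1..J}. internal k (X j)) \<and>
      (\<forall>m\<in>{1..M}. tiling k J (\<lambda>j. coords k ` F m j) (ext k (coords k ` E m)) X)"
    then obtain X where X: "\<forall>j\<in>{1..J}. internal k (X j)"
      "\<forall>m\<in>{1..M}. tiling k J (\<lambda>j. coords k ` F m j) (ext k (coords k ` E m)) X" by blast
    from X(1) obtain s where s: "\<And>j. j \<in> {1..J} \<Longrightarrow> codes (s j) (X j)"
      unfolding internal_def by metis
    \<comment> \<open>The unknown with number j is variable j - 1, hence the shift by one; the old
      environment continues from J on.\<close>
    define e' where "e' i = (if i < J then s (i + 1) else e (i - J))" for i
    have e': "codes (e' (j - 1)) (X j)" if "j \<in> {1..J}" for j
      using s[OF that] that by (auto simp: e'_def)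
    have vecs: "\<forall>l\<in>X j. vec k l" if "j \<in> {1..J}" for j using X(1) that unfolding internal_def by blast
    have "\<forall>m\<in>{1..M}. sat mem e' (tile_fm k J (F m) (E m))"
      using tile[of e' X, OF e' vecs] X(2) by simp
    moreover have "\<forall>j\<in>{1..J}. \<forall>u. u \<epsilon> e' (j - 1) \<longrightarrow> (\<exists>l. vec k l \<and> u = enc l)"
      using e' vecs unfolding codes_def by blast
    moreover have "\<forall>i. e' (i + J) = e i" by (simp add: e'_def)
    ultimately show "sat mem e (solvable_sentence k J M F E)"
      unfolding solvable_sentence_def sat_Exis body by blast
  qed
qed

section \<open>Definability of lifting and slicing\<close>

text \<open>The ambient set from which lifted and sliced sets are separated.\<close>

lemma vectors_superset: "\<exists>V. \<forall>l. vec k l \<longrightarrow> enc l \<epsilon> V"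
proof (induction k)
  case 0
  have "Emp \<epsilon> suc Emp" by (simp add: mem_suc)
  then show ?case by auto
next
  case (Suc k)
  then obtain V where V: "\<forall>l. vec k l \<longrightarrow> enc l \<epsilon> V" by blast
  obtain W where W: "\<forall>a\<in>integers. a \<epsilon> W" using integers_superset by blast
  obtain U where U: "\<forall>z. z \<epsilon> V \<or> z \<epsilon> W \<longrightarrow> z \<epsilon> U" using binary_union_superset by blast
  obtain B where B: "\<forall>x y. x \<epsilon> U \<longrightarrow> y \<epsilon> U \<longrightarrow> pair x y \<epsilon> B" using pairs_superset by blast
  have "enc l \<epsilon> B" if "vec (Suc k) l" for l
    using that U V W B by (auto simp: vec_Suc)
  then show ?case by blast
qed

text \<open>The height is the innermost coordinate of the nested pairs, so appending it is expressed
  by recursion on the standard length.\<close>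

primrec is_snoc :: "nat \<Rightarrow> nat \<Rightarrow> nat \<Rightarrow> nat \<Rightarrow> fm"
  where "is_snoc 0 v a x = (\<^bold>\<exists> (is_empty 0 \<^bold>\<and> is_pair (Suc a) 0 (Suc x)))"
  | "is_snoc (Suc k) v a x =
      (\<^bold>\<exists> (\<^bold>\<exists> (\<^bold>\<exists> (is_pair 2 1 (v + 3) \<^bold>\<and> is_pair 2 0 (x + 3) \<^bold>\<and> is_snoc k 1 (a + 3) 0))))"

lemma sat_is_snoc:
  "length l = k \<Longrightarrow> e v = enc l \<Longrightarrow> sat mem e (is_snoc k v a x) \<longleftrightarrow> e x = enc (l @ [e a])"
proof (induction k arbitrary: l e v a x)
  case (Suc k)
  then obtain b l' where l: "l = b # l'" "length l' = k" by (cases l) auto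
  have "sat mem e (is_snoc (Suc k) v a x) \<longleftrightarrow>
    (\<exists>p q r. pair b (enc l') = pair p q \<and> e x = pair p r \<and>
      sat mem (r ## q ## p ## e) (is_snoc k 1 (a + 3) 0))"
    using Suc.prems l by (simp add: eval_nat_numeral)
  also have "\<dots> \<longleftrightarrow> (\<exists>r. e x = pair b r \<and> sat mem (r ## enc l' ## b ## e) (is_snoc k 1 (a + 3) 0))"
    by simp
  also have "\<dots> \<longleftrightarrow> e x = enc (l @ [e a])"
    using l Suc.IH[OF l(2)] by (auto simp: eval_nat_numeral)
  finally show ?case .
qed auto

lemma internal_lift_set:
  assumes "N > 0" "internal d A"
  shows "internal (Suc d) (lift_set N A)"
proof -
  obtain s where s: "codes s A" and vec: "\<And>l. l \<in> A \<Longrightarrow> vec d l"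
    using assms unfolding internal_def by blast
  have vecs: "\<forall>l\<in>lift_set N A. vec (Suc d) l" using vec unfolding lift_set_def vec_snoc by blast
  obtain V where V: "\<And>l. vec (Suc d) l \<Longrightarrow> enc l \<epsilon> V" using vectors_superset by blast
  \<comment> \<open>Under the two quantifiers the indices 0, 1, 2, 3 are the height, the vector from
    A, the candidate x and the code s of A.\<close>
  obtain t where t: "\<And>x. x \<epsilon> t \<longleftrightarrow> x \<epsilon> V \<and>
      sat mem (x ## s ## undefined) (\<^bold>\<exists> (\<^bold>\<exists> ((1 \<^bold>\<in> 3) \<^bold>\<and> is_int_cong N 0 0 \<^bold>\<and> is_snoc d 1 0 2)))"
    using separation by blast
  have "x \<epsilon> t \<longleftrightarrow> (\<exists>l\<in>lift_set N A. x = enc l)" for x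
  proof -
    have "sat mem (x ## s ## undefined) (\<^bold>\<exists> (\<^bold>\<exists> ((1 \<^bold>\<in> 3) \<^bold>\<and> is_int_cong N 0 0 \<^bold>\<and> is_snoc d 1 0 2)))
        \<longleftrightarrow> (\<exists>v a. v \<epsilon> s \<and> cong N 0 a \<and> sat mem (a ## v ## x ## s ## undefined) (is_snoc d 1 0 2))"
      by (simp add: sat_is_int_cong eval_nat_numeral)
    also have "\<dots> \<longleftrightarrow> (\<exists>l\<in>A. \<exists>a. cong N 0 a \<and>
        sat mem (a ## enc l ## x ## s ## undefined) (is_snoc d 1 0 2))"
      using s unfolding codes_def by auto
    also have "\<dots> \<longleftrightarrow> (\<exists>l\<in>A. \<exists>a. cong N 0 a \<and> x = enc (l @ [a]))"
    proof (intro bex_cong[OF refl] ex_cong1 conj_cong[OF refl])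
      fix l a assume "l \<in> A"
      then show "sat mem (a ## enc l ## x ## s ## undefined) (is_snoc d 1 0 2) \<longleftrightarrow> x = enc (l @ [a])"
        using sat_is_snoc[of l d "a ## enc l ## x ## s ## undefined" 1 0 2] vec
        by (simp add: vec_def eval_nat_numeral)
    qed
    also have "\<dots> \<longleftrightarrow> (\<exists>l\<in>lift_set N A. x = enc l)"
      using cong_iff_res[OF assms(1), of _ 0] cong_integers[of N 0] unfolding lift_set_def by fastforce
    finally show ?thesis using t V vecs by blast
  qed
  then show ?thesis using vecs unfolding internal_def codes_def by blast
qed

lemma internal_slice_set:
  assumes "internal (Suc d) A"
  shows "internal d (slice_set A)"
proof -
  obtain s where s: "codes s A" and vec: "\<And>l. l \<in> A \<Longrightarrow> vec (Suc d) l"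
    using assms unfolding internal_def by blast
  have vecs: "\<forall>l\<in>slice_set A. vec d l"
  proof
    fix l assume "l \<in> slice_set A"
    then have "vec (Suc d) (l @ [zero])" using vec by (simp add: slice_set_def)
    then show "vec d l" by (simp add: vec_def)
  qed
  obtain V where V: "\<And>l. vec d l \<Longrightarrow> enc l \<epsilon> V" using vectors_superset by blast
  \<comment> \<open>Under the two quantifiers the indices 0, 1, 2, 3 are the height zero, the
    extended vector, the candidate x and the code s of A.\<close>
  obtain t where t: "\<And>x. x \<epsilon> t \<longleftrightarrow> x \<epsilon> V \<and> sat mem (x ## s ## undefined)
      (is_vector d 0 \<^bold>\<and> (\<^bold>\<exists> (\<^bold>\<exists> ((1 \<^bold>\<in> 3) \<^bold>\<and> is_int_const 0 0 \<^bold>\<and> is_snoc d 2 0 1))))"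
    using separation by blast
  have snoc: "sat mem (zero ## y ## enc l ## s ## undefined) (is_snoc d 2 0 1) \<longleftrightarrow> y = enc (l @ [zero])"
    if "vec d l" for l y
    using sat_is_snoc[of l d "zero ## y ## enc l ## s ## undefined" 2 0 1] that
    by (simp add: vec_def eval_nat_numeral)
  have "x \<epsilon> t \<longleftrightarrow> (\<exists>l\<in>slice_set A. x = enc l)" for x
  proof -
    have "sat mem (x ## s ## undefined)
        (is_vector d 0 \<^bold>\<and> (\<^bold>\<exists> (\<^bold>\<exists> ((1 \<^bold>\<in> 3) \<^bold>\<and> is_int_const 0 0 \<^bold>\<and> is_snoc d 2 0 1))))
      \<longleftrightarrow> (\<exists>l. vec d l \<and> x = enc l) \<and>
        (\<exists>y. y \<epsilon> s \<and> sat mem (zero ## y ## x ## s ## undefined) (is_snoc d 2 0 1))"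
      by (simp add: sat_is_vector eval_nat_numeral)
    also have "\<dots> \<longleftrightarrow> (\<exists>l. vec d l \<and> x = enc l \<and> enc (l @ [zero]) \<epsilon> s)"
      using snoc by auto
    also have "\<dots> \<longleftrightarrow> (\<exists>l\<in>slice_set A. x = enc l)"
      using s vecs by (auto simp: slice_set_def codes_def)
    finally show ?thesis using t V vecs by blast
  qed
  then show ?thesis using vecs unfolding internal_def codes_def by blast
qed

end

section \<open>Admissibility of the stacked data and transfer to provability\<close>

lemma finite_stacked_tile:
  assumes "\<And>m. m \<in> {1..M} \<Longrightarrow> finite (F m j)"
  shows "finite (stacked_tile d M F j)"
  unfolding stacked_tile_def using assms by (auto intro: finite_times_lattice)

lemma stacked_tile_carrier:
  assumes "\<And>m. m \<in> {1..M} \<Longrightarrow> F m j \<subseteq> carrier (lattice_group d)"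
  shows "stacked_tile d M F j \<subseteq> carrier (lattice_group (Suc d))"
  unfolding stacked_tile_def by (intro UN_least times_lattice_carrier assms)

lemma periodic_stacked_set:
  assumes "N > M" and E: "\<And>m. m \<in> {1..M} \<Longrightarrow> periodic_set (lattice_group d) (E m)"
  shows "periodic_set (lattice_group (Suc d)) (stacked_set d M N E)"
proof -
  obtain l where l: "l > 0" "N dvd l" "\<And>m. m \<in> {1..M} \<Longrightarrow> periodic_list d l (coords d ` E m)"
    using common_period[of N M "\<lambda>m. least_period d (E m)" d "\<lambda>m. coords d ` E m"]
      least_period[OF E] assms(1) by auto
  then have "periodic_list (Suc d) l (coords (Suc d) ` stacked_set d M N E)"
    unfolding coords_stacked_set[OF assms(1)] by (intro periodic_stacked_lists)
  moreover have "stacked_set d M N E \<subseteq> carrier (lattice_group (Suc d))"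
    unfolding stacked_set_def using E by (intro UN_least times_lattice_carrier) (simp add: periodic_set_iff)
  ultimately show ?thesis using l(1) unfolding periodic_set_iff by blast
qed

text \<open>The factor n controls the first d coordinates and N the height.\<close>

lemma periodic_lift_set:
  assumes "periodic_list d n A" "n > 0" "N > 0"
  shows "periodic_list (Suc d) (n * N) (std.lift_set N A)"
  unfolding periodic_list_def
proof (intro conjI allI impI)
  show "std.lift_set N A \<subseteq> {v. length v = Suc d}"
    using assms(1) unfolding periodic_list_def std.lift_set_def by auto
next
  fix v w assume eq: "map (\<lambda>a. a mod int (n * N)) v = map (\<lambda>a. a mod int (n * N)) w"
    and "v \<in> std.lift_set N A"
  then obtain x a where v: "v = x @ [a]" "x \<in> A" "a mod int N = 0"
    by (auto simp: std.lift_set_def)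
  obtain y b where w: "w = y @ [b]" using map_eq_imp_length_eq[OF eq] v(1)
    by (cases w rule: rev_cases) auto
  have xy: "map (\<lambda>a. a mod int (n * N)) x = map (\<lambda>a. a mod int (n * N)) y"
    and ab: "a mod int (n * N) = b mod int (n * N)"
    using eq unfolding v(1) w by simp_all
  have "y \<in> A"
    using periodic_list_iff[OF periodic_list_dvd[OF assms(1), of "n * N"] xy] v(2) by simp
  moreover have "b mod int N = 0"
    using v(3) ab mod_mod_cancel[of "int N" "int (n * N)" a] mod_mod_cancel[of "int N" "int (n * N)" b]
    by simp
  ultimately show "w \<in> std.lift_set N A" by (simp add: w std.lift_set_def)
qed

lemma periodic_slice_set:
  assumes "periodic_list (Suc d) n A"
  shows "periodic_list d n (std.slice_set A)"
  unfolding periodic_list_def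
proof (intro conjI allI impI)
  show "std.slice_set A \<subseteq> {v. length v = d}"
    using assms unfolding periodic_list_def std.slice_set_def by fastforce
next
  fix v w :: "int list"
  assume "map (\<lambda>a. a mod int n) v = map (\<lambda>a. a mod int n) w" "v \<in> std.slice_set A"
  then show "w \<in> std.slice_set A"
    using periodic_list_iff[OF assms, of "v @ [0]" "w @ [0]"] by (simp add: std.slice_set_def)
qed

text \<open>Soundness carries p from ZFC into each model, and completeness leads from the models on
  \<open>nat\<close> back to a proof of q.\<close>

lemma provable_iff:
  assumes "\<And>mem :: nat \<Rightarrow> nat \<Rightarrow> bool. \<And>e. zfc_model mem \<Longrightarrow> sat mem e p \<longleftrightarrow> sat mem e q"
  shows "(ZFC \<^bold>\<turnstile> p) \<longleftrightarrow> (ZFC \<^bold>\<turnstile> q)"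
proof -
  have "ZFC \<^bold>\<turnstile> q"
    if "ZFC \<^bold>\<turnstile> p" "\<And>mem :: nat \<Rightarrow> nat \<Rightarrow> bool. \<And>e. zfc_model mem \<Longrightarrow> sat mem e p \<Longrightarrow> sat mem e q" for p q
  proof (rule completeness)
    fix mem :: "nat \<Rightarrow> nat \<Rightarrow> bool" and e assume *: "\<And>p e. p \<in> ZFC \<Longrightarrow> sat mem e p"
    have "zfc_model mem" by unfold_locales (rule *)
    moreover have "sat mem e p" by (rule soundness[OF that(1) *])
    ultimately show "sat mem e q" by (rule that(2))
  qed
  with assms show ?thesis by blast
qed

theorem theorem9p1:
  fixes J M d N :: nat
    and F :: "nat \<Rightarrow> nat \<Rightarrow> (nat \<Rightarrow> int) set"
    and E :: "nat \<Rightarrow> (nat \<Rightarrow> int) set"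
  assumes "J \<ge> 1" and "M \<ge> 1" and "d \<ge> 1" and "N > M"
    and "\<And>m j. m \<in> {1..M} \<Longrightarrow> j \<in> {1..J} \<Longrightarrow>
           finite (F m j) \<and> F m j \<noteq> {} \<and> F m j \<subseteq> carrier (lattice_group d)"
    and "\<And>m. m \<in> {1..M} \<Longrightarrow> periodic_set (lattice_group d) (E m)"
  shows "(aperiodic_system d J M F E \<longleftrightarrow>
            aperiodic_system (d + 1) J 1 (\<lambda>_. stacked_tile d M F) (\<lambda>_. stacked_set d M N E))
       \<and> (undecidable_system d J M F E \<longleftrightarrow>
            undecidable_system (d + 1) J 1 (\<lambda>_. stacked_tile d M F) (\<lambda>_. stacked_set d M N E))
       \<and> (independent_system d J M F E \<longleftrightarrow>
            independent_system (d + 1) J 1 (\<lambda>_. stacked_tile d M F) (\<lambda>_. stacked_set d M N E))"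
proof -
  let ?F = "\<lambda>_ :: nat. stacked_tile d M F" and ?E = "\<lambda>_ :: nat. stacked_set d M N E"
  let ?cF = "\<lambda>m j. coords d ` F m j" and ?cE = "\<lambda>m. coords d ` E m"
  note tiles = assms(5) and E = assms(6)
  have cF: "?cF m j \<noteq> {} \<and> ?cF m j \<subseteq> {f. length f = d}" if "m \<in> {1..M}" "j \<in> {1..J}" for m j
    using tiles[OF that] by auto
  have cE: "least_period d (E m) > 0 \<and> periodic_list d (least_period d (E m)) (?cE m)"
    if "m \<in> {1..M}" for m
    using least_period[OF E[OF that]] .
  have coords: "(\<lambda>j. coords (Suc d) ` stacked_tile d M F j) = stacked_tiles M ?cF"
    "coords (Suc d) ` stacked_set d M N E = stacked_lists M N ?cE"
    using coords_stacked_tile coords_stacked_set[OF \<open>N > M\<close>] by auto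
  have stacked_fin: "finite (?F m j)" and stacked_carrier: "?F m j \<subseteq> carrier (lattice_group (Suc d))"
    if "j \<in> {1..J}" for m j
    using tiles that by (auto intro!: finite_stacked_tile stacked_tile_carrier del: subsetI)
  have stacked_periodic: "periodic_set (lattice_group (Suc d)) (?E m)" for m
    using \<open>N > M\<close> E by (rule periodic_stacked_set)
  \<comment> \<open>P is indexed by the dimension because the same condition is imposed in
    dimensions d and d + 1. It is used with a trivial P and with the existence of a positive
    period.\<close>
  have solvable: "(\<exists>X. solves_system d J M F E X \<and> (\<forall>j\<in>{1..J}. P d (coords d ` X j))) \<longleftrightarrow>
      (\<exists>X. solves_system (Suc d) J 1 ?F ?E X \<and> (\<forall>j\<in>{1..J}. P (Suc d) (coords (Suc d) ` X j)))"
    if "\<And>A. P d A \<Longrightarrow> P (Suc d) (std.lift_set N A)" "\<And>A. P (Suc d) A \<Longrightarrow> P d (std.slice_set A)"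
    for P :: "nat \<Rightarrow> int list set \<Rightarrow> bool"
  proof -
    have "(\<exists>X. solves_system d J M F E X \<and> (\<forall>j\<in>{1..J}. P d (coords d ` X j))) \<longleftrightarrow>
      (\<exists>Y. (\<forall>j\<in>{1..J}. P d (Y j)) \<and> (\<forall>m\<in>{1..M}. std.tiling d J (?cF m) (std.ext d (?cE m)) Y))"
      using tiles E \<open>M \<ge> 1\<close> by (intro solves_system_iff) blast+
    also have "\<dots> \<longleftrightarrow> (\<exists>Y. (\<forall>j\<in>{1..J}. P (Suc d) (Y j)) \<and>
      std.tiling (Suc d) J (stacked_tiles M ?cF) (std.ext (Suc d) (stacked_lists M N ?cE)) Y)"
      by (rule std.stacking[OF \<open>M \<ge> 1\<close> \<open>N > M\<close> cF cE]) (use that in blast)+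
    also have "\<dots> \<longleftrightarrow>
      (\<exists>X. solves_system (Suc d) J 1 ?F ?E X \<and> (\<forall>j\<in>{1..J}. P (Suc d) (coords (Suc d) ` X j)))"
      using solves_system_iff[of 1 J ?F "Suc d" ?E "P (Suc d)"] stacked_carrier stacked_periodic
      by (simp add: coords)
    finally show ?thesis .
  qed
  \<comment> \<open>An equation already forces the unknowns into the lattice, so that periodicity of
    a solution reduces to the existence of a period.\<close>
  have periodic_iff: "(\<exists>X. solves_system k J M' F' E' X \<and> (\<forall>j\<in>{1..J}. periodic_set (lattice_group k) (X j))) \<longleftrightarrow>
    (\<exists>X. solves_system k J M' F' E' X \<and> (\<forall>j\<in>{1..J}. \<exists>n>0. periodic_list k n (coords k ` X j)))"
    if "M' \<ge> 1" for k M' F' E'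
  proof -
    have "X j \<subseteq> carrier (lattice_group k)" if "solves_system k J M' F' E' X" "j \<in> {1..J}" for X j
      using that \<open>M' \<ge> 1\<close> by (force simp: solves_system_def solves_tile_def)
    then show ?thesis unfolding periodic_set_iff by blast
  qed
  have "aperiodic_system d J M F E \<longleftrightarrow> aperiodic_system (d + 1) J 1 ?F ?E"
  proof -
    have "(\<exists>X. solves_system d J M F E X \<and> (\<forall>j\<in>{1..J}. \<exists>n>0. periodic_list d n (coords d ` X j))) \<longleftrightarrow>
      (\<exists>X. solves_system (Suc d) J 1 ?F ?E X \<and>
        (\<forall>j\<in>{1..J}. \<exists>n>0. periodic_list (Suc d) n (coords (Suc d) ` X j)))"
    proof (rule solvable)
      show "\<exists>n>0. periodic_list (Suc d) n (std.lift_set N A)" if "\<exists>n>0. periodic_list d n A" for A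
        using that periodic_lift_set[of d _ A N] \<open>N > M\<close> by (metis gr0I less_nat_zero_code mult_is_0)
      show "\<exists>n>0. periodic_list d n (std.slice_set A)" if "\<exists>n>0. periodic_list (Suc d) n A" for A
        using that periodic_slice_set by blast
    qed
    then show ?thesis
      using solvable[of "\<lambda>_ _. True"] periodic_iff[OF \<open>M \<ge> 1\<close>, of d F E]
        periodic_iff[of 1 "Suc d" ?F ?E]
      unfolding aperiodic_system_def by simp
  qed
  \<comment> \<open>Both sentences are read as tilings over the integers of the model. Their
    different least periods disappear in \<open>ext\<close>, and internality takes the place of
    periodicity in \<open>stacking\<close>.\<close>
  moreover have sat: "sat mem e (solvable_sentence d J M F E) \<longleftrightarrow>
      sat mem e (solvable_sentence (d + 1) J 1 ?F ?E)"
    if "zfc_model mem" for mem :: "nat \<Rightarrow> nat \<Rightarrow> bool" and e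
  proof -
    interpret zfc_model mem by (rule that)
    have "sat mem e (solvable_sentence d J M F E) \<longleftrightarrow> (\<exists>X. (\<forall>j\<in>{1..J}. internal d (X j)) \<and>
        (\<forall>m\<in>{1..M}. tiling d J (?cF m) (ext d (?cE m)) X))"
      using tiles E by (intro sat_solvable_sentence) blast+
    also have "\<dots> \<longleftrightarrow> (\<exists>X. (\<forall>j\<in>{1..J}. internal (Suc d) (X j)) \<and>
        tiling (Suc d) J (stacked_tiles M ?cF) (ext (Suc d) (stacked_lists M N ?cE)) X)"
      by (rule stacking[OF \<open>M \<ge> 1\<close> \<open>N > M\<close> cF cE])
        (use \<open>N > M\<close> internal_lift_set internal_slice_set in auto)
    also have "\<dots> \<longleftrightarrow> sat mem e (solvable_sentence (d + 1) J 1 ?F ?E)"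
      using sat_solvable_sentence[of 1 J ?F "Suc d" ?E e] stacked_fin stacked_periodic
      by (simp add: coords)
    finally show ?thesis .
  qed
  have "(ZFC \<^bold>\<turnstile> solvable_sentence d J M F E) \<longleftrightarrow> (ZFC \<^bold>\<turnstile> solvable_sentence (d + 1) J 1 ?F ?E)"
    by (rule provable_iff) (rule sat)
  moreover have "(ZFC \<^bold>\<turnstile> (\<^bold>\<not> solvable_sentence d J M F E)) \<longleftrightarrow>
      (ZFC \<^bold>\<turnstile> (\<^bold>\<not> solvable_sentence (d + 1) J 1 ?F ?E))"
    by (rule provable_iff) (simp only: sat_eq.simps sat)
  ultimately show ?thesis
    unfolding undecidable_system_def independent_system_def by blast
qed

end
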